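(* Let $\psi:[0,\infty)\to[0,\infty)$ be a weak $\Phi$-function satisfying (aDec)$_{q_1}$ for some $q_1\ge 1$, where $L\ge1$ is a constant for which both (aInc)$_1$ and (aDec)$_{q_1}$ hold. Let $p\in[1,n)$, $q_2>0$, $\gamma>0$ and $\theta\in[0,1]$ satisfy $$\frac{1}{\gamma}\ge \frac{\theta}{p^*}+\frac{(1-\theta)q_1}{q_2},\qquad p^*:=\frac{np}{n-p}.$$ Then there is $c=c(n,p,L,q_1,q_2)>0$ such that for every ball $B_r\subset\mathbb{R}^n$ of radius $r>0$ and every (real- or vector-valued) $f\in W^{1,1}(B_r)$, $$\bigg(\fint_{B_{r}}\psi\big(\big|\tfrac{f}{r}\big|\big)^\gamma\, dx\bigg)^{\frac1\gamma} \le c \bigg(\fint_{B_r}\left[\psi(|Df|)^p+\psi\big(\big|\tfrac{f}{r}\big|\big)^p\right]dx\bigg)^{\frac{\theta}{p}} \psi\bigg(\Big(\fint_{B_r}\big|\tfrac{f}{r}\big|^{q_2}\,dx\Big)^{\frac1{q_2}}\bigg)^{1-\theta}.$$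
   Context: Here $n\ge2$. $f$ is almost increasing with constant $L\ge1$ if $f(t)\le Lf(s)$ for all $0<t<s<\infty$; almost decreasing is defined analogously. (aInc)$_p$ with constant $L$: $t\mapsto\psi(t)/t^p$ is almost increasing on $(0,\infty)$ with constant $L$. (aDec)$_q$ with constant $L$: $t\mapsto\psi(t)/t^q$ is almost decreasing on $(0,\infty)$ with constant $L$. A weak $\Phi$-function is an increasing (non-decreasing) function $\psi$ on $[0,\infty)$ with $\psi(0)=0$, $\lim_{t\to0^+}\psi(t)=0$, $\lim_{t\to\infty}\psi(t)=\infty$, satisfying (aInc)$_1$. $\fint_U$ denotes the integral average. Integrals may be infinite (with $\psi(\infty):=\infty$); a factor raised to the power $0$ is read as $1$. *)

theory Defs
  imports "HOL-Analysis.Analysis"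
begin

subsection \<open>Growth conditions and weak Phi-functions\<close>

definition almost_increasing :: "real \<Rightarrow> (real \<Rightarrow> real) \<Rightarrow> bool" where
  "almost_increasing L f \<longleftrightarrow> L \<ge> 1 \<and> (\<forall>t s. 0 < t \<longrightarrow> t < s \<longrightarrow> f t \<le> L * f s)"

definition almost_decreasing :: "real \<Rightarrow> (real \<Rightarrow> real) \<Rightarrow> bool" where
  "almost_decreasing L f \<longleftrightarrow> L \<ge> 1 \<and> (\<forall>t s. 0 < t \<longrightarrow> t < s \<longrightarrow> f s \<le> L * f t)"

definition aInc :: "real \<Rightarrow> real \<Rightarrow> (real \<Rightarrow> real) \<Rightarrow> bool" where
  "aInc p L \<psi> \<longleftrightarrow> almost_increasing L (\<lambda>t. \<psi> t / t powr p)"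

definition aDec :: "real \<Rightarrow> real \<Rightarrow> (real \<Rightarrow> real) \<Rightarrow> bool" where
  "aDec q L \<psi> \<longleftrightarrow> almost_decreasing L (\<lambda>t. \<psi> t / t powr q)"

text \<open>
  A function on the half-line is a total function on the reals whose values at negative
  arguments are irrelevant.
\<close>

definition weak_Phi :: "(real \<Rightarrow> real) \<Rightarrow> bool" where
  "weak_Phi \<psi> \<longleftrightarrow>
     mono_on {0..} \<psi> \<and> \<psi> 0 = 0 \<and> (\<forall>t\<ge>0. \<psi> t \<ge> 0) \<and>
     (\<psi> \<longlongrightarrow> 0) (at_right 0) \<and> filterlim \<psi> at_top at_top \<and>
     (\<exists>L. aInc 1 L \<psi>)"

subsection \<open>Values in the extended half-line\<close>

text \<open>The extension of a function on the half-line by the value \<open>\<infinity>\<close> at \<open>\<infinity>\<close>.\<close>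

definition ext_infty :: "(real \<Rightarrow> real) \<Rightarrow> ennreal \<Rightarrow> ennreal" where
  "ext_infty \<psi> x = (if x = \<infinity> then \<infinity> else ennreal (\<psi> (enn2real x)))"

text \<open>
  Powers with exponent \<open>a \<ge> 0\<close>. The exponent \<open>0\<close> gives \<open>1\<close> for every base, including
  \<open>0\<close> (where the real power \<open>0 powr 0\<close> would be \<open>0\<close>) and \<open>\<infinity>\<close>.
\<close>

definition epow :: "ennreal \<Rightarrow> real \<Rightarrow> ennreal" where
  "epow x a = (if a = 0 then 1 else if x = \<infinity> then \<infinity> else ennreal (enn2real x powr a))"

definition average :: "'a::euclidean_space set \<Rightarrow> ('a \<Rightarrow> ennreal) \<Rightarrow> ennreal" where
  "average U g = (\<integral>\<^sup>+x\<in>U. g x \<partial>lebesgue) / emeasure lebesgue U"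

subsection \<open>Weak gradients and the Sobolev space of order one\<close>

primrec Ck :: "nat \<Rightarrow> ('a::euclidean_space \<Rightarrow> real) \<Rightarrow> bool" where
  "Ck 0 \<phi> \<longleftrightarrow> continuous_on UNIV \<phi>"
| "Ck (Suc k) \<phi> \<longleftrightarrow>
     \<phi> differentiable_on UNIV \<and>
     (\<forall>b\<in>Basis. Ck k (\<lambda>x. frechet_derivative \<phi> (at x) b))"

definition test_function :: "'a::euclidean_space set \<Rightarrow> ('a \<Rightarrow> real) \<Rightarrow> bool" where
  "test_function U \<phi> \<longleftrightarrow>
     (\<forall>k. Ck k \<phi>) \<and> compact (closure {x. \<phi> x \<noteq> 0}) \<and> closure {x. \<phi> x \<noteq> 0} \<subseteq> U"

definition locally_integrable_on ::
  "('a::euclidean_space \<Rightarrow> 'b::euclidean_space) \<Rightarrow> 'a set \<Rightarrow> bool" where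
  "locally_integrable_on u U \<longleftrightarrow> (\<forall>K. compact K \<and> K \<subseteq> U \<longrightarrow> u absolutely_integrable_on K)"

definition weak_gradient ::
  "'a::euclidean_space set \<Rightarrow> ('a \<Rightarrow> real) \<Rightarrow> ('a \<Rightarrow> 'a) \<Rightarrow> bool" where
  "weak_gradient U u G \<longleftrightarrow>
     locally_integrable_on u U \<and> locally_integrable_on G U \<and>
     (\<forall>\<phi>. test_function U \<phi> \<longrightarrow> (\<forall>b\<in>Basis.
        (LINT x:U|lebesgue. u x * frechet_derivative \<phi> (at x) b)
          = - (LINT x:U|lebesgue. (G x \<bullet> b) * \<phi> x)))"

definition W11 :: "'a::euclidean_space set \<Rightarrow> ('a \<Rightarrow> real) set" where
  "W11 U = {u. u absolutely_integrable_on U \<and>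
               (\<exists>G. weak_gradient U u G \<and> G absolutely_integrable_on U)}"

text \<open>
  An \<open>N\<close>-vector-valued function is a family \<open>f x i\<close> with \<open>i < N\<close>, and its weak derivative
  is the family \<open>Df x i\<close> of the weak gradients of the components. Keeping \<open>N\<close> a number
  rather than a type allows a constant that does not depend on \<open>N\<close>. Both \<open>|f|\<close> and
  \<open>|Df|\<close> are Euclidean, the latter being the Frobenius norm of the derivative matrix.
\<close>

definition vec_W11 :: "'a::euclidean_space set \<Rightarrow> nat \<Rightarrow> ('a \<Rightarrow> nat \<Rightarrow> real) set" where
  "vec_W11 U N = {f. \<forall>i<N. (\<lambda>x. f x i) \<in> W11 U}"

definition weak_derivative ::
  "'a::euclidean_space set \<Rightarrow> nat \<Rightarrow> ('a \<Rightarrow> nat \<Rightarrow> real) \<Rightarrow> ('a \<Rightarrow> nat \<Rightarrow> 'a) \<Rightarrow> bool" where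
  "weak_derivative U N f Df \<longleftrightarrow> (\<forall>i<N. weak_gradient U (\<lambda>x. f x i) (\<lambda>x. Df x i))"

definition vec_norm :: "nat \<Rightarrow> (nat \<Rightarrow> real) \<Rightarrow> real" where
  "vec_norm N v = L2_set v {..<N}"

definition mat_norm :: "nat \<Rightarrow> (nat \<Rightarrow> 'a::euclidean_space) \<Rightarrow> real" where
  "mat_norm N A = L2_set (\<lambda>i. norm (A i)) {..<N}"

end

theory Submission
  imports Defs
begin

text \<open>
  By Lyapunov's inequality for \<open>\<psi>(|f / r|)\<close> it suffices to treat \<open>\<theta> = 1\<close> and \<open>\<theta> = 0\<close>.
  For \<open>\<theta> = 0\<close> the bound follows from \<open>\<psi> t \<le> L \<psi> m (1 + (t / m) powr q\<^sub>1)\<close>, where \<open>m\<close> is the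
  mean of order \<open>q\<^sub>2\<close> of \<open>|f / r|\<close>. For \<open>\<theta> = 1\<close> it is a Sobolev inequality for
  \<open>\<Phi>(|f / r|)\<close>, with a convex \<open>\<Phi>\<close> comparable to \<open>\<psi>\<close>. When \<open>f\<close> is smooth, this
  follows from Gagliardo's slicing argument, where each point of the ball is the end of segments
  in \<open>n\<close> sheared directions that stay in the ball, and from
  \<open>\<Phi>(t) / t * |Df| \<le> \<Phi>(t) + \<Phi>(|Df|)\<close>. The general case follows by mollification, with Jensen's
  inequality on the right-hand side and Fatou's lemma on the left-hand side.
\<close>

subsection \<open>Powers of extended reals and Hoelder's inequality\<close>

text \<open>The mean of \<psi>(|f / r|)^p on the right replaces a Poincare inequality: it pays for a
  cutoff along each segment, so neither mean values nor boundary values of f enter. The power p* is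
  reached from the case p = 1 by applying that case to a power of \<Psi>(|f|). This puts the same
  integral on both sides, and it must be finite to be absorbed; continuity on a compact ball
  provides that. Two defects of smoothness are repaired on the way: |f| becomes the square root of
  |f|^2 + \<kappa>^2, and \<Phi> becomes its average \<Psi>, which doubling keeps comparable to
  \<Phi>. Mollification at x sees a cube with corner x, because almost everywhere convergence is
  drawn from the differentiation theorem for such cubes. It makes sense only on smaller balls of
  radius \<rho>, and with r \<le> 2 \<rho> the return to radius r costs constants only. At the end
  the constants of the two extreme cases are raised to the powers \<theta> and 1 - \<theta>; taking
  the maximum with 1 removes the dependence on \<theta> and \<gamma>.\<close>

lemma epow_0 [simp]: "epow x 0 = 1"
  by (simp add: epow_def)

lemma epow_one [simp]: "epow 1 a = 1"
  by (simp add: epow_def)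

lemma epow_ennreal: "0 \<le> x \<Longrightarrow> 0 < a \<Longrightarrow> epow (ennreal x) a = ennreal (x powr a)"
  by (simp add: epow_def)

lemma epow_zero [simp]: "0 < a \<Longrightarrow> epow 0 a = 0"
  by (simp add: epow_def)

lemma epow_top [simp]: "0 < a \<Longrightarrow> epow \<infinity> a = \<infinity>" "0 < a \<Longrightarrow> epow top a = top"
  by (simp_all add: epow_def)

lemma epow_mono: "x \<le> y \<Longrightarrow> 0 \<le> a \<Longrightarrow> epow x a \<le> epow y a"
  by (cases x; cases y) (auto simp: epow_def powr_mono2 top_unique)

lemma epow_mult: "0 \<le> a \<Longrightarrow> epow (x * y) a = epow x a * epow y a"
  by (cases x; cases y)
     (auto simp: epow_def powr_mult ennreal_mult[symmetric] ennreal_mult_top ennreal_top_mult)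

lemma epow_add: "0 \<le> a \<Longrightarrow> 0 \<le> b \<Longrightarrow> epow x (a + b) = epow x a * epow x b"
  by (cases x)
     (auto simp: epow_def powr_add ennreal_mult[symmetric] ennreal_mult_top ennreal_top_mult)

lemma epow_epow: "0 \<le> a \<Longrightarrow> 0 \<le> b \<Longrightarrow> epow (epow x a) b = epow x (a * b)"
  by (cases x) (auto simp: epow_def powr_powr)

lemma epow_1 [simp]: "epow x 1 = x"
  by (cases x) (auto simp: epow_def)

lemma epow_eq_0_iff: "0 < a \<Longrightarrow> epow x a = 0 \<longleftrightarrow> x = 0"
  by (cases x) (auto simp: epow_def)

lemma measurable_epow [measurable]:
  assumes [measurable]: "f \<in> borel_measurable M"
  shows "(\<lambda>x. epow (f x) a) \<in> borel_measurable M"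
  unfolding epow_def by measurable

lemma epow_prod:
  assumes "finite I" "\<And>i. i \<in> I \<Longrightarrow> 0 \<le> a i"
  shows "(\<Sum>i\<in>I. a i) = s \<Longrightarrow> (\<Prod>i\<in>I. epow x (a i)) = epow x s"
  using assms
  by (induction I arbitrary: s rule: finite_induct) (auto simp: epow_add sum_nonneg)

lemma weighted_arith_geom_mean:
  fixes x :: "'i \<Rightarrow> real"
  assumes I: "finite I" and a: "\<And>i. i \<in> I \<Longrightarrow> 0 < a i" "(\<Sum>i\<in>I. a i) = 1"
    and x: "\<And>i. i \<in> I \<Longrightarrow> 0 \<le> x i"
  shows "(\<Prod>i\<in>I. x i powr a i) \<le> (\<Sum>i\<in>I. a i * x i)"
proof (cases "\<exists>i\<in>I. x i = 0")
  case True
  then have "(\<Prod>i\<in>I. x i powr a i) = 0" using I by (auto intro!: prod_zero)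
  moreover have "0 \<le> (\<Sum>i\<in>I. a i * x i)"
    by (rule sum_nonneg) (use a x less_imp_le in \<open>auto intro!: mult_nonneg_nonneg\<close>)
  ultimately show ?thesis by simp
next
  case False
  then have pos: "\<And>i. i \<in> I \<Longrightarrow> 0 < x i" using x by (metis less_eq_real_def)
  have ne: "I \<noteq> {}" using a by auto
  have "(\<Sum>i\<in>I. a i * ln (x i)) \<le> ln (\<Sum>i\<in>I. a i *\<^sub>R x i)"
    by (rule concave_on_sum[OF I ne ln_concave]) (use a pos less_imp_le in auto)
  moreover have "0 < (\<Sum>i\<in>I. a i * x i)" by (rule sum_pos) (use I ne a pos in auto)
  ultimately have "exp (\<Sum>i\<in>I. a i * ln (x i)) \<le> (\<Sum>i\<in>I. a i * x i)"
    by (simp add: ln_ge_iff)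
  moreover have "exp (\<Sum>i\<in>I. a i * ln (x i)) = (\<Prod>i\<in>I. x i powr a i)"
    unfolding exp_sum[OF I] by (rule prod.cong) (use pos in \<open>force simp: powr_def\<close>)+
  ultimately show ?thesis by simp
qed

text \<open>An infinite entry makes the right-hand side infinite because its weight is positive;
  otherwise all entries are real numbers.\<close>

lemma prod_epow_le_sum:
  fixes x :: "'i \<Rightarrow> ennreal"
  assumes I: "finite I" and a: "\<And>i. i \<in> I \<Longrightarrow> 0 < a i" "(\<Sum>i\<in>I. a i) = 1"
  shows "(\<Prod>i\<in>I. epow (x i) (a i)) \<le> (\<Sum>i\<in>I. ennreal (a i) * x i)"
proof (cases "\<exists>i\<in>I. x i = \<infinity>")
  case True
  then obtain i where i: "i \<in> I" "x i = \<infinity>" by auto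
  then have "ennreal (a i) * x i = \<infinity>" using a(1)[of i] by (simp add: ennreal_mult_top)
  then have "(\<Sum>i\<in>I. ennreal (a i) * x i) = \<infinity>"
    using i I by (auto simp: sum.remove)
  then show ?thesis by simp
next
  case False
  then have x: "\<And>i. i \<in> I \<Longrightarrow> x i = ennreal (enn2real (x i))"
    by (auto simp: less_top[symmetric])
  have "(\<Prod>i\<in>I. epow (x i) (a i)) = (\<Prod>i\<in>I. ennreal (enn2real (x i) powr a i))"
    by (rule prod.cong) (use False a(1) in \<open>force simp: epow_def\<close>)+
  also have "\<dots> = ennreal (\<Prod>i\<in>I. enn2real (x i) powr a i)"
    by (simp add: prod_ennreal)
  also have "\<dots> \<le> ennreal (\<Sum>i\<in>I. a i * enn2real (x i))"
    by (intro ennreal_leI weighted_arith_geom_mean) (use I a in auto)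
  also have "\<dots> = (\<Sum>i\<in>I. ennreal (a i * enn2real (x i)))"
    by (rule sum_ennreal[symmetric]) (use a(1) less_imp_le in \<open>auto intro!: mult_nonneg_nonneg\<close>)
  also have "\<dots> = (\<Sum>i\<in>I. ennreal (a i) * x i)"
    by (rule sum.cong) (use a x in \<open>auto simp: ennreal_mult less_imp_le\<close>)
  finally show ?thesis .
qed

text \<open>Each function is divided by its integral; the inequality of weighted means, applied
  pointwise and integrated, then yields the sum of the weights, which is 1. Integrals 0 or
  \<infinity> forbid the division: a zero integral makes the product vanish almost everywhere, and
  an infinite one, when none is 0, makes the bound infinite.\<close>

lemma Holder_pos:
  fixes f :: "'i \<Rightarrow> 'a \<Rightarrow> ennreal"
  assumes I: "finite I" and a: "\<And>i. i \<in> I \<Longrightarrow> 0 < a i" "(\<Sum>i\<in>I. a i) = 1"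
    and [measurable]: "\<And>i. i \<in> I \<Longrightarrow> f i \<in> borel_measurable M"
  shows "(\<integral>\<^sup>+x. (\<Prod>i\<in>I. epow (f i x) (a i)) \<partial>M) \<le> (\<Prod>i\<in>I. epow (\<integral>\<^sup>+x. f i x \<partial>M) (a i))"
proof -
  define A where "A i = (\<integral>\<^sup>+x. f i x \<partial>M)" for i
  consider "\<exists>i\<in>I. A i = 0" | "\<forall>i\<in>I. A i \<noteq> 0" "\<exists>i\<in>I. A i = \<infinity>"
    | "\<forall>i\<in>I. A i \<noteq> 0 \<and> A i \<noteq> \<infinity>" by auto
  then show ?thesis
  proof cases
    case 1
    then obtain i where i: "i \<in> I" "A i = 0" by auto
    then have "AE x in M. f i x = 0"
      by (simp add: A_def nn_integral_0_iff_AE)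
    then have "AE x in M. (\<Prod>i\<in>I. epow (f i x) (a i)) = 0"
      by eventually_elim (use i I a in \<open>auto intro!: prod_zero bexI[of _ i]\<close>)
    then have "(\<integral>\<^sup>+x. (\<Prod>i\<in>I. epow (f i x) (a i)) \<partial>M) = (\<integral>\<^sup>+x. 0 \<partial>M)"
      by (rule nn_integral_cong_AE)
    then show ?thesis by simp
  next
    case 2
    then obtain i where i: "i \<in> I" "A i = \<infinity>" by auto
    have "(\<Prod>i\<in>I-{i}. epow (A i) (a i)) \<noteq> 0"
      using 2 I a by (auto simp: epow_eq_0_iff)
    then have "(\<Prod>i\<in>I. epow (A i) (a i)) = \<infinity>"
      using i I a by (auto simp: prod.remove[of I i] ennreal_top_mult)
    then show ?thesis by (simp add: A_def)
  next
    case 3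
    define P where "P = (\<Prod>i\<in>I. epow (A i) (a i))"
    have 1: "(\<Prod>i\<in>I. epow (f i x) (a i)) \<le> P * (\<Sum>i\<in>I. ennreal (a i) * (f i x / A i))" for x
    proof -
      have "(\<Prod>i\<in>I. epow (f i x) (a i)) = (\<Prod>i\<in>I. epow (A i * (f i x / A i)) (a i))"
      proof (rule prod.cong)
        fix i assume "i \<in> I"
        then have "A i * (f i x / A i) = f i x"
          using 3 by (metis ennreal_mult_divide_eq ennreal_times_divide infinity_ennreal_def mult.commute)
        then show "epow (f i x) (a i) = epow (A i * (f i x / A i)) (a i)" by simp
      qed simp
      also have "\<dots> = P * (\<Prod>i\<in>I. epow (f i x / A i) (a i))"
        unfolding P_def prod.distrib[symmetric]
        by (rule prod.cong) (use a in \<open>auto simp: epow_mult less_imp_le\<close>)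
      also have "\<dots> \<le> P * (\<Sum>i\<in>I. ennreal (a i) * (f i x / A i))"
        by (intro mult_left_mono prod_epow_le_sum) (use I a in auto)
      finally show ?thesis .
    qed
    have "(\<integral>\<^sup>+x. (\<Prod>i\<in>I. epow (f i x) (a i)) \<partial>M)
        \<le> (\<integral>\<^sup>+x. P * (\<Sum>i\<in>I. ennreal (a i) * (f i x / A i)) \<partial>M)"
      by (intro nn_integral_mono 1)
    also have "\<dots> = P * (\<Sum>i\<in>I. ennreal (a i) * (A i / A i))"
      by (subst nn_integral_cmult)
         (auto simp: nn_integral_sum nn_integral_cmult nn_integral_divide A_def)
    also have "\<dots> = P * (\<Sum>i\<in>I. ennreal (a i))"
      using 3 by (auto intro!: arg_cong2[where f="(*)"] sum.cong simp: ennreal_divide_self less_top)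
    also have "\<dots> = P" using a by (simp add: sum_ennreal less_imp_le)
    finally show ?thesis by (simp add: P_def A_def)
  qed
qed

text \<open>Zero exponents can be discarded since \<open>epow\<close> gives 1 even for the bases 0
  and \<infinity>. They do occur: at the first step of the Gagliardo induction, for p = 1, and at
  the end points of the interpolation.\<close>

lemma Holder_epow:
  fixes f :: "'i \<Rightarrow> 'a \<Rightarrow> ennreal"
  assumes I: "finite I" and a: "\<And>i. i \<in> I \<Longrightarrow> 0 \<le> a i" "(\<Sum>i\<in>I. a i) = 1"
    and m [measurable]: "\<And>i. i \<in> I \<Longrightarrow> f i \<in> borel_measurable M"
  shows "(\<integral>\<^sup>+x. (\<Prod>i\<in>I. epow (f i x) (a i)) \<partial>M) \<le> (\<Prod>i\<in>I. epow (\<integral>\<^sup>+x. f i x \<partial>M) (a i))"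
proof -
  define J where "J = {i\<in>I. a i \<noteq> 0}"
  have J: "finite J" "J \<subseteq> I" using I by (auto simp: J_def)
  have e: "(\<Prod>i\<in>I. epow (h i) (a i)) = (\<Prod>i\<in>J. epow (h i) (a i))" for h
    by (rule prod.mono_neutral_right) (use I in \<open>auto simp: J_def\<close>)
  have "(\<Sum>i\<in>J. a i) = (\<Sum>i\<in>I. a i)"
    by (rule sum.mono_neutral_left) (use I in \<open>auto simp: J_def\<close>)
  then show ?thesis
    unfolding e by (intro Holder_pos) (use J a m in \<open>auto simp: J_def less_le\<close>)
qed

lemma Holder2_epow:
  assumes "0 \<le> a" "0 \<le> b" "a + b = 1"
    and [measurable]: "f \<in> borel_measurable M" "g \<in> borel_measurable M"
  shows "(\<integral>\<^sup>+x. epow (f x) a * epow (g x) b \<partial>M) \<le> epow (\<integral>\<^sup>+x. f x \<partial>M) a * epow (\<integral>\<^sup>+x. g x \<partial>M) b"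
  using Holder_epow[of "{True, False}" "\<lambda>i. if i then a else b" "\<lambda>i. if i then f else g" M] assms
  by simp

subsection \<open>Young functions\<close>

text \<open>Young functions are extended by \<open>0\<close> to the negative half-line, which makes them convex on \<open>UNIV\<close>.\<close>

locale doubling_young =
  fixes \<Phi> :: "real \<Rightarrow> real" and D :: real
  assumes conv: "convex_on UNIV \<Phi>"
    and nonpos: "\<And>t. t \<le> 0 \<Longrightarrow> \<Phi> t = 0"
    and pos: "\<And>t. 0 < t \<Longrightarrow> 0 < \<Phi> t"
    and doubling: "\<And>t. 0 \<le> t \<Longrightarrow> \<Phi> (2 * t) \<le> D * \<Phi> t"
begin

lemma nonneg: "0 \<le> \<Phi> t"
  using pos[of t] nonpos[of t] by (cases "t \<le> 0") auto

text \<open>Since \<Phi> vanishes at 0, convexity places its graph below the chord from the origin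
  to the point over \<open>b\<close>.\<close>

lemma quotient_mono:
  assumes "0 < a" "a \<le> b"
  shows "\<Phi> a / a \<le> \<Phi> b / b"
proof -
  have "\<Phi> ((1 - a / b) *\<^sub>R 0 + (a / b) *\<^sub>R b) \<le> (1 - a / b) * \<Phi> 0 + (a / b) * \<Phi> b"
    by (rule convex_onD[OF conv]) (use assms in auto)
  then have "\<Phi> a \<le> a / b * \<Phi> b" using assms nonpos[of 0] by simp
  then show ?thesis using assms by (simp add: field_simps)
qed

lemma mono: "a \<le> b \<Longrightarrow> \<Phi> a \<le> \<Phi> b"
proof (cases "0 < a")
  case True
  assume ab: "a \<le> b"
  have "\<Phi> a = a * (\<Phi> a / a)" using True by simp
  also have "\<dots> \<le> b * (\<Phi> b / b)"
    using ab True nonneg by (intro mult_mono quotient_mono) auto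
  also have "\<dots> = \<Phi> b" using ab True by simp
  finally show ?thesis .
next
  case False
  then show ?thesis using nonpos nonneg by simp
qed

lemma cont: "continuous_on A \<Phi>"
  using convex_on_continuous[OF open_UNIV conv] continuous_on_subset by blast

lemma isCont: "isCont \<Phi> x"
  using cont[of UNIV] by (simp add: continuous_on_eq_continuous_at)

lemma measurable_Phi [measurable]: "\<Phi> \<in> borel_measurable borel"
  using cont by (rule borel_measurable_continuous_onI)

lemma D_ge_1: "1 \<le> D"
proof -
  have "\<Phi> 1 \<le> D * \<Phi> 1" using mono[of 1 2] doubling[of 1] by simp
  then show ?thesis using pos[of 1] by simp
qed

lemma add_le: "\<Phi> (a + b) \<le> D * \<Phi> a + D * \<Phi> b"
proof -
  have "\<Phi> (a + b) \<le> \<Phi> (2 * max 0 (max a b))" by (rule mono) auto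
  also have "\<dots> \<le> D * \<Phi> (max 0 (max a b))" by (rule doubling) auto
  also have "\<dots> \<le> D * (\<Phi> a + \<Phi> b)"
    using D_ge_1 nonneg[of a] nonneg[of b] nonpos[of 0]
    by (intro mult_left_mono) (auto simp: max_def)
  finally show ?thesis by (simp add: algebra_simps)
qed

text \<open>Averaging \<open>\<Phi>\<close> over \<open>[0, t]\<close> makes it differentiable, as the chain rule requires.\<close>

definition \<Psi> :: "real \<Rightarrow> real" where
  "\<Psi> t = integral {0..t} \<Phi> / t"

definition \<Psi>' :: "real \<Rightarrow> real" where
  "\<Psi>' t = (\<Phi> t - \<Psi> t) / t"

lemma intble: "\<Phi> integrable_on {a..b}"
  by (rule integrable_continuous_real[OF cont])

lemma Psi_le: "0 < t \<Longrightarrow> \<Psi> t \<le> \<Phi> t"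
proof -
  assume t: "0 < t"
  have "integral {0..t} \<Phi> \<le> integral {0..t} (\<lambda>_. \<Phi> t)"
    by (rule integral_le) (auto intro: intble mono)
  then show ?thesis using t by (simp add: \<Psi>_def field_simps)
qed

text \<open>Only the upper half of the interval is kept. With \<open>Psi_le\<close> and doubling
  this shows that averaging changes \<Phi> by a bounded factor at most.\<close>

lemma Psi_ge: "0 < t \<Longrightarrow> \<Phi> (t / 2) / 2 \<le> \<Psi> t"
proof -
  assume t: "0 < t"
  have "integral {t/2..t} (\<lambda>_. \<Phi> (t/2)) \<le> integral {t/2..t} \<Phi>"
    by (rule integral_le) (auto intro: intble mono)
  also have "\<dots> \<le> integral {0..t} \<Phi>"
    by (rule integral_subset_le) (use t nonneg intble in auto)
  finally show ?thesis using t by (simp add: \<Psi>_def field_simps)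
qed

lemma Psi_pos: "0 < t \<Longrightarrow> 0 < \<Psi> t"
  using Psi_ge[of t] pos[of "t/2"] by simp

lemma Psi'_nonneg: "0 < t \<Longrightarrow> 0 \<le> \<Psi>' t"
  using Psi_le[of t] by (simp add: \<Psi>'_def)

lemma Psi'_le: "0 < t \<Longrightarrow> \<Psi>' t \<le> \<Phi> t / t"
  using Psi_pos[of t] by (simp add: \<Psi>'_def field_simps)

lemma Psi_deriv: "0 < t \<Longrightarrow> (\<Psi> has_real_derivative \<Psi>' t) (at t)"
proof -
  assume t: "0 < t"
  have "((\<lambda>u. integral {0..u} \<Phi>) has_real_derivative \<Phi> t) (at t within {0..t + 1})"
    by (rule integral_has_real_derivative) (use t cont in auto)
  then have d: "((\<lambda>u. integral {0..u} \<Phi>) has_real_derivative \<Phi> t) (at t)"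
    using at_within_Icc_at[of 0 t "t+1"] t by simp
  have "((\<lambda>u. integral {0..u} \<Phi> / u) has_real_derivative
      (\<Phi> t * t - integral {0..t} \<Phi> * 1) / (t * t)) (at t)"
    by (rule DERIV_divide[OF d DERIV_ident]) (use t in auto)
  moreover have "(\<Phi> t * t - integral {0..t} \<Phi> * 1) / (t * t) = \<Psi>' t"
    using t by (simp add: \<Psi>'_def \<Psi>_def field_simps)
  ultimately show ?thesis by (simp add: \<Psi>_def[abs_def])
qed

lemma Psi_cont: "continuous_on {0<..} \<Psi>"
  using Psi_deriv by (auto intro!: continuous_at_imp_continuous_on DERIV_isCont)

lemma Psi'_cont: "continuous_on {0<..} \<Psi>'"
  unfolding \<Psi>'_def[abs_def] by (intro continuous_intros cont Psi_cont) auto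

text \<open>The product splits because \<open>\<Phi> t / t\<close> is increasing: replace the smaller of \<open>a\<close> and \<open>b\<close> by the larger.\<close>

lemma quotient_mult_le:
  assumes "0 < a" "0 \<le> b"
  shows "\<Phi> a / a * b \<le> \<Phi> a + \<Phi> b"
proof (cases "b \<le> a")
  case True
  have "\<Phi> a / a * b \<le> \<Phi> a / a * a"
    using True assms nonneg[of a] by (intro mult_left_mono) auto
  then show ?thesis using assms nonneg[of b] by simp
next
  case False
  then have "\<Phi> a / a * b \<le> \<Phi> b / b * b"
    using assms by (intro mult_right_mono quotient_mono) auto
  then show ?thesis using False assms nonneg[of a] by simp
qed

text \<open>Jensen's inequality will be applied to \<open>\<Phi> t powr p\<close>, a nondecreasing
  convex function of a convex one. Convexity of the power at the end point 0 is checked by hand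
  through \<open>u powr p \<le> u\<close> on the unit interval.\<close>

lemma powr_convex_on:
  assumes p: "1 \<le> p"
  shows "convex_on UNIV (\<lambda>t. \<Phi> t powr p)"
proof (rule convex_onI)
  fix t x y :: real assume t: "0 < t" "t < 1"
  have cv: "convex_on {0..} (\<lambda>x::real. x powr p)"
  proof (rule convex_onI)
    fix t x y :: real assume t: "0 < t" "t < 1" and x: "x \<in> {0..}" "y \<in> {0..}"
    have pw: "u powr p \<le> u" if "0 < u" "u < 1" for u :: real
      using that p powr_mono'[of 1 p u] by simp
    consider "x = 0" | "y = 0" | "0 < x" "0 < y" using x by fastforce
    then show "((1 - t) *\<^sub>R x + t *\<^sub>R y) powr p \<le> (1 - t) * x powr p + t * y powr p"
    proof cases
      case 1 then show ?thesis using t p x pw[of t] by (simp add: powr_mult mult_right_mono)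
    next
      case 2 then show ?thesis using t p x pw[of "1-t"] by (simp add: powr_mult mult_right_mono)
    next
      case 3 then show ?thesis using convex_onD[OF powr_convex[OF p], of t x y] t by simp
    qed
  qed auto
  have "\<Phi> ((1 - t) *\<^sub>R x + t *\<^sub>R y) powr p \<le> ((1 - t) *\<^sub>R \<Phi> x + t *\<^sub>R \<Phi> y) powr p"
    using convex_onD[OF conv, of t x y] t p nonneg by (intro powr_mono2) auto
  also have "\<dots> \<le> (1 - t) * \<Phi> x powr p + t * \<Phi> y powr p"
    using convex_onD[OF cv, of t "\<Phi> x" "\<Phi> y"] t nonneg by simp
  finally show "\<Phi> ((1 - t) *\<^sub>R x + t *\<^sub>R y) powr p \<le> (1 - t) * \<Phi> x powr p + t * \<Phi> y powr p" .
qed auto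

end

text \<open>
  A supremum of affine functions comparable to \<open>\<psi>\<close>: convexity is immediate, the choice
  \<open>s = t / 2\<close> gives the lower bound by (aDec), and (aInc) gives the upper bound.
\<close>

definition young_of :: "(real \<Rightarrow> real) \<Rightarrow> real \<Rightarrow> real" where
  "young_of \<psi> t = (SUP s\<in>{0<..}. \<psi> s / s * max 0 (t - s))"

section \<open>Comparison of \<psi> with its convex replacement\<close>

context
  fixes \<psi> :: "real \<Rightarrow> real" and L q :: real
  assumes weak: "weak_Phi \<psi>" and inc: "aInc 1 L \<psi>" and dec: "aDec q L \<psi>" and q: "0 \<le> q"
begin

lemma psi_mono: "0 \<le> a \<Longrightarrow> a \<le> b \<Longrightarrow> \<psi> a \<le> \<psi> b"
  using weak by (auto simp: weak_Phi_def mono_on_def)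

lemma psi_zero: "\<psi> 0 = 0" and psi_nonneg: "0 \<le> t \<Longrightarrow> 0 \<le> \<psi> t"
  using weak by (auto simp: weak_Phi_def)

lemma aInc_const_ge_1: "1 \<le> L"
  using inc by (auto simp: aInc_def almost_increasing_def)

lemma psi_inc: "0 < t \<Longrightarrow> t \<le> s \<Longrightarrow> \<psi> t / t \<le> L * (\<psi> s / s)"
  using inc aInc_const_ge_1 psi_nonneg[of t] mult_right_mono[of 1 L "\<psi> t / t"]
  by (cases "t = s") (auto simp: aInc_def almost_increasing_def)

lemma psi_dec: "0 < t \<Longrightarrow> t \<le> s \<Longrightarrow> \<psi> s \<le> L * \<psi> t * (s / t) powr q"
proof (cases "t = s")
  case True
  assume "0 < t" then show ?thesis
    using aInc_const_ge_1 psi_nonneg[of t] mult_right_mono[of 1 L "\<psi> t"] True by simp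
next
  case False
  assume "0 < t" "t \<le> s"
  with False have "\<psi> s / s powr q \<le> L * (\<psi> t / t powr q)"
    using dec by (auto simp: aDec_def almost_decreasing_def)
  then show ?thesis using \<open>0 < t\<close> \<open>t \<le> s\<close> by (simp add: powr_divide field_simps)
qed

text \<open>A weak Phi-function may vanish near 0, but not under (aDec): it is positive somewhere
  beyond \<open>t\<close> because it tends to \<infinity>, and (aDec) bounds that value by a
  multiple of \<psi> t.\<close>

lemma psi_pos: assumes "0 < t" shows "0 < \<psi> t"
proof -
  have "filterlim \<psi> at_top at_top" using weak by (auto simp: weak_Phi_def)
  then have "eventually (\<lambda>s. 0 < \<psi> s \<and> t \<le> s) at_top"
    by (auto simp: filterlim_at_top_dense eventually_conj_iff eventually_ge_at_top)
  then obtain s where "0 < \<psi> s" "t \<le> s" by (auto simp: eventually_at_top_linorder)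
  then have "0 < L * \<psi> t * (s / t) powr q" using psi_dec[of t s] assms by linarith
  then show ?thesis using aInc_const_ge_1 psi_nonneg[of t] assms
    by (cases "\<psi> t = 0") auto
qed

lemma psi_le_sum:
  assumes "0 < s" "0 \<le> t"
  shows "\<psi> t \<le> L * \<psi> s * (1 + (t / s) powr q)"
proof (cases "s \<le> t")
  case True
  then show ?thesis using psi_dec[of s t] assms psi_nonneg[of s] aInc_const_ge_1
    by (simp add: distrib_left add_increasing)
next
  case False
  then have "\<psi> t \<le> 1 * \<psi> s * 1" using assms psi_mono by simp
  also have "\<dots> \<le> L * \<psi> s * (1 + (t / s) powr q)"
    using aInc_const_ge_1 psi_nonneg[of s] assms by (intro mult_mono) auto
  finally show ?thesis .
qed

lemma young_term_le: "0 < s \<Longrightarrow> \<psi> s / s * max 0 (t - s) \<le> L * \<psi> (max 0 t)"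
proof (cases "s < t")
  case True
  assume s: "0 < s"
  have "\<psi> s / s * max 0 (t - s) \<le> L * (\<psi> t / t) * t"
    using s True aInc_const_ge_1 psi_nonneg[of t] by (intro mult_mono psi_inc) auto
  then show ?thesis using s True by (simp add: max_def)
next
  case False
  then show ?thesis using psi_nonneg[of t] psi_zero aInc_const_ge_1 by (auto simp: max_def)
qed

lemma young_bdd: "bdd_above ((\<lambda>s. \<psi> s / s * max 0 (t - s)) ` {0<..})"
  using young_term_le by (auto intro!: bdd_aboveI2)

lemma young_le: "0 \<le> t \<Longrightarrow> young_of \<psi> t \<le> L * \<psi> t"
  unfolding young_of_def using young_term_le[of _ t] by (intro cSUP_least) (auto simp: max_def)

lemma young_ge: "0 < s \<Longrightarrow> \<psi> s / s * max 0 (t - s) \<le> young_of \<psi> t"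
  unfolding young_of_def by (rule cSUP_upper[OF _ young_bdd]) auto

lemma psi_le_young: assumes "0 \<le> t" shows "\<psi> t \<le> L * 2 powr q * young_of \<psi> t"
proof (cases "t = 0")
  case True
  have "0 \<le> young_of \<psi> 0" using young_ge[of 1 0] by simp
  then show ?thesis using True aInc_const_ge_1 psi_zero by simp
next
  case False
  with assms have t: "0 < t" by simp
  have "\<psi> t \<le> L * \<psi> (t/2) * (t / (t/2)) powr q" by (rule psi_dec) (use t in auto)
  also have "\<psi> (t/2) \<le> young_of \<psi> t" using young_ge[of "t/2" t] t by (simp add: max_def)
  finally show ?thesis using t aInc_const_ge_1 by (simp add: mult.commute mult.left_commute)
qed

lemma young_of_doubling: "doubling_young (young_of \<psi>) (L ^ 3 * 4 powr q)"
proof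
  show "young_of \<psi> t = 0" if "t \<le> 0" for t
  proof -
    have "young_of \<psi> t = (SUP s\<in>{0::real<..}. 0)"
      unfolding young_of_def by (rule SUP_cong) (use that in \<open>auto simp: max_def\<close>)
    then show ?thesis by simp
  qed
  show "0 < young_of \<psi> t" if "0 < t" for t
    using psi_le_young[of t] psi_pos[of t] aInc_const_ge_1 that
    by (smt (verit) mult_nonneg_nonpos powr_ge_zero zero_le_mult_iff)
  show "convex_on UNIV (young_of \<psi>)"
  proof (rule convex_onI)
    fix t x y :: real assume t: "0 < t" "t < 1"
    show "young_of \<psi> ((1 - t) *\<^sub>R x + t *\<^sub>R y) \<le> (1 - t) * young_of \<psi> x + t * young_of \<psi> y"
      unfolding young_of_def[of \<psi> "(1 - t) *\<^sub>R x + t *\<^sub>R y"]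
    proof (rule cSUP_least)
      fix s :: real assume s: "s \<in> {0<..}"
      have "max 0 ((1 - t) *\<^sub>R x + t *\<^sub>R y - s) \<le> (1 - t) * max 0 (x - s) + t * max 0 (y - s)"
      proof -
        have "(1 - t) * (x - s) \<le> (1 - t) * max 0 (x - s)" "t * (y - s) \<le> t * max 0 (y - s)"
          "0 \<le> (1 - t) * max 0 (x - s)" "0 \<le> t * max 0 (y - s)"
          using t by (auto intro!: mult_left_mono)
        moreover have "(1 - t) *\<^sub>R x + t *\<^sub>R y - s = (1 - t) * (x - s) + t * (y - s)"
          by (simp add: algebra_simps)
        ultimately show ?thesis by (intro max.boundedI) linarith+
      qed
      then have "\<psi> s / s * max 0 ((1 - t) *\<^sub>R x + t *\<^sub>R y - s)
          \<le> \<psi> s / s * ((1 - t) * max 0 (x - s) + t * max 0 (y - s))"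
        using s psi_nonneg[of s] by (intro mult_left_mono) auto
      also have "\<dots> = (1 - t) * (\<psi> s / s * max 0 (x - s)) + t * (\<psi> s / s * max 0 (y - s))"
        by (simp add: distrib_left mult.left_commute del: times_divide_eq_left times_divide_eq_right)
      also have "\<dots> \<le> (1 - t) * young_of \<psi> x + t * young_of \<psi> y"
        using t s young_ge by (intro add_mono mult_left_mono) auto
      finally show "\<psi> s / s * max 0 ((1 - t) *\<^sub>R x + t *\<^sub>R y - s)
        \<le> (1 - t) * young_of \<psi> x + t * young_of \<psi> y" .
    qed auto
  qed auto
  \<comment> \<open>The factor is collected by passing from \<open>young_of\<close> to \<psi>, from
    2 t to t, and back to \<open>young_of\<close>: \<open>L\<close>, then
    \<open>L * 2 powr q\<close>, then \<open>L * 2 powr q\<close> again.\<close>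
  show "young_of \<psi> (2 * t) \<le> L ^ 3 * 4 powr q * young_of \<psi> t" if "0 \<le> t" for t
  proof -
    have d: "\<psi> (2 * t) \<le> L * \<psi> t * 2 powr q"
      using psi_dec[of t "2*t"] psi_zero that by (cases "t = 0") auto
    have "young_of \<psi> (2 * t) \<le> L * \<psi> (2 * t)" by (rule young_le) (use that in auto)
    also have "\<dots> \<le> L * (L * \<psi> t * 2 powr q)" using d aInc_const_ge_1 by (intro mult_left_mono) auto
    also have "\<dots> \<le> L * (L * (L * 2 powr q * young_of \<psi> t) * 2 powr q)"
      using psi_le_young[OF that] aInc_const_ge_1 by (intro mult_left_mono mult_right_mono) auto
    also have "\<dots> = L ^ 3 * 4 powr q * young_of \<psi> t"
      using powr_mult[of 2 2 q] by (simp add: power3_eq_cube algebra_simps)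
    finally show ?thesis .
  qed
qed

end

subsection \<open>The Gagliardo inequality in sheared directions\<close>

definition line_int :: "'a::euclidean_space \<Rightarrow> ('a \<Rightarrow> ennreal) \<Rightarrow> 'a \<Rightarrow> ennreal" where
  "line_int v g x = (\<integral>\<^sup>+t. g (x + t *\<^sub>R v) \<partial>lborel)"

text \<open>Partial integrals in Fubini's order, with \<open>v 0\<close> innermost. The directions
  are arbitrary vectors, so that sheared ones are allowed.\<close>

primrec iter_int :: "(nat \<Rightarrow> 'a::euclidean_space) \<Rightarrow> nat \<Rightarrow> ('a \<Rightarrow> ennreal) \<Rightarrow> 'a \<Rightarrow> ennreal" where
  "iter_int v 0 g = g"
| "iter_int v (Suc k) g = line_int (v k) (iter_int v k g)"

lemma measurable_line_int [measurable]:
  assumes [measurable]: "g \<in> borel_measurable borel"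
  shows "line_int v g \<in> borel_measurable borel"
  unfolding line_int_def[abs_def] by measurable

lemma measurable_iter_int [measurable]:
  "g \<in> borel_measurable borel \<Longrightarrow> iter_int v k g \<in> borel_measurable borel"
  by (induction k) auto

lemma line_int_cmult:
  assumes [measurable]: "g \<in> borel_measurable borel"
  shows "line_int v (\<lambda>x. c * g x) = (\<lambda>x. c * line_int v g x)"
  unfolding line_int_def by (intro ext nn_integral_cmult) measurable

lemma line_int_commute:
  assumes [measurable]: "g \<in> borel_measurable borel"
  shows "line_int v (line_int w g) = line_int w (line_int v g)"
proof
  fix x
  have "(\<integral>\<^sup>+t. \<integral>\<^sup>+s. g (x + t *\<^sub>R v + s *\<^sub>R w) \<partial>lborel \<partial>lborel)
      = (\<integral>\<^sup>+s. \<integral>\<^sup>+t. g (x + t *\<^sub>R v + s *\<^sub>R w) \<partial>lborel \<partial>lborel)"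
    by (rule lborel_pair.Fubini') measurable
  then show "line_int v (line_int w g) x = line_int w (line_int v g) x"
    by (simp add: line_int_def algebra_simps)
qed

lemma iter_int_line_int:
  "g \<in> borel_measurable borel \<Longrightarrow> iter_int v k (line_int w g) = line_int w (iter_int v k g)"
  by (induction k) (auto simp: line_int_commute)

lemma line_int_shift: 
  assumes [measurable]: "g \<in> borel_measurable borel"
  shows "line_int v g (x + s *\<^sub>R v) = line_int v g x"
  using nn_integral_real_affine[of "\<lambda>t. g (x + t *\<^sub>R v)" 1 s]
  by (simp add: line_int_def algebra_simps)

lemma line_int_scale: 
  assumes [measurable]: "g \<in> borel_measurable borel" and c: "c \<noteq> 0"
  shows "line_int v g x = ennreal \<bar>c\<bar> * line_int (c *\<^sub>R v) g x"
  using nn_integral_real_affine[of "\<lambda>t. g (x + t *\<^sub>R v)" c 0] c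
  by (simp add: line_int_def mult.commute)

text \<open>Every such iterated integral contains the integration along \<open>e 0\<close>, after
  which a translation in that direction is invisible. This is what undoes the shear.\<close>

lemma iter_int_shift_0:
  assumes "g \<in> borel_measurable borel"
  shows "iter_int e (Suc k) g (x + s *\<^sub>R e 0) = iter_int e (Suc k) g x"
proof (induction k arbitrary: x)
  case 0
  then show ?case using assms by (simp add: line_int_shift)
next
  case (Suc k)
  have "iter_int e (Suc (Suc k)) g (x + s *\<^sub>R e 0)
      = (\<integral>\<^sup>+t. iter_int e (Suc k) g ((x + t *\<^sub>R e (Suc k)) + s *\<^sub>R e 0) \<partial>lborel)"
    unfolding iter_int.simps(2)[of e "Suc k"] line_int_def by (simp add: add_ac)
  also have "\<dots> = iter_int e (Suc (Suc k)) g x"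
    unfolding Suc.IH by (simp add: line_int_def)
  finally show ?case .
qed

text \<open>The first direction absorbs its multiples in all the later ones, so no determinant is needed.\<close>

lemma iter_int_shear:
  fixes e :: "nat \<Rightarrow> 'a::euclidean_space"
  assumes g [measurable]: "g \<in> borel_measurable borel" and c: "\<bar>c\<bar> = 1"
  defines "v \<equiv> \<lambda>i. c *\<^sub>R e 0 + (if i = 0 then 0 else (1/2) *\<^sub>R e i)"
  shows "iter_int v (Suc k) g = (\<lambda>x. 2 ^ k * iter_int e (Suc k) g x)"
proof (induction k)
  case 0
  have "c \<noteq> 0" using c by auto
  then show ?case using line_int_scale[of g c "e 0"] c by (simp add: v_def fun_eq_iff)
next
  case (Suc k)
  let ?h = "iter_int e (Suc k) g"
  \<comment> \<open>Once the multiple of \<open>e 0\<close> is absorbed, half of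
    \<open>e (Suc k)\<close> remains, and halving a direction doubles the integral along it.\<close>
  have "line_int (v (Suc k)) ?h x = 2 * line_int (e (Suc k)) ?h x" for x
  proof -
    have "line_int (v (Suc k)) ?h x
        = (\<integral>\<^sup>+t. ?h ((x + t *\<^sub>R ((1/2) *\<^sub>R e (Suc k))) + (t * c) *\<^sub>R e 0) \<partial>lborel)"
      unfolding line_int_def v_def by (simp add: scaleR_add_right algebra_simps del: iter_int.simps)
    also have "\<dots> = line_int ((1/2) *\<^sub>R e (Suc k)) ?h x"
      unfolding iter_int_shift_0[OF g] by (simp add: line_int_def)
    finally have 1: "line_int (v (Suc k)) ?h x = line_int ((1/2) *\<^sub>R e (Suc k)) ?h x" .
    have "2 * line_int (e (Suc k)) ?h x = (2 * ennreal (1/2)) * line_int ((1/2) *\<^sub>R e (Suc k)) ?h x"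
      by (subst line_int_scale[of ?h "1/2"]) (auto simp: mult.assoc)
    also have "2 * ennreal (1/2) = 1"
      using ennreal_mult[of 2 "1/2"] by simp
    finally show ?thesis using 1 by simp
  qed
  then have "iter_int v (Suc (Suc k)) g x = 2 ^ Suc k * iter_int e (Suc (Suc k)) g x" for x
    unfolding iter_int.simps(2)[of v "Suc k"] Suc.IH
    by (subst line_int_cmult) (auto simp: mult_ac)
  then show ?case by blast
qed

text \<open>The product is indexed by the vectors themselves and not by their numbers, so that for a
  full basis it is the product measure whose image is \<open>lborel\<close>. Injectivity keeps two
  coordinates from merging.\<close>

lemma iter_int_PiM:
  fixes e :: "nat \<Rightarrow> 'a::euclidean_space"
  assumes [measurable]: "g \<in> borel_measurable borel"
  shows "inj_on e {..<k} \<Longrightarrow> iter_int e k g x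
    = (\<integral>\<^sup>+f. g (x + (\<Sum>b\<in>e ` {..<k}. f b *\<^sub>R b)) \<partial>Pi\<^sub>M (e ` {..<k}) (\<lambda>_. lborel))"
proof (induction k arbitrary: x)
  interpret product_sigma_finite "\<lambda>_::'a. lborel :: real measure" ..
  case 0
  show ?case by (simp add: PiM_empty nn_integral_count_space_finite)
next
  interpret product_sigma_finite "\<lambda>_::'a. lborel :: real measure" ..
  case (Suc k)
  let ?I = "e ` {..<k}"
  have inj: "inj_on e {..<k}" and nin: "e k \<notin> ?I"
    using Suc.prems by (auto simp: lessThan_Suc inj_on_def)
  have sum: "(\<Sum>b\<in>insert (e k) ?I. (f(e k := y)) b *\<^sub>R b) = y *\<^sub>R e k + (\<Sum>b\<in>?I. f b *\<^sub>R b)" for f y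
  proof -
    have "(\<Sum>b\<in>?I. (f(e k := y)) b *\<^sub>R b) = (\<Sum>b\<in>?I. f b *\<^sub>R b)"
      by (intro sum.cong refl) (metis fun_upd_other nin)
    then show ?thesis using nin by (simp add: sum.insert)
  qed
  have "(\<integral>\<^sup>+f. g (x + (\<Sum>b\<in>insert (e k) ?I. f b *\<^sub>R b)) \<partial>Pi\<^sub>M (insert (e k) ?I) (\<lambda>_. lborel))
     = (\<integral>\<^sup>+y. \<integral>\<^sup>+f. g (x + (\<Sum>b\<in>insert (e k) ?I. (f(e k := y)) b *\<^sub>R b)) \<partial>Pi\<^sub>M ?I (\<lambda>_. lborel) \<partial>lborel)"
    by (rule product_nn_integral_insert_rev) (use nin in auto)
  also have "\<dots> = (\<integral>\<^sup>+y. iter_int e k g (x + y *\<^sub>R e k) \<partial>lborel)"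
    unfolding Suc.IH[OF inj] sum by (simp add: add.assoc)
  finally show ?case by (simp add: lessThan_Suc line_int_def)
qed

lemma iter_int_Basis:
  fixes e :: "nat \<Rightarrow> 'a::euclidean_space"
  assumes [measurable]: "g \<in> borel_measurable borel"
    and e: "bij_betw e {..<DIM('a)} Basis"
  shows "iter_int e DIM('a) g 0 = (\<integral>\<^sup>+x. g x \<partial>lborel)"
proof -
  have "iter_int e DIM('a) g 0 = (\<integral>\<^sup>+f. g (\<Sum>b\<in>Basis. f b *\<^sub>R b) \<partial>Pi\<^sub>M (Basis::'a set) (\<lambda>_. lborel))"
    using iter_int_PiM[of g e "DIM('a)" 0] e by (simp add: bij_betw_def)
  also have "\<dots> = (\<integral>\<^sup>+x. g x \<partial>lborel)"
    by (subst (2) lborel_eq) (simp add: nn_integral_distr)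
  finally show ?thesis .
qed

text \<open>Gagliardo's induction. The factors with index below \<open>k\<close> have been pulled
  out at their own direction and merged into the power \<open>a * k\<close> of the partial integral
  of \<open>g\<close>; the others still await theirs. At \<open>k = n\<close> only a power of the
  full integral is left.\<close>

lemma iter_int_prod_le:
  fixes v :: "nat \<Rightarrow> 'a::euclidean_space"
  assumes g [measurable]: "g \<in> borel_measurable borel" and a: "a * (real n - 1) = 1" "0 \<le> a"
  shows "k \<le> n \<Longrightarrow> iter_int v k (\<lambda>x. \<Prod>i<n. epow (line_int (v i) g x) a) x
    \<le> epow (iter_int v k g x) (a * k) * (\<Prod>i\<in>{k..<n}. epow (iter_int v k (line_int (v i) g) x) a)"
proof (induction k arbitrary: x)
  case 0
  then show ?case by (simp add: lessThan_atLeast0)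
next
  case (Suc k)
  let ?I = "\<lambda>k. iter_int v k" and ?J = "{Suc k..<n}"
  define c where "c = ?I (Suc k) g x"
  define F where "F i t = (if i = k then ?I k g else ?I k (line_int (v i) g)) (x + t *\<^sub>R v k)" for i t
  define A where "A i = (if i = k then a * k else a)" for i
  have kn: "k < n" and J: "{k..<n} = insert k ?J" using Suc.prems by auto
  have [measurable]: "F i \<in> borel_measurable borel" for i
    by (cases "i = k"; simp add: F_def[abs_def]; measurable)
  \<comment> \<open>The factor with index \<open>k\<close> is constant along \<open>v k\<close>,
    since it already contains the integration in that direction; hence it leaves the
    integral.\<close>
  have cc: "?I k (line_int (v k) g) (x + t *\<^sub>R v k) = c" for t
    by (simp add: c_def iter_int_line_int line_int_shift)
  have "?I (Suc k) (\<lambda>x. \<Prod>i<n. epow (line_int (v i) g x) a) x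
     \<le> (\<integral>\<^sup>+t. epow (?I k g (x + t *\<^sub>R v k)) (a * k)
          * (\<Prod>i\<in>{k..<n}. epow (?I k (line_int (v i) g) (x + t *\<^sub>R v k)) a) \<partial>lborel)"
    unfolding iter_int.simps line_int_def[of "v k"] using Suc kn by (intro nn_integral_mono) auto
  also have "\<dots> = (\<integral>\<^sup>+t. epow c a * (\<Prod>i\<in>insert k ?J. epow (F i t) (A i)) \<partial>lborel)"
    unfolding J by (intro nn_integral_cong) (auto simp: cc F_def A_def mult_ac intro!: prod.cong)
  also have "\<dots> = epow c a * (\<integral>\<^sup>+t. (\<Prod>i\<in>insert k ?J. epow (F i t) (A i)) \<partial>lborel)"
    by (rule nn_integral_cmult) measurable
  also have "\<dots> \<le> epow c a * (\<Prod>i\<in>insert k ?J. epow (\<integral>\<^sup>+t. F i t \<partial>lborel) (A i))"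
  proof (intro mult_left_mono Holder_epow)
    \<comment> \<open>The accumulated power and the \<open>n - Suc k\<close> remaining factors have
      exponents with sum \<open>a * (n - 1)\<close>, which is 1 as Hoelder's inequality
      requires.\<close>
    have "(\<Sum>i\<in>insert k ?J. A i) = a * k + a * real (n - Suc k)"
      by (simp add: A_def)
    also have "\<dots> = a * (real n - 1)" using kn by (simp add: algebra_simps)
    finally show "(\<Sum>i\<in>insert k ?J. A i) = 1" using a by simp
  qed (use a in \<open>auto simp: A_def\<close>)
  also have "\<dots> = epow c a * (epow c (a * k) * (\<Prod>i\<in>?J. epow (?I (Suc k) (line_int (v i) g) x) a))"
    by (auto simp: F_def A_def c_def line_int_def intro!: prod.cong arg_cong2[where f="(*)"])
  also have "\<dots> = epow c (a * Suc k) * (\<Prod>i\<in>?J. epow (?I (Suc k) (line_int (v i) g) x) a)"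
    using epow_add[of a "a * k" c] a by (simp add: mult.assoc[symmetric] distrib_left)
  finally show ?case by (simp add: c_def)
qed

lemma gagliardo_sheared:
  fixes e :: "nat \<Rightarrow> 'a::euclidean_space"
  assumes g [measurable]: "g \<in> borel_measurable borel" and c: "\<bar>c\<bar> = 1"
    and e: "bij_betw e {..<DIM('a)} Basis" and n: "2 \<le> DIM('a)"
  defines "v \<equiv> \<lambda>i. c *\<^sub>R e 0 + (if i = 0 then 0 else (1/2) *\<^sub>R e i)"
    and "a \<equiv> 1 / (real DIM('a) - 1)"
  shows "(\<integral>\<^sup>+x. (\<Prod>i<DIM('a). epow (line_int (v i) g x) a) \<partial>lborel)
    \<le> 2 * epow (\<integral>\<^sup>+x. g x \<partial>lborel) (real DIM('a) * a)"
proof -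
  obtain k where k: "DIM('a) = Suc k" using n by (metis Suc_le_D numeral_2_eq_2)
  have k0: "real k > 0" and ak: "a = 1 / real k" using n k by (auto simp: a_def)
  have I: "2 ^ k * (\<integral>\<^sup>+x. h x \<partial>lborel) = iter_int v DIM('a) h 0" if [measurable]: "h \<in> borel_measurable borel" for h
    unfolding iter_int_Basis[OF that e, symmetric] k v_def iter_int_shear[OF that c] ..
  have "2 ^ k * (\<integral>\<^sup>+x. (\<Prod>i<DIM('a). epow (line_int (v i) g x) a) \<partial>lborel)
     \<le> epow (2 ^ k * (\<integral>\<^sup>+x. g x \<partial>lborel)) (a * DIM('a))"
    using iter_int_prod_le[OF g, of a "DIM('a)" "DIM('a)" v 0] k0 by (simp add: I ak k)
  also have "\<dots> = epow (2 ^ k) (a * DIM('a)) * epow (\<integral>\<^sup>+x. g x \<partial>lborel) (a * DIM('a))"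
    by (rule epow_mult) (simp add: ak)
  \<comment> \<open>The exponent is 1 + 1 / k, so the shear factor \<open>2 ^ k\<close> comes back
    multiplied only by 2 and can be cancelled.\<close>
  also have "epow (2 ^ k) (a * DIM('a)) = 2 ^ k * 2"
  proof -
    have "epow (2 ^ k) (a * DIM('a)) = epow (ennreal (2 ^ k)) (1 + 1 / real k)"
      using k0 by (simp add: ak k field_simps flip: ennreal_power)
    also have "\<dots> = ennreal ((2 ^ k) powr (1 + 1 / real k))"
      by (rule epow_ennreal) (use k0 in \<open>auto intro: add_pos_pos\<close>)
    also have "(2 ^ k) powr (1 + 1 / real k) = (2::real) ^ k * 2"
      using k0 by (simp add: powr_add powr_powr flip: powr_realpow)
    finally show ?thesis by (simp add: ennreal_mult flip: ennreal_power)
  qed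
  finally have "2 ^ k * (\<integral>\<^sup>+x. (\<Prod>i<DIM('a). epow (line_int (v i) g x) a) \<partial>lborel)
     \<le> 2 ^ k * (2 * epow (\<integral>\<^sup>+x. g x \<partial>lborel) (real DIM('a) * a))"
    by (simp add: mult_ac)
  then show ?thesis
    by (subst (asm) ennreal_mult_le_mult_iff) (auto simp: power_eq_top_ennreal)
qed

subsection \<open>The Sobolev inequality for differentiable functions on the unit ball\<close>

lemma prod_mono_ennreal:
  fixes f g :: "'i \<Rightarrow> ennreal"
  shows "(\<And>i. i \<in> A \<Longrightarrow> f i \<le> g i) \<Longrightarrow> prod f A \<le> prod g A"
  by (induction A rule: infinite_finite_induct) (auto intro: mult_mono)

text \<open>Directional derivatives that are linear in the direction suffice, as functions are only
  differentiated along lines; no Frechet derivative of a mollified function has to be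
  produced.\<close>

definition gateaux_on :: "'a::euclidean_space set \<Rightarrow> ('a \<Rightarrow> real) \<Rightarrow> ('a \<Rightarrow> 'a) \<Rightarrow> bool" where
  "gateaux_on S w Dw \<longleftrightarrow>
     (\<forall>x\<in>S. \<forall>v. ((\<lambda>t. w (x + t *\<^sub>R v)) has_real_derivative (Dw x \<bullet> v)) (at 0))"

lemma gateaux_onD:
  assumes "gateaux_on S w Dw" "x + t *\<^sub>R v \<in> S"
  shows "((\<lambda>s. w (x + s *\<^sub>R v)) has_real_derivative (Dw (x + t *\<^sub>R v) \<bullet> v)) (at t)"
proof -
  have "((\<lambda>s. w (x + t *\<^sub>R v + s *\<^sub>R v)) has_real_derivative (Dw (x + t *\<^sub>R v) \<bullet> v)) (at 0)"
    using assms by (auto simp: gateaux_on_def)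
  then have "((\<lambda>s. w (x + (s + t) *\<^sub>R v)) has_real_derivative (Dw (x + t *\<^sub>R v) \<bullet> v)) (at 0)"
    by (simp add: algebra_simps)
  then show ?thesis
    using DERIV_shift[of "\<lambda>s. w (x + s *\<^sub>R v)" "Dw (x + t *\<^sub>R v) \<bullet> v" 0 t] by simp
qed

text \<open>Integrate the derivative of \<open>(1 - t / \<delta>) w (x + t v)\<close>, which vanishes at \<open>t = \<delta>\<close>.\<close>

lemma le_line_int:
  fixes w :: "'a::euclidean_space \<Rightarrow> real"
  assumes w: "\<And>x. x \<in> S \<Longrightarrow> 0 \<le> w x" "continuous_on S w" "continuous_on S Dw"
    and D: "gateaux_on S w Dw" and \<delta>: "0 < \<delta>" and v: "norm v \<le> 2"
    and seg: "\<And>t. 0 \<le> t \<Longrightarrow> t \<le> \<delta> \<Longrightarrow> x + t *\<^sub>R v \<in> S"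
  shows "ennreal (w x) \<le> line_int v (\<lambda>y. ennreal (w y / \<delta> + 2 * norm (Dw y)) * indicator S y) x"
proof -
  define l where "l t = x + t *\<^sub>R v" for t
  define m where "m t = (1 - t / \<delta>) * w (l t)" for t
  define m' where "m' t = - (1 / \<delta>) * w (l t) + (1 - t / \<delta>) * (Dw (l t) \<bullet> v)" for t
  define q where "q t = w (l t) / \<delta> + 2 * norm (Dw (l t))" for t
  have lS: "l ` {0..\<delta>} \<subseteq> S" using seg by (auto simp: l_def)
  have cl: "continuous_on {0..\<delta>} l" unfolding l_def by (intro continuous_intros)
  have cw: "continuous_on {0..\<delta>} (\<lambda>t. w (l t))" "continuous_on {0..\<delta>} (\<lambda>t. Dw (l t))"
    using continuous_on_compose2[OF w(2) cl lS] continuous_on_compose2[OF w(3) cl lS] by auto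
  have cq: "continuous_on {0..\<delta>} q" unfolding q_def by (intro continuous_intros cw) (use \<delta> in auto)
  have "(m' has_integral (m \<delta> - m 0)) {0..\<delta>}"
  proof (rule fundamental_theorem_of_calculus_interior)
    show "continuous_on {0..\<delta>} m" unfolding m_def by (intro continuous_intros cw) (use \<delta> in auto)
    show "(m has_vector_derivative m' t) (at t)" if "t \<in> {0<..<\<delta>}" for t
    proof -
      have "x + t *\<^sub>R v \<in> S" using that seg by auto
      from gateaux_onD[OF D this] have d: "((\<lambda>t. w (l t)) has_real_derivative Dw (l t) \<bullet> v) (at t)"
        by (simp add: l_def)
      have "(m has_real_derivative m' t) (at t)"
        unfolding m_def m'_def by (rule derivative_eq_intros d refl | use \<delta> in simp)+
      then show ?thesis by (simp add: has_real_derivative_iff_has_vector_derivative)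
    qed
  qed (use \<delta> in auto)
  from has_integral_neg[OF this] have "((\<lambda>t. - m' t) has_integral w x) {0..\<delta>}"
    using \<delta> by (simp add: m_def l_def)
  moreover have "(q has_integral integral {0..\<delta>} q) {0..\<delta>}"
    using integrable_continuous_real[OF cq] by (rule integrable_integral)
  moreover have "- m' t \<le> q t" if "t \<in> {0..\<delta>}" for t
  proof -
    have "- ((1 - t / \<delta>) * (Dw (l t) \<bullet> v)) \<le> \<bar>(1 - t / \<delta>) * (Dw (l t) \<bullet> v)\<bar>" by (rule abs_ge_minus_self)
    also have "\<dots> = \<bar>1 - t / \<delta>\<bar> * \<bar>Dw (l t) \<bullet> v\<bar>" by (rule abs_mult)
    also have "\<dots> \<le> 1 * (norm (Dw (l t)) * 2)"
    proof (rule mult_mono)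
      show "\<bar>1 - t / \<delta>\<bar> \<le> 1" using that \<delta> by (auto simp: abs_le_iff field_simps)
      show "\<bar>Dw (l t) \<bullet> v\<bar> \<le> norm (Dw (l t)) * 2"
        using Cauchy_Schwarz_ineq2[of "Dw (l t)" v] v mult_left_mono[OF v norm_ge_zero[of "Dw (l t)"]]
        by linarith
    qed auto
    finally show ?thesis by (simp add: m'_def q_def)
  qed
  ultimately have le: "w x \<le> integral {0..\<delta>} q" by (rule has_integral_le)
  have si: "set_integrable lborel {0..\<delta>} q" by (rule borel_integrable_atLeastAtMost'[OF cq])
  have q0: "0 \<le> q t" if "t \<in> {0..\<delta>}" for t
  proof -
    have "l t \<in> S" using lS that by auto
    then show ?thesis using w(1)[of "l t"] \<delta> by (simp add: q_def)
  qed
  have "ennreal (integral {0..\<delta>} q) = ennreal (LINT t:{0..\<delta>}|lborel. q t)"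
    by (simp add: set_borel_integral_eq_integral(2)[OF si])
  also have "\<dots> = (\<integral>\<^sup>+t. ennreal (indicator {0..\<delta>} t *\<^sub>R q t) \<partial>lborel)"
    unfolding set_lebesgue_integral_def
    by (rule nn_integral_eq_integral[symmetric])
       (use si q0 in \<open>auto simp: set_integrable_def indicator_def\<close>)
  also have "\<dots> \<le> (\<integral>\<^sup>+t. ennreal (w (l t) / \<delta> + 2 * norm (Dw (l t))) * indicator S (l t) \<partial>lborel)"
    by (rule nn_integral_mono) (use image_subset_iff[THEN iffD1, OF lS] in \<open>auto simp: q_def indicator_def\<close>)
  finally show ?thesis using le by (simp add: line_int_def l_def order_trans[OF ennreal_leI])
qed

text \<open>Let v be the direction and m = \<sigma> (x . b), the largest modulus of a coordinate.
  Then x . v \<le> - m / 2 and |v|^2 \<le> 5 / 4, so |x + t v|^2 \<le> |x|^2 - t (m - 5 t / 4). For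
  large m the norm does not grow; for small m all coordinates are small, and from a point so close
  to the centre a short step stays inside.\<close>

lemma sector_segment:
  fixes x :: "'a::euclidean_space"
  assumes b: "b \<in> Basis" and x: "norm x < 1" "\<And>i. i \<in> Basis \<Longrightarrow> \<bar>x \<bullet> i\<bar> \<le> \<sigma> * (x \<bullet> b)"
    and \<sigma>: "\<bar>\<sigma>\<bar> = 1" and n: "2 \<le> DIM('a)"
    and d: "d = 0 \<or> (\<exists>i\<in>Basis. i \<noteq> b \<and> d = (1/2) *\<^sub>R i)"
    and t: "0 \<le> t" "t \<le> 2 / (5 * real DIM('a))"
  shows "norm (x + t *\<^sub>R (- \<sigma> *\<^sub>R b + d)) < 1"
proof -
  define m where "m = \<sigma> * (x \<bullet> b)"
  define n where "n = real DIM('a)"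
  let ?v = "- \<sigma> *\<^sub>R b + d"
  have n2: "2 \<le> n" using n by (simp add: n_def)
  have m0: "0 \<le> m" using x(2)[OF b] by (simp add: m_def)
  have ss: "\<sigma> * \<sigma> = 1" using \<sigma> by (metis abs_mult_self_eq mult_1)
  have xv: "x \<bullet> ?v \<le> - m / 2"
    using d
  proof (elim disjE bexE conjE)
    assume "d = 0" then show ?thesis using m0 by (simp add: m_def)
  next
    fix i assume i: "i \<in> Basis" "d = (1/2) *\<^sub>R i"
    have "x \<bullet> i \<le> m" using x(2)[OF i(1)] by (simp add: m_def abs_le_iff)
    then show ?thesis by (simp add: i inner_simps m_def field_simps)
  qed
  have vv: "?v \<bullet> ?v \<le> 5 / 4"
    using d b ss by (auto simp: inner_simps inner_same_Basis inner_not_same_Basis)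
  have xx: "x \<bullet> x \<le> n * m\<^sup>2"
  proof -
    have "x \<bullet> x = (\<Sum>i\<in>Basis. (x \<bullet> i)\<^sup>2)"
      by (subst euclidean_inner) (simp add: power2_eq_square)
    also have "\<dots> \<le> (\<Sum>i\<in>(Basis::'a set). m\<^sup>2)"
      using x(2) by (intro sum_mono abs_le_square_iff[THEN iffD1]) (force simp: m_def[symmetric])
    finally show ?thesis by (simp add: n_def)
  qed
  have "(norm (x + t *\<^sub>R ?v))\<^sup>2 = x \<bullet> x + 2 * t * (x \<bullet> ?v) + t\<^sup>2 * (?v \<bullet> ?v)"
    unfolding power2_norm_eq_inner inner_add_left inner_add_right inner_scaleR_left inner_scaleR_right
    by (simp add: inner_commute algebra_simps power2_eq_square)
  also have "\<dots> \<le> x \<bullet> x + 2 * t * (- m / 2) + t\<^sup>2 * (5 / 4)"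
    using xv vv t by (intro add_mono mult_left_mono) auto
  also have "\<dots> = x \<bullet> x - t * (m - 5 / 4 * t)" by (simp add: power2_eq_square algebra_simps)
  also have "\<dots> < 1"
  proof (cases "5 / 4 * t \<le> m")
    case True
    have "x \<bullet> x < 1" using x(1) by (simp add: norm_lt_square)
    then show ?thesis using True t by (smt (verit) mult_nonneg_nonneg)
  next
    \<comment> \<open>The bound on \<open>t\<close> is chosen for this case: it forces
      \<open>m \<le> 1 / (2 * n)\<close>, hence |x|^2 \<le> 1 / 8.\<close>
    case False
    have tn: "t \<le> 2 / (5 * n)" using t by (simp add: n_def)
    then have "5 / 4 * t \<le> 5 / 4 * (2 / (5 * n))" by (intro mult_left_mono) auto
    then have "m \<le> 1 / (2 * n)" using False by simp
    then have "m\<^sup>2 \<le> (1 / (2 * n))\<^sup>2" using m0 by (intro power_mono) auto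
    then have "n * m\<^sup>2 \<le> n * (1 / (2 * n))\<^sup>2" using n2 by (intro mult_left_mono) auto
    also have "\<dots> = 1 / (4 * n)" using n2 by (simp add: power2_eq_square field_simps)
    also have "\<dots> \<le> 1 / 8" using n2 by (simp add: field_simps)
    finally have 1: "x \<bullet> x \<le> 1 / 8" using xx by simp
    have "2 / (5 * n) \<le> 1 / 5" using n2 by (simp add: field_simps)
    then have "t \<le> 1 / 5" using tn by linarith
    then have "t * t \<le> 1 / 5 * (1 / 5)" using t by (intro mult_mono) auto
    moreover have "0 \<le> t * m" using t m0 by simp
    ultimately show ?thesis using 1 by (simp add: algebra_simps)
  qed
  finally show ?thesis using norm_lt_square[of "x + t *\<^sub>R ?v" 1] by (simp add: power2_norm_eq_inner)
qed

text \<open>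
  From a point of the sector one can move a fixed distance in all the directions \<open>-\<sigma> b\<close> and
  \<open>-\<sigma> b + i / 2\<close> without leaving the ball, so no extension operator is needed.
\<close>

definition sector :: "'a::euclidean_space \<Rightarrow> real \<Rightarrow> 'a set" where
  "sector b \<sigma> = {x \<in> ball 0 1. \<forall>i\<in>Basis. \<bar>x \<bullet> i\<bar> \<le> \<sigma> * (x \<bullet> b)}"

lemma sector_borel [measurable]: "sector b \<sigma> \<in> sets borel"
proof -
  have "closed (\<Inter>i\<in>Basis. {x. \<bar>x \<bullet> i\<bar> \<le> \<sigma> * (x \<bullet> b)})"
    by (intro closed_INT ballI closed_Collect_le continuous_intros)
  moreover have "sector b \<sigma> = ball 0 1 \<inter> (\<Inter>i\<in>Basis. {x. \<bar>x \<bullet> i\<bar> \<le> \<sigma> * (x \<bullet> b)})"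
    by (auto simp: sector_def)
  ultimately show ?thesis by auto
qed

lemma sectors_cover: "ball 0 1 \<subseteq> (\<Union>b\<in>Basis. \<Union>\<sigma>\<in>{1,-1}. sector (b::'a::euclidean_space) \<sigma>)"
proof
  fix x :: 'a assume x: "x \<in> ball 0 1"
  let ?A = "(\<lambda>i. \<bar>x \<bullet> i\<bar>) ` Basis"
  have "Max ?A \<in> ?A" by (rule Max_in) auto
  then obtain b where b: "b \<in> Basis" "Max ?A = \<bar>x \<bullet> b\<bar>" by blast
  have m: "\<bar>x \<bullet> i\<bar> \<le> \<bar>x \<bullet> b\<bar>" if "i \<in> Basis" for i
    unfolding b(2)[symmetric] by (rule Max_ge) (use that in auto)
  define \<sigma> :: real where "\<sigma> = (if 0 \<le> x \<bullet> b then 1 else -1)"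
  have "\<sigma> * (x \<bullet> b) = \<bar>x \<bullet> b\<bar>" by (simp add: \<sigma>_def)
  then have "x \<in> sector b \<sigma>" using m x by (simp add: sector_def)
  moreover have "\<sigma> \<in> {1, -1}" by (simp add: \<sigma>_def)
  ultimately show "x \<in> (\<Union>b\<in>Basis. \<Union>\<sigma>\<in>{1,-1}. sector b \<sigma>)" using b(1) by blast
qed

text \<open>At a point of the sector each sheared direction bounds \<open>w x\<close> by a line
  integral of one and the same function \<open>h\<close>. Multiplying powers of these bounds
  produces the product that \<open>gagliardo_sheared\<close> integrates.\<close>

lemma sobolev_sector:
  fixes w :: "'a::euclidean_space \<Rightarrow> real"
  assumes w: "\<And>x. x \<in> ball 0 1 \<Longrightarrow> 0 \<le> w x" "continuous_on (ball 0 1) w" "continuous_on (ball 0 1) Dw"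
    and D: "gateaux_on (ball 0 1) w Dw" and n: "2 \<le> DIM('a)" and b: "b \<in> Basis" and \<sigma>: "\<bar>\<sigma>\<bar> = 1"
  shows "(\<integral>\<^sup>+x\<in>sector b \<sigma>. epow (ennreal (w x)) (DIM('a) / (real DIM('a) - 1)) \<partial>lborel)
    \<le> 2 * epow (\<integral>\<^sup>+x\<in>ball 0 1. ennreal (w x / (2 / (5 * real DIM('a))) + 2 * norm (Dw x)) \<partial>lborel)
          (DIM('a) / (real DIM('a) - 1))"
proof -
  define \<delta> where "\<delta> = 2 / (5 * real DIM('a))"
  define a where "a = 1 / (real DIM('a) - 1)"
  define h where "h y = ennreal (w y / \<delta> + 2 * norm (Dw y)) * indicator (ball 0 1) y" for y
  have \<delta>: "0 < \<delta>" by (simp add: \<delta>_def)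
  have a0: "0 < a" and ad: "DIM('a) / (real DIM('a) - 1) = real DIM('a) * a" using n by (auto simp: a_def)
  \<comment> \<open>The basis is listed with \<open>b\<close> first, because the shear adds a
    multiple of its first vector to the others.\<close>
  obtain bs where bs: "distinct bs" "set bs = Basis - {b}"
    using finite_distinct_list[of "Basis - {b}"] by auto
  define e where "e i = (b # bs) ! i" for i
  have "length (b # bs) = DIM('a)"
    using distinct_card[of "b # bs"] bs b by (simp add: insert_absorb)
  then have e: "bij_betw e {..<DIM('a)} Basis"
    using bij_betw_nth[of "b # bs" "{..<DIM('a)}" Basis] bs b by (auto simp: e_def[abs_def] insert_absorb)
  have e0: "e 0 = b" by (simp add: e_def)
  define v where "v i = (- \<sigma>) *\<^sub>R e 0 + (if i = 0 then 0 else (1/2) *\<^sub>R e i)" for i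
  have cc: "continuous_on (ball 0 1) (\<lambda>y. w y / \<delta> + 2 * norm (Dw y))"
    by (intro continuous_intros w) (use \<delta> in auto)
  have [measurable]: "h \<in> borel_measurable borel"
  proof -
    have "(\<lambda>y. indicator (ball 0 1) y *\<^sub>R (w y / \<delta> + 2 * norm (Dw y))) \<in> borel_measurable borel"
      by (rule borel_measurable_continuous_on_indicator[OF _ cc]) auto
    then have "(\<lambda>y. ennreal (indicator (ball 0 1) y *\<^sub>R (w y / \<delta> + 2 * norm (Dw y)))) \<in> borel_measurable borel"
      by measurable
    moreover have "(\<lambda>y. ennreal (indicator (ball 0 1) y *\<^sub>R (w y / \<delta> + 2 * norm (Dw y)))) = h"
      by (auto simp: h_def indicator_def)
    ultimately show ?thesis by simp
  qed
  have le: "ennreal (w x) \<le> line_int (v i) h x" if x: "x \<in> sector b \<sigma>" and i: "i < DIM('a)" for x i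
    unfolding h_def[abs_def]
  proof (rule le_line_int[OF w D \<delta>])
    define d where "d = (if i = 0 then 0 else (1/2) *\<^sub>R e i)"
    have vi: "v i = - \<sigma> *\<^sub>R b + d" by (simp add: v_def e0 d_def)
    have d: "d = 0 \<or> (\<exists>i\<in>Basis. i \<noteq> b \<and> d = (1/2) *\<^sub>R i)"
    proof (cases "i = 0")
      case False
      have "e i \<noteq> e 0" using inj_onD[of e "{..<DIM('a)}" i 0] e i False by (auto simp: bij_betw_def)
      moreover have "e i \<in> Basis" using e i by (auto simp: bij_betw_def)
      ultimately show ?thesis using False by (auto simp: d_def e0)
    qed (simp add: d_def)
    show "norm (v i) \<le> 2"
      using norm_triangle_ineq[of "- \<sigma> *\<^sub>R b" d] d b \<sigma> by (auto simp: vi)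
    show "x + t *\<^sub>R v i \<in> ball 0 1" if "0 \<le> t" "t \<le> \<delta>" for t
      using sector_segment[OF b, of x \<sigma> d t] x \<sigma> n d that by (auto simp: vi sector_def \<delta>_def)
  qed auto
  have "(\<integral>\<^sup>+x\<in>sector b \<sigma>. epow (ennreal (w x)) (real DIM('a) * a) \<partial>lborel)
    \<le> (\<integral>\<^sup>+x. (\<Prod>i<DIM('a). epow (line_int (v i) h x) a) \<partial>lborel)"
  proof (rule nn_integral_mono)
    fix x
    show "epow (ennreal (w x)) (real DIM('a) * a) * indicator (sector b \<sigma>) x
        \<le> (\<Prod>i<DIM('a). epow (line_int (v i) h x) a)"
    proof (cases "x \<in> sector b \<sigma>")
      case True
      have "epow (ennreal (w x)) (real DIM('a) * a) = (\<Prod>i<DIM('a). epow (ennreal (w x)) a)"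
        by (rule epow_prod[symmetric]) (use a0 in auto)
      also have "\<dots> \<le> (\<Prod>i<DIM('a). epow (line_int (v i) h x) a)"
        by (intro prod_mono_ennreal epow_mono le True) (use a0 in auto)
      finally show ?thesis using True by simp
    qed simp
  qed
  also have "\<dots> \<le> 2 * epow (\<integral>\<^sup>+x. h x \<partial>lborel) (real DIM('a) * a)"
    using gagliardo_sheared[of h "- \<sigma>" e] \<sigma> e n by (simp add: v_def[abs_def] a_def)
  finally show ?thesis by (simp add: ad h_def \<delta>_def)
qed

text \<open>There are \<open>2 * DIM('a)\<close> sectors, each with the factor 2 from
  \<open>gagliardo_sheared\<close>. Overlaps between them only enlarge the sum.\<close>

lemma sobolev_C1:
  fixes w :: "'a::euclidean_space \<Rightarrow> real"
  assumes w: "\<And>x. x \<in> ball 0 1 \<Longrightarrow> 0 \<le> w x" "continuous_on (ball 0 1) w" "continuous_on (ball 0 1) Dw"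
    and D: "gateaux_on (ball 0 1) w Dw" and n: "2 \<le> DIM('a)"
  shows "(\<integral>\<^sup>+x\<in>ball 0 1. epow (ennreal (w x)) (DIM('a) / (real DIM('a) - 1)) \<partial>lborel)
    \<le> ennreal (4 * real DIM('a))
      * epow (\<integral>\<^sup>+x\<in>ball 0 1. ennreal (w x / (2 / (5 * real DIM('a))) + 2 * norm (Dw x)) \<partial>lborel)
          (DIM('a) / (real DIM('a) - 1))"
proof -
  let ?a = "DIM('a) / (real DIM('a) - 1)"
  let ?R = "2 * epow (\<integral>\<^sup>+x\<in>ball 0 1. ennreal (w x / (2 / (5 * real DIM('a))) + 2 * norm (Dw x)) \<partial>lborel) ?a"
  have mm: "(\<lambda>x. epow (ennreal (w x)) ?a * indicator (sector b \<sigma>) x) \<in> borel_measurable lborel" for b \<sigma>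
  proof -
    have m [measurable]: "(\<lambda>y. indicator (ball 0 1) y *\<^sub>R w y) \<in> borel_measurable borel"
      by (rule borel_measurable_continuous_on_indicator[OF _ w(2)]) auto
    have eq: "(\<lambda>x. epow (ennreal (w x)) ?a * indicator (sector b \<sigma>) x)
       = (\<lambda>x. epow (ennreal (indicator (ball 0 1) x *\<^sub>R w x)) ?a * indicator (sector b \<sigma>) x)"
      by (auto simp: fun_eq_iff indicator_def sector_def)
    show ?thesis unfolding eq by measurable
  qed
  have "(\<integral>\<^sup>+x\<in>ball 0 1. epow (ennreal (w x)) ?a \<partial>lborel)
     \<le> (\<integral>\<^sup>+x. (\<Sum>b\<in>Basis. \<Sum>\<sigma>\<in>{1,-1}. epow (ennreal (w x)) ?a * indicator (sector b \<sigma>) x) \<partial>lborel)"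
  proof (rule nn_integral_mono)
    fix x :: 'a
    show "epow (ennreal (w x)) ?a * indicator (ball 0 1) x
       \<le> (\<Sum>b\<in>Basis. \<Sum>\<sigma>\<in>{1,-1}. epow (ennreal (w x)) ?a * indicator (sector b \<sigma>) x)"
    proof (cases "x \<in> ball 0 1")
      case True
      then obtain b \<sigma> where b: "b \<in> Basis" "\<sigma> \<in> {1,-1}" "x \<in> sector b \<sigma>" using sectors_cover by blast
      have "epow (ennreal (w x)) ?a = epow (ennreal (w x)) ?a * indicator (sector b \<sigma>) x" using b by simp
      also have "\<dots> \<le> (\<Sum>\<sigma>\<in>{1,-1}. epow (ennreal (w x)) ?a * indicator (sector b \<sigma>) x)"
        by (rule member_le_sum) (use b in auto)
      also have "\<dots> \<le> (\<Sum>b\<in>Basis. \<Sum>\<sigma>\<in>{1,-1}. epow (ennreal (w x)) ?a * indicator (sector b \<sigma>) x)"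
        by (rule member_le_sum) (use b in auto)
      finally show ?thesis using True by simp
    qed simp
  qed
  also have "\<dots> = (\<Sum>b\<in>Basis. \<Sum>\<sigma>\<in>{1,-1}. \<integral>\<^sup>+x\<in>sector b \<sigma>. epow (ennreal (w x)) ?a \<partial>lborel)"
    by (simp only: nn_integral_sum borel_measurable_sum mm)
  also have "\<dots> \<le> (\<Sum>b\<in>(Basis::'a set). \<Sum>\<sigma>\<in>{1,-1::real}. ?R)"
    by (intro sum_mono sobolev_sector[OF w D n]) auto
  also have "\<dots> = of_nat DIM('a) * (of_nat (card {1,-1::real}) * ?R)"
    by (simp only: sum_constant)
  also have "\<dots> = (of_nat DIM('a) * (of_nat (card {1,-1::real}) * 2)) * epow (\<integral>\<^sup>+x\<in>ball 0 1. ennreal (w x / (2 / (5 * real DIM('a))) + 2 * norm (Dw x)) \<partial>lborel) ?a"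
    by (simp only: mult.assoc)
  also have "of_nat DIM('a) * (of_nat (card {1,-1::real}) * 2) = ennreal (4 * real DIM('a))"
    by (simp add: ennreal_mult ennreal_of_nat_eq_real_of_nat mult.commute)
  finally show ?thesis .
qed

section \<open>From exponent 1 to exponent p: powers of a Young function of |F|\<close>

lemma sqrt_sum_squares_bounds:
  fixes a \<kappa> :: real
  assumes "0 \<le> a" "0 < \<kappa>"
  shows "a \<le> sqrt (a\<^sup>2 + \<kappa>\<^sup>2)" "sqrt (a\<^sup>2 + \<kappa>\<^sup>2) \<le> a + \<kappa>" "0 < sqrt (a\<^sup>2 + \<kappa>\<^sup>2)"
proof -
  show "a \<le> sqrt (a\<^sup>2 + \<kappa>\<^sup>2)" by (rule real_le_rsqrt) simp
  show "sqrt (a\<^sup>2 + \<kappa>\<^sup>2) \<le> a + \<kappa>"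
    by (rule real_le_lsqrt) (use assms in \<open>auto simp: power2_sum\<close>)
  show "0 < sqrt (a\<^sup>2 + \<kappa>\<^sup>2)" using assms by (simp add: add_nonneg_pos)
qed

lemma measurable_mat_norm:
  fixes f :: "'b \<Rightarrow> nat \<Rightarrow> 'a::euclidean_space"
  assumes "\<And>i. i < N \<Longrightarrow> (\<lambda>x. f x i) \<in> borel_measurable M"
  shows "(\<lambda>x. mat_norm N (f x)) \<in> borel_measurable M"
proof -
  have "(\<lambda>x. \<Sum>i<N. (norm (f x i))\<^sup>2) \<in> borel_measurable M"
    by (intro borel_measurable_sum borel_measurable_power measurable_compose[OF assms borel_measurable_norm]) auto
  then show ?thesis unfolding mat_norm_def L2_set_def by measurable
qed

lemma mat_norm_real: "mat_norm N v = vec_norm N v"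
  by (simp add: mat_norm_def vec_norm_def L2_set_def)

lemma measurable_vec_norm:
  "(\<And>i. i < N \<Longrightarrow> (\<lambda>x. f x i) \<in> borel_measurable M) \<Longrightarrow> (\<lambda>x. vec_norm N (f x)) \<in> borel_measurable M"
  unfolding mat_norm_real[symmetric] by (rule measurable_mat_norm)

lemma powr_sum3_le:
  fixes a b c p :: real
  assumes "0 \<le> a" "0 \<le> b" "0 \<le> c" "0 \<le> p"
  shows "(a + b + c) powr p \<le> 3 powr p * (a powr p + b powr p + c powr p)"
proof -
  define m where "m = max a (max b c)"
  have "(a + b + c) powr p \<le> (3 * m) powr p"
    by (rule powr_mono2) (use assms in \<open>auto simp: m_def\<close>)
  also have "\<dots> = 3 powr p * m powr p" using assms by (simp add: powr_mult m_def)
  also have "m powr p \<le> a powr p + b powr p + c powr p"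
    by (auto simp: m_def max_def)
  finally show ?thesis by simp
qed

definition sobolev_exp :: "nat \<Rightarrow> real \<Rightarrow> real" where
  "sobolev_exp d p = real d * p / (real d - p)"

text \<open>The exponent \<open>s\<close> for which \<open>s d / (d - 1)\<close> is the Sobolev exponent of \<open>p\<close>.\<close>

definition chain_exp :: "nat \<Rightarrow> real \<Rightarrow> real" where
  "chain_exp d p = p * (real d - 1) / (real d - p)"

text \<open>The first summand comes from the reciprocal of the segment length
  \<open>2 / (5 * d)\<close>; the second combines the weight 2 of the gradient in
  \<open>sobolev_C1\<close> with the factor from differentiating the power.\<close>

definition grad_const :: "nat \<Rightarrow> real \<Rightarrow> real" where
  "grad_const d p = 5 * real d / 2 + 2 * chain_exp d p"

context doubling_young
begin

context
  fixes N :: nat and F :: "'a::euclidean_space \<Rightarrow> nat \<Rightarrow> real" and DF :: "'a \<Rightarrow> nat \<Rightarrow> 'a"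
    and p \<kappa> :: real
  assumes n: "2 \<le> DIM('a)" and p: "1 \<le> p" "p < DIM('a)" and \<kappa>: "0 < \<kappa>"
    and cF: "\<And>i. i < N \<Longrightarrow> continuous_on UNIV (\<lambda>x. F x i)"
    and cDF: "\<And>i. i < N \<Longrightarrow> continuous_on UNIV (\<lambda>x. DF x i)"
    and DF: "\<And>i. i < N \<Longrightarrow> gateaux_on (ball 0 1) (\<lambda>x. F x i) (\<lambda>x. DF x i)"
begin

text \<open>A regularised norm: it is differentiable also where F vanishes, and it stays in the open
  half-line, where \<Psi> is differentiable.\<close>

definition modulus :: "'a \<Rightarrow> real" where
  "modulus x = sqrt ((\<Sum>i<N. (F x i)\<^sup>2) + \<kappa>\<^sup>2)"

definition wfun :: "'a \<Rightarrow> real" where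
  "wfun x = \<Psi> (modulus x) powr (chain_exp DIM('a) p)"

definition Dwfun :: "'a \<Rightarrow> 'a" where
  "Dwfun x = (chain_exp DIM('a) p * \<Psi> (modulus x) powr (chain_exp DIM('a) p - 1) * \<Psi>' (modulus x) / modulus x) *\<^sub>R (\<Sum>i<N. F x i *\<^sub>R DF x i)"

lemma sum_squares_pos: "0 < (\<Sum>i<N. (F x i)\<^sup>2) + \<kappa>\<^sup>2"
  using \<kappa> by (intro add_nonneg_pos sum_nonneg) auto

lemma modulus_eq: "modulus x = sqrt ((vec_norm N (F x))\<^sup>2 + \<kappa>\<^sup>2)"
  by (simp add: modulus_def vec_norm_def L2_set_def sum_nonneg)

lemma vec_norm_nonneg: "0 \<le> vec_norm N v"
  by (simp add: vec_norm_def L2_set_nonneg)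

lemma modulus_pos: "0 < modulus x"
  using sum_squares_pos by (simp add: modulus_def)

lemma modulus_ge: "vec_norm N (F x) \<le> modulus x" and modulus_le: "modulus x \<le> vec_norm N (F x) + \<kappa>"
  unfolding modulus_eq using sqrt_sum_squares_bounds[OF vec_norm_nonneg \<kappa>] by auto

lemma modulus_cont: "continuous_on A modulus"
proof -
  have "continuous_on UNIV modulus"
    unfolding modulus_def by (intro continuous_intros cF) auto
  then show ?thesis by (rule continuous_on_subset) auto
qed

lemma measurable_modulus: "modulus \<in> borel_measurable borel"
  using modulus_cont by (rule borel_measurable_continuous_onI)

lemma measurable_mat_norm_DF: "(\<lambda>x. mat_norm N (DF x)) \<in> borel_measurable borel"
  by (intro measurable_mat_norm borel_measurable_continuous_onI cDF)

lemma Psi_modulus_cont: "continuous_on A (\<lambda>x. \<Psi> (modulus x))" "continuous_on A (\<lambda>x. \<Psi>' (modulus x))"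
  by (rule continuous_on_compose2[OF Psi_cont modulus_cont], use modulus_pos in auto)
     (rule continuous_on_compose2[OF Psi'_cont modulus_cont], use modulus_pos in auto)

lemma measurable_Psi_modulus: "(\<lambda>x. \<Psi> (modulus x)) \<in> borel_measurable borel"
  using Psi_modulus_cont by (intro borel_measurable_continuous_onI)

lemma Psi_modulus_pos: "0 < \<Psi> (modulus x)"
  using Psi_pos modulus_pos by blast

lemma wfun_cont: "continuous_on A wfun"
  unfolding wfun_def using Psi_modulus_pos by (intro continuous_intros Psi_modulus_cont) (simp add: less_imp_neq[THEN not_sym])

lemma Dwfun_cont: "continuous_on A Dwfun"
proof -
  have "continuous_on UNIV Dwfun"
    unfolding Dwfun_def using Psi_modulus_pos modulus_pos
    by (intro continuous_intros Psi_modulus_cont modulus_cont cF cDF)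
       (auto simp: less_imp_neq[THEN not_sym])
  then show ?thesis by (rule continuous_on_subset) auto
qed

lemma wfun_gateaux: "gateaux_on (ball 0 1) wfun Dwfun"
  unfolding gateaux_on_def
proof (intro ballI allI)
  fix x v :: 'a assume x: "x \<in> ball 0 1"
  have "((\<lambda>t. F (x + t *\<^sub>R v) i) has_real_derivative DF x i \<bullet> v) (at 0)" if "i < N" for i
    using DF[OF that] x by (auto simp: gateaux_on_def)
  then have "((\<lambda>t. (\<Sum>i<N. (F (x + t *\<^sub>R v) i)\<^sup>2) + \<kappa>\<^sup>2) has_real_derivative
      (\<Sum>i<N. 2 * F x i * (DF x i \<bullet> v)) + 0) (at 0)"
    by (intro DERIV_add DERIV_sum DERIV_const) (auto intro!: derivative_eq_intros)
  then have "((\<lambda>t. modulus (x + t *\<^sub>R v)) has_real_derivative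
      inverse (sqrt ((\<Sum>i<N. (F x i)\<^sup>2) + \<kappa>\<^sup>2)) / 2 * ((\<Sum>i<N. 2 * F x i * (DF x i \<bullet> v)) + 0)) (at 0)"
    unfolding modulus_def
    by (rule DERIV_chain2[rotated]) (use sum_squares_pos[of x] in \<open>auto intro!: DERIV_real_sqrt\<close>)
  then have dm: "((\<lambda>t. modulus (x + t *\<^sub>R v)) has_real_derivative
      inverse (modulus x) * (\<Sum>i<N. F x i * (DF x i \<bullet> v))) (at 0)"
    by (simp add: modulus_def sum_distrib_left mult.assoc)
  have "((\<lambda>t. \<Psi> (modulus (x + t *\<^sub>R v))) has_real_derivative
      \<Psi>' (modulus x) * (inverse (modulus x) * (\<Sum>i<N. F x i * (DF x i \<bullet> v)))) (at 0)"
    by (rule DERIV_chain2[OF _ dm]) (use Psi_deriv modulus_pos in auto)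
  then have "((\<lambda>t. \<Psi> (modulus (x + t *\<^sub>R v)) powr (chain_exp DIM('a) p)) has_real_derivative
      chain_exp DIM('a) p * \<Psi> (modulus x) powr (chain_exp DIM('a) p - 1) * (\<Psi>' (modulus x) * (inverse (modulus x) * (\<Sum>i<N. F x i * (DF x i \<bullet> v))))) (at 0)"
    by (rule DERIV_chain2[rotated]) (use Psi_modulus_pos in \<open>auto intro!: has_real_derivative_powr\<close>)
  then show "((\<lambda>t. wfun (x + t *\<^sub>R v)) has_real_derivative Dwfun x \<bullet> v) (at 0)"
    by (simp add: wfun_def Dwfun_def inner_sum_left divide_inverse mult.assoc)
qed

lemma chain_exp_ge_1: "1 \<le> chain_exp DIM('a) p"
proof -
  have "real DIM('a) - p \<le> p * (real DIM('a) - 1)"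
    using p mult_right_mono[of 1 p "real DIM('a)"] by (simp add: algebra_simps)
  then show ?thesis using p by (simp add: chain_exp_def field_simps)
qed

text \<open>By Cauchy-Schwarz the gradient of the modulus is at most |DF|, and
  \<open>Psi'_le\<close> leaves \<Phi>(m) |DF| / m with m the modulus.
  \<open>quotient_mult_le\<close> separates the modulus from |DF| in this product.\<close>

lemma Dwfun_bound:
  "norm (Dwfun x) \<le> chain_exp DIM('a) p * \<Psi> (modulus x) powr (chain_exp DIM('a) p - 1) * (\<Phi> (modulus x) + \<Phi> (mat_norm N (DF x)))"
proof -
  let ?m = "modulus x" and ?d = "mat_norm N (DF x)"
  have m: "0 < ?m" by (rule modulus_pos)
  have d0: "0 \<le> ?d" by (simp add: mat_norm_def L2_set_nonneg)
  have "norm (\<Sum>i<N. F x i *\<^sub>R DF x i) \<le> (\<Sum>i<N. \<bar>F x i\<bar> * \<bar>norm (DF x i)\<bar>)"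
    by (rule sum_norm_le) simp
  also have "\<dots> \<le> vec_norm N (F x) * ?d"
    unfolding vec_norm_def mat_norm_def by (rule L2_set_mult_ineq)
  also have "\<dots> \<le> ?m * ?d" using modulus_ge d0 by (intro mult_right_mono)
  finally have 1: "norm (\<Sum>i<N. F x i *\<^sub>R DF x i) \<le> ?m * ?d" .
  let ?c = "chain_exp DIM('a) p * \<Psi> ?m powr (chain_exp DIM('a) p - 1)"
  have c: "0 \<le> ?c" using chain_exp_ge_1 by simp
  have "norm (Dwfun x) = ?c * (\<Psi>' ?m / ?m * norm (\<Sum>i<N. F x i *\<^sub>R DF x i))"
    using c Psi'_nonneg[OF m] m chain_exp_ge_1 by (simp add: Dwfun_def abs_mult)
  also have "\<dots> \<le> ?c * (\<Psi>' ?m / ?m * (?m * ?d))"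
    using c Psi'_nonneg[OF m] m by (intro mult_left_mono 1) auto
  also have "\<dots> = ?c * (\<Psi>' ?m * ?d)" using m by simp
  also have "\<dots> \<le> ?c * (\<Phi> ?m / ?m * ?d)"
    using Psi'_le[OF m] d0 c by (intro mult_left_mono mult_right_mono) auto
  also have "\<dots> \<le> ?c * (\<Phi> ?m + \<Phi> ?d)"
    using quotient_mult_le[OF m d0] c by (intro mult_left_mono)
  finally show ?thesis .
qed

text \<open>Function and gradient are brought to the common form of a power of \<Psi> times a sum of
  values of \<Phi>, ready for Hoelder's inequality with exponents p / (p - 1) and p.\<close>

lemma integrand_bound:
  "wfun x / (2 / (5 * real DIM('a))) + 2 * norm (Dwfun x)
    \<le> grad_const DIM('a) p * (\<Psi> (modulus x) powr (chain_exp DIM('a) p - 1) * (\<Phi> (modulus x) + \<Phi> (mat_norm N (DF x))))"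
proof -
  let ?m = "modulus x" and ?d = "mat_norm N (DF x)"
  let ?y = "\<Psi> ?m powr (chain_exp DIM('a) p - 1) * (\<Phi> ?m + \<Phi> ?d)"
  have "wfun x = \<Psi> ?m powr (chain_exp DIM('a) p - 1) * \<Psi> ?m"
    using Psi_modulus_pos[of x] powr_mult_base[of "\<Psi> ?m" "chain_exp DIM('a) p - 1"] by (simp add: wfun_def mult.commute)
  also have "\<dots> \<le> ?y"
    using Psi_le[OF modulus_pos[of x]] nonneg[of ?d] by (intro mult_left_mono) auto
  finally have "5 * real DIM('a) / 2 * wfun x \<le> 5 * real DIM('a) / 2 * ?y"
    by (intro mult_left_mono) auto
  moreover have "2 * norm (Dwfun x) \<le> 2 * chain_exp DIM('a) p * ?y" using Dwfun_bound[of x] by (simp add: mult.assoc)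
  moreover have "wfun x / (2 / (5 * real DIM('a))) = 5 * real DIM('a) / 2 * wfun x" by simp
  ultimately show ?thesis by (simp only: grad_const_def distrib_right mult.assoc)
qed

text \<open>A continuous function is bounded on the closed ball. Finiteness permits the absorption
  in \<open>sobolev_modulus\<close>.\<close>

lemma Psi_powr_finite: "(\<integral>\<^sup>+x\<in>ball 0 1. ennreal (\<Psi> (modulus x) powr (sobolev_exp DIM('a) p)) \<partial>lborel) < \<infinity>"
proof -
  have "continuous_on (cball 0 1) (\<lambda>x. \<Psi> (modulus x) powr (sobolev_exp DIM('a) p))"
    using Psi_modulus_pos by (intro continuous_intros Psi_modulus_cont) (simp add: less_imp_neq[THEN not_sym])
  then have "compact ((\<lambda>x. \<Psi> (modulus x) powr (sobolev_exp DIM('a) p)) ` cball 0 1)"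
    by (rule compact_continuous_image) simp
  then have "bdd_above ((\<lambda>x::'a. \<Psi> (modulus x) powr (sobolev_exp DIM('a) p)) ` cball 0 1)"
    by (intro bounded_imp_bdd_above compact_imp_bounded)
  then obtain M where M: "\<And>x. x \<in> cball 0 1 \<Longrightarrow> \<Psi> (modulus x) powr (sobolev_exp DIM('a) p) \<le> M"
    unfolding bdd_above_def by fast
  have "ennreal (\<Psi> (modulus x) powr (sobolev_exp DIM('a) p)) * indicator (ball 0 1) x
     \<le> ennreal M * indicator (ball 0 1) x" for x
    by (cases "x \<in> ball 0 1") (simp_all add: M ennreal_leI)
  then have "(\<integral>\<^sup>+x\<in>ball 0 1. ennreal (\<Psi> (modulus x) powr (sobolev_exp DIM('a) p)) \<partial>lborel)
     \<le> (\<integral>\<^sup>+x. ennreal M * indicator (ball (0::'a) 1) x \<partial>lborel)"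
    by (intro nn_integral_mono)
  also have "\<dots> = ennreal M * emeasure lborel (ball (0::'a) 1)"
    by (rule nn_integral_cmult_indicator) simp
  also have "\<dots> < \<infinity>" using emeasure_lborel_ball_finite[of "0::'a" 1] by (simp add: ennreal_mult_less_top)
  finally show ?thesis .
qed

text \<open>Let X be the integral on the left and Z the one on the right. The case of exponent 1 for
  \<open>wfun\<close>, followed by Hoelder's inequality, gives X \<le> C X^\<alpha> Z^(n'/p) with n'
  = d / (d - 1) and \<alpha> = (1 - 1/p) n'. Dividing by X^\<alpha> and raising to the power p / n'
  gives the claim.\<close>

lemma sobolev_modulus:
  "epow (\<integral>\<^sup>+x\<in>ball 0 1. ennreal (\<Psi> (modulus x) powr (sobolev_exp DIM('a) p)) \<partial>lborel) (p / (sobolev_exp DIM('a) p))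
   \<le> epow (ennreal (4 * real DIM('a)) * epow (ennreal (grad_const DIM('a) p)) (DIM('a) / (real DIM('a) - 1)))
        (p * (real DIM('a) - 1) / DIM('a))
     * (\<integral>\<^sup>+x\<in>ball 0 1. ennreal ((\<Phi> (modulus x) + \<Phi> (mat_norm N (DF x))) powr p) \<partial>lborel)"
proof -
  let ?m = "\<lambda>x. ennreal (\<Psi> (modulus x) powr (sobolev_exp DIM('a) p)) * indicator (ball 0 1) x"
  let ?g = "\<lambda>x. ennreal (wfun x / (2 / (5 * real DIM('a))) + 2 * norm (Dwfun x))"
  note [measurable] = measurable_modulus measurable_mat_norm_DF measurable_Psi_modulus
  define d where "d = real DIM('a)"
  define n' where "n' = d / (d - 1)"
  define X where "X = (\<integral>\<^sup>+x\<in>ball 0 1. ennreal (\<Psi> (modulus x) powr (sobolev_exp DIM('a) p)) \<partial>lborel)"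
  define Y where "Y x = \<Phi> (modulus x) + \<Phi> (mat_norm N (DF x))" for x
  let ?y = "\<lambda>x. ennreal (Y x powr p) * indicator (ball 0 1) x"
  define Z where "Z = (\<integral>\<^sup>+x\<in>ball 0 1. ennreal (Y x powr p) \<partial>lborel)"
  define \<alpha> where "\<alpha> = (1 - 1 / p) * n'"
  have d2: "2 \<le> d" "p < d" "0 < p" using n p by (auto simp: d_def)
  have n'pos: "0 < n'" using d2 by (simp add: n'_def)
  have ps: "sobolev_exp DIM('a) p = d * p / (d - p)" "0 < sobolev_exp DIM('a) p" using d2 by (auto simp: sobolev_exp_def d_def)
  have sn: "chain_exp DIM('a) p * n' = sobolev_exp DIM('a) p" using d2 by (simp add: chain_exp_def n'_def ps d_def[symmetric] divide_simps)
  \<comment> \<open>This identity makes \<Psi> to the power \<open>chain_exp - 1\<close> the (1 -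
    1/p)-th power of the integrand of X, so that Hoelder's inequality reproduces X.\<close>
  have s1: "sobolev_exp DIM('a) p * (1 - 1 / p) = chain_exp DIM('a) p - 1"
    using d2 by (simp add: ps chain_exp_def d_def[symmetric] divide_simps) (simp add: algebra_simps)
  have \<alpha>: "0 \<le> \<alpha>" using p n'pos by (simp add: \<alpha>_def)
  have \<alpha>1: "1 - \<alpha> = (d - p) / (p * (d - 1))"
    using d2 by (simp add: \<alpha>_def n'_def divide_simps) (simp add: algebra_simps)
  have K: "0 \<le> grad_const DIM('a) p" using chain_exp_ge_1 by (simp add: grad_const_def)
  have Y0: "0 \<le> Y x" for x using nonneg by (simp add: Y_def)
  have [measurable]: "Y \<in> borel_measurable borel" unfolding Y_def by measurable
  have [measurable]: "ball (0::'a) 1 \<in> sets borel" by simp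
  have "X = (\<integral>\<^sup>+x\<in>ball 0 1. epow (ennreal (wfun x)) n' \<partial>lborel)"
    unfolding X_def
    by (intro nn_integral_cong) (auto simp: epow_ennreal n'pos wfun_def powr_powr sn)
  also have "\<dots> \<le> ennreal (4 * d) * epow (\<integral>\<^sup>+x\<in>ball 0 1. ?g x \<partial>lborel) n'"
    unfolding d_def n'_def
    by (rule sobolev_C1[OF _ wfun_cont Dwfun_cont wfun_gateaux n]) (simp add: wfun_def)
  also have "(\<integral>\<^sup>+x\<in>ball 0 1. ?g x \<partial>lborel)
      \<le> (\<integral>\<^sup>+x. ennreal (grad_const DIM('a) p) * (epow (?m x) (1 - 1 / p)
             * epow (?y x) (1 / p)) \<partial>lborel)"
  proof (rule nn_integral_mono)
    fix x :: 'a
    \<comment> \<open>For p = 1 the exponent 1 - 1/p is 0 and \<open>epow\<close> is 1 by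
      convention; the real power agrees because \<Psi> is positive at the modulus.\<close>
    have 1: "epow (ennreal (\<Psi> (modulus x) powr (sobolev_exp DIM('a) p))) (1 - 1 / p) = ennreal (\<Psi> (modulus x) powr (chain_exp DIM('a) p - 1))"
    proof (cases "p = 1")
      case True
      then have "chain_exp DIM('a) p = 1" using s1 by simp
      then show ?thesis using True Psi_modulus_pos[of x] by simp
    next
      case False
      then have "0 < 1 - 1 / p" using p by simp
      then show ?thesis by (simp add: epow_ennreal powr_powr s1)
    qed
    have 2: "epow (ennreal (Y x powr p)) (1 / p) = ennreal (Y x)"
      using d2 Y0 by (simp add: epow_ennreal powr_powr)
    have "?g x
      \<le> ennreal (grad_const DIM('a) p * (\<Psi> (modulus x) powr (chain_exp DIM('a) p - 1) * Y x))"
      unfolding Y_def by (intro ennreal_leI integrand_bound)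
    also have "\<dots> = ennreal (grad_const DIM('a) p) * (ennreal (\<Psi> (modulus x) powr (chain_exp DIM('a) p - 1)) * ennreal (Y x))"
      using K Y0 by (simp add: ennreal_mult)
    finally show "?g x * indicator (ball 0 1) x
      \<le> ennreal (grad_const DIM('a) p) * (epow (?m x) (1 - 1 / p)
             * epow (?y x) (1 / p))"
      by (cases "x \<in> ball 0 1") (simp_all add: 1 2)
  qed
  also have "\<dots> = ennreal (grad_const DIM('a) p) * (\<integral>\<^sup>+x. (epow (?m x) (1 - 1 / p)
             * epow (?y x) (1 / p)) \<partial>lborel)"
    by (rule nn_integral_cmult) measurable
  also have "\<dots> \<le> ennreal (grad_const DIM('a) p) * (epow X (1 - 1 / p) * epow Z (1 / p))"
    unfolding X_def Z_def
    by (intro mult_left_mono Holder2_epow) (use p in auto)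
  finally have "X \<le> ennreal (4 * d) * epow (ennreal (grad_const DIM('a) p) * (epow X (1 - 1 / p) * epow Z (1 / p))) n'"
    using n'pos by (simp add: epow_mono mult_left_mono)
  also have "\<dots> = ennreal (4 * d) * (epow (ennreal (grad_const DIM('a) p)) n' * (epow X \<alpha> * epow Z (n' / p)))"
    using n'pos p by (simp add: epow_mult epow_epow \<alpha>_def)
  also have "\<dots> = epow X \<alpha> * (ennreal (4 * d) * epow (ennreal (grad_const DIM('a) p)) n' * epow Z (n' / p))"
    by (simp add: mult_ac)
  finally have le: "X \<le> epow X \<alpha> * (ennreal (4 * d) * epow (ennreal (grad_const DIM('a) p)) n' * epow Z (n' / p))" .
  have pp: "0 < p / sobolev_exp DIM('a) p" using ps d2 by simp
  have "epow X (p / (sobolev_exp DIM('a) p)) \<le> epow (ennreal (4 * d) * epow (ennreal (grad_const DIM('a) p)) n') (p / n') * Z"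
  \<comment> \<open>Division by X^\<alpha> requires 0 < X < \<infinity>, and a positive power 1 -
    \<alpha> survives because p is below the dimension.\<close>
  proof (cases "X = 0")
    case True
    then show ?thesis using pp by simp
  next
    case False
    have fin: "X < \<infinity>" unfolding X_def by (rule Psi_powr_finite)
    have nz: "epow X \<alpha> \<noteq> 0" "epow X \<alpha> < \<infinity>"
      using False fin \<alpha> by (cases X; auto simp: epow_def)+
    have a1: "0 < 1 - \<alpha>" unfolding \<alpha>1 using d2 by simp
    have "epow X \<alpha> * epow X (1 - \<alpha>) = X"
      using epow_add[of \<alpha> "1 - \<alpha>" X] \<alpha> a1 by simp
    then have "epow X \<alpha> * epow X (1 - \<alpha>) \<le> epow X \<alpha> * (ennreal (4 * d) * epow (ennreal (grad_const DIM('a) p)) n' * epow Z (n' / p))"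
      using le by simp
    then have "epow X (1 - \<alpha>) \<le> ennreal (4 * d) * epow (ennreal (grad_const DIM('a) p)) n' * epow Z (n' / p)"
      using nz by (simp add: ennreal_mult_le_mult_iff)
    then have "epow (epow X (1 - \<alpha>)) (p / n') \<le> epow (ennreal (4 * d) * epow (ennreal (grad_const DIM('a) p)) n' * epow Z (n' / p)) (p / n')"
      using n'pos d2 by (intro epow_mono) auto
    also have "\<dots> = epow (ennreal (4 * d) * epow (ennreal (grad_const DIM('a) p)) n') (p / n') * Z"
      using n'pos d2 by (simp add: epow_mult epow_epow)
    also have "epow (epow X (1 - \<alpha>)) (p / n') = epow X (p / (sobolev_exp DIM('a) p))"
    proof -
      have "(1 - \<alpha>) * (p / n') = p / sobolev_exp DIM('a) p" unfolding \<alpha>1 ps(1) n'_def using d2 by (simp add: divide_simps)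
      then show ?thesis using a1 n'pos d2 by (simp add: epow_epow)
    qed
    finally show ?thesis .
  qed
  moreover have "p / n' = p * (d - 1) / d" using d2 by (simp add: n'_def)
  ultimately show ?thesis by (simp add: X_def Z_def Y_def n'_def d_def)
qed

end

end

text \<open>The middle factor is that of \<open>sobolev_modulus\<close>. The factor with 2 D is paid
  for returning from \<Psi> to \<Phi> on the left, the one with 3 D for removing \<kappa> from the
  modulus on the right.\<close>

definition sobolev_const :: "nat \<Rightarrow> real \<Rightarrow> real \<Rightarrow> ennreal" where
  "sobolev_const d p D = ennreal ((2 * D) powr p)
     * epow (ennreal (4 * real d) * epow (ennreal (grad_const d p)) (d / (real d - 1))) (p * (real d - 1) / d)
     * ennreal ((3 * D) powr p)"

lemma sobolev_const_finite:
  "2 \<le> d \<Longrightarrow> 0 < p \<Longrightarrow> sobolev_const d p D < \<infinity>"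
  by (auto simp: sobolev_const_def epow_def ennreal_mult_less_top less_top[symmetric] ennreal_mult_eq_top_iff)

text \<open>On the left the modulus may be lowered to |F|; on the right \<kappa> leaves an error
  \<open>\<Phi> \<kappa> powr p\<close> times the volume. It tends to 0 with \<kappa> because \<Phi>
  is continuous and vanishes at 0.\<close>

lemma (in doubling_young) sobolev_young_C1:
  fixes F :: "'a::euclidean_space \<Rightarrow> nat \<Rightarrow> real" and DF :: "'a \<Rightarrow> nat \<Rightarrow> 'a"
    and p :: real
  assumes n: "2 \<le> DIM('a)" and p: "1 \<le> p" "p < DIM('a)"
    and cF: "\<And>i. i < N \<Longrightarrow> continuous_on UNIV (\<lambda>x. F x i)"
    and cDF: "\<And>i. i < N \<Longrightarrow> continuous_on UNIV (\<lambda>x. DF x i)"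
    and DF: "\<And>i. i < N \<Longrightarrow> gateaux_on (ball 0 1) (\<lambda>x. F x i) (\<lambda>x. DF x i)"
  shows "epow (\<integral>\<^sup>+x\<in>ball 0 1. ennreal (\<Phi> (vec_norm N (F x)) powr (sobolev_exp DIM('a) p)) \<partial>lborel) (p / sobolev_exp DIM('a) p)
   \<le> sobolev_const DIM('a) p D
     * (\<integral>\<^sup>+x\<in>ball 0 1. ennreal (\<Phi> (mat_norm N (DF x)) powr p + \<Phi> (vec_norm N (F x)) powr p) \<partial>lborel)"
proof -
  let ?f = "\<lambda>x. \<Phi> (vec_norm N (F x))"
  let ?g = "\<lambda>x. \<Phi> (mat_norm N (DF x))"
  let ?ps = "sobolev_exp DIM('a) p" and ?B = "ball (0::'a) 1"
  define C1 where "C1 = epow (ennreal (4 * real DIM('a)) * epow (ennreal (grad_const DIM('a) p)) (DIM('a) / (real DIM('a) - 1))) (p * (real DIM('a) - 1) / DIM('a))"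
  define X where "X = (\<integral>\<^sup>+x\<in>?B. ennreal (?f x powr ?ps) \<partial>lborel)"
  define R where "R = (\<integral>\<^sup>+x\<in>?B. ennreal (?g x powr p + ?f x powr p) \<partial>lborel)"
  have ps: "0 < ?ps" using p by (simp add: sobolev_exp_def)
  have D: "1 \<le> D" by (rule D_ge_1)
  have [measurable]: "?B \<in> sets borel" by simp
  have mF: "(\<lambda>x. F x i) \<in> borel_measurable borel" if "i < N" for i
    using cF[OF that] by (rule borel_measurable_continuous_onI)
  have mDF: "(\<lambda>x. DF x i) \<in> borel_measurable borel" if "i < N" for i
    using cDF[OF that] by (rule borel_measurable_continuous_onI)
  have [measurable]: "(\<lambda>x. vec_norm N (F x)) \<in> borel_measurable borel" "(\<lambda>x. mat_norm N (DF x)) \<in> borel_measurable borel"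
    by (auto intro!: measurable_vec_norm measurable_mat_norm mF mDF)
  have bound: "epow X (p / ?ps) \<le> sobolev_const DIM('a) p D * (R + ennreal (\<Phi> \<kappa> powr p) * emeasure lborel ?B)"
    if \<kappa>: "0 < \<kappa>" for \<kappa>
  proof -
    define G where "G = modulus N F \<kappa>"
  let ?Z = "\<integral>\<^sup>+x\<in>?B. ennreal ((\<Phi> (G x) + ?g x) powr p) \<partial>lborel"
  let ?G = "\<integral>\<^sup>+x\<in>?B. ennreal (\<Psi> (G x) powr ?ps) \<partial>lborel"
    have Gm: "0 < G x" "vec_norm N (F x) \<le> G x" "G x \<le> vec_norm N (F x) + \<kappa>" for x
      unfolding G_def
      by (rule modulus_pos[where N = N and F = F and DF = DF, OF n p \<kappa> cF cDF DF] modulus_ge[where N = N and F = F and DF = DF, OF n p \<kappa> cF cDF DF] modulus_le[where N = N and F = F and DF = DF, OF n p \<kappa> cF cDF DF]; assumption)+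
    have [measurable]: "G \<in> borel_measurable borel"
      unfolding G_def by (rule measurable_modulus[where N = N and F = F and DF = DF, OF n p \<kappa> cF cDF DF])
    have [measurable]: "(\<lambda>x. \<Psi> (G x)) \<in> borel_measurable borel"
      unfolding G_def by (rule measurable_Psi_modulus[where N = N and F = F and DF = DF, OF n p \<kappa> cF cDF DF])
    have 1: "X \<le> ennreal ((2 * D) powr ?ps) * ?G"
    proof -
      have "?f x powr ?ps \<le> (2 * D) powr ?ps * \<Psi> (G x) powr ?ps" for x
      proof -
        have "?f x \<le> \<Phi> (2 * (G x / 2))" using Gm by (simp add: mono)
        also have "\<dots> \<le> D * \<Phi> (G x / 2)" using Gm[of x] by (intro doubling) auto
        also have "\<dots> \<le> 2 * D * \<Psi> (G x)" using Psi_ge[OF Gm(1)[of x]] D by simp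
        finally have "?f x powr ?ps \<le> (2 * D * \<Psi> (G x)) powr ?ps"
          using ps nonneg by (intro powr_mono2) auto
        then show ?thesis using D Psi_pos[OF Gm(1)[of x]] by (simp add: powr_mult)
      qed
      then have "X \<le> (\<integral>\<^sup>+x. ennreal ((2 * D) powr ?ps) * (ennreal (\<Psi> (G x) powr ?ps) * indicator ?B x) \<partial>lborel)"
        unfolding X_def by (intro nn_integral_mono) (auto simp: indicator_def ennreal_leI simp flip: ennreal_mult)
      also have "\<dots> = ennreal ((2 * D) powr ?ps) * ?G"
        by (rule nn_integral_cmult) measurable
      finally show ?thesis .
    qed
    have 2: "?Z
      \<le> ennreal ((3 * D) powr p) * (R + ennreal (\<Phi> \<kappa> powr p) * emeasure lborel ?B)"
    proof -
      have "(\<Phi> (G x) + ?g x) powr p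
        \<le> (3 * D) powr p * (?g x powr p + ?f x powr p + \<Phi> \<kappa> powr p)" for x
      proof -
        let ?m = "?g x" and ?f = "?f x"
        have "\<Phi> (G x) \<le> D * ?f + D * \<Phi> \<kappa>"
          using mono[OF Gm(3)[of x]] add_le[of "vec_norm N (F x)" \<kappa>] by linarith
        moreover have "?m \<le> D * ?m" using mult_right_mono[OF D nonneg] by simp
        ultimately have "\<Phi> (G x) + ?m \<le> D * (?m + ?f + \<Phi> \<kappa>)" by (simp add: distrib_left)
        then have "(\<Phi> (G x) + ?m) powr p \<le> (D * (?m + ?f + \<Phi> \<kappa>)) powr p"
          using p nonneg by (intro powr_mono2) (auto intro: add_nonneg_nonneg)
        also have "\<dots> = D powr p * (?m + ?f + \<Phi> \<kappa>) powr p"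
          by (rule powr_mult)
        also have "\<dots> \<le> D powr p * (3 powr p * (?m powr p + ?f powr p + \<Phi> \<kappa> powr p))"
          using p nonneg by (intro mult_left_mono powr_sum3_le) auto
        also have "\<dots> = (3 * D) powr p * (?m powr p + ?f powr p + \<Phi> \<kappa> powr p)"
          using D by (simp add: powr_mult)
        finally show ?thesis .
      qed
      then have "ennreal ((\<Phi> (G x) + ?g x) powr p) * indicator ?B x
         \<le> ennreal ((3 * D) powr p) * (ennreal (?g x powr p + ?f x powr p) * indicator ?B x
             + ennreal (\<Phi> \<kappa> powr p) * indicator ?B x)" for x
        by (cases "x \<in> ?B") (simp_all add: ennreal_leI flip: ennreal_mult ennreal_plus)
      then have "?Z
         \<le> (\<integral>\<^sup>+x. ennreal ((3 * D) powr p) * (ennreal (?g x powr p + ?f x powr p) * indicator ?B x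
             + ennreal (\<Phi> \<kappa> powr p) * indicator ?B x) \<partial>lborel)"
        by (intro nn_integral_mono)
      also have "\<dots> = ennreal ((3 * D) powr p) * (R + ennreal (\<Phi> \<kappa> powr p) * emeasure lborel ?B)"
        unfolding R_def by (subst nn_integral_cmult; (subst nn_integral_add)?; (subst nn_integral_cmult_indicator)?; measurable?) 
      finally show ?thesis .
    qed
    have 3: "epow ?G (p / ?ps)
       \<le> C1 * ?Z"
      unfolding G_def C1_def by (rule sobolev_modulus[where N = N and F = F and DF = DF, OF n p \<kappa> cF cDF DF])
    have "epow X (p / ?ps) \<le> epow (ennreal ((2 * D) powr ?ps) * ?G) (p / ?ps)"
      using ps p by (intro epow_mono 1) auto
    also have "\<dots> = ennreal ((2 * D) powr p) * epow ?G (p / ?ps)"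
      using ps p by (simp add: epow_mult epow_ennreal powr_powr)
    also have "\<dots> \<le> ennreal ((2 * D) powr p) * (C1 * (ennreal ((3 * D) powr p) * (R + ennreal (\<Phi> \<kappa> powr p) * emeasure lborel ?B)))"
      by (intro mult_left_mono order_trans[OF 3] 2) auto
    finally show ?thesis by (simp add: sobolev_const_def C1_def mult_ac)
  qed
  have "(\<lambda>k. \<Phi> (1 / Suc k) powr p) \<longlonglongrightarrow> 0"
  proof -
    have "(\<lambda>k. \<Phi> (1 / Suc k)) \<longlonglongrightarrow> \<Phi> 0"
      by (rule isCont_tendsto_compose[OF isCont LIMSEQ_Suc[OF lim_1_over_n]])
    then have "(\<lambda>k. \<Phi> (1 / Suc k) powr p) \<longlonglongrightarrow> \<Phi> 0 powr p"
      using p nonneg by (intro tendsto_powr2 tendsto_const) auto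
    then show ?thesis using nonpos[of 0] by simp
  qed
  then have "(\<lambda>k. ennreal (\<Phi> (1 / Suc k) powr p)) \<longlonglongrightarrow> 0"
    using tendsto_ennrealI by force
  then have "(\<lambda>k. emeasure lborel ?B * ennreal (\<Phi> (1 / Suc k) powr p)) \<longlonglongrightarrow> emeasure lborel ?B * 0"
    using emeasure_lborel_ball_finite[of "0::'a" 1] by (intro ennreal_tendsto_cmult) simp_all
  then have "(\<lambda>k. R + emeasure lborel ?B * ennreal (\<Phi> (1 / Suc k) powr p)) \<longlonglongrightarrow> R + emeasure lborel ?B * 0"
    by (intro tendsto_add tendsto_const)
  then have "(\<lambda>k. sobolev_const DIM('a) p D * (R + emeasure lborel ?B * ennreal (\<Phi> (1 / Suc k) powr p)))
      \<longlonglongrightarrow> sobolev_const DIM('a) p D * (R + emeasure lborel ?B * 0)"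
    using sobolev_const_finite[OF n, of p D] p by (intro ennreal_tendsto_cmult) simp_all
  then have "epow X (p / ?ps) \<le> sobolev_const DIM('a) p D * (R + emeasure lborel ?B * 0)"
  proof (rule LIMSEQ_le_const, intro exI allI impI)
    show "epow X (p / ?ps) \<le> sobolev_const DIM('a) p D
        * (R + emeasure lborel ?B * ennreal (\<Phi> (1 / Suc k) powr p))" for k
      by (subst mult.commute[of "emeasure lborel ?B"]) (rule bound, simp)
  qed
  then show ?thesis by (simp add: X_def R_def)
qed

subsection \<open>Smooth bump functions\<close>

text \<open>Smoothness in one variable is enough, as the test functions are products of functions of
  single coordinates.\<close>

primrec smooth_upto :: "nat \<Rightarrow> (real \<Rightarrow> real) \<Rightarrow> bool" where
  "smooth_upto 0 f \<longleftrightarrow> True"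
| "smooth_upto (Suc k) f \<longleftrightarrow>
     (\<forall>t. (f has_real_derivative deriv f t) (at t)) \<and> smooth_upto k (deriv f)"

lemma smooth_upto_SucI:
  assumes "\<And>t. (f has_real_derivative f' t) (at t)" "smooth_upto k f'"
  shows "smooth_upto (Suc k) f"
proof -
  have "deriv f = f'" using assms(1) by (intro ext DERIV_imp_deriv)
  then show ?thesis using assms by simp
qed

lemma smooth_upto_Suc_imp: "smooth_upto (Suc k) f \<Longrightarrow> smooth_upto k f"
  by (induction k arbitrary: f) auto

lemma smooth_upto_const: "smooth_upto k (\<lambda>_. c)"
proof (induction k arbitrary: c)
  case (Suc k)
  show ?case by (rule smooth_upto_SucI[OF DERIV_const Suc])
qed simp

lemma smooth_upto_add:
  "smooth_upto k f \<Longrightarrow> smooth_upto k g \<Longrightarrow> smooth_upto k (\<lambda>t. f t + g t)"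
proof (induction k arbitrary: f g)
  case (Suc k)
  show ?case
    by (rule smooth_upto_SucI[where f' = "\<lambda>t. deriv f t + deriv g t"])
       (use Suc in \<open>auto intro: DERIV_add\<close>)
qed simp

lemma smooth_upto_mult:
  "smooth_upto k f \<Longrightarrow> smooth_upto k g \<Longrightarrow> smooth_upto k (\<lambda>t. f t * g t)"
proof (induction k arbitrary: f g)
  case (Suc k)
  have d: "((\<lambda>t. f t * g t) has_real_derivative deriv f t * g t + f t * deriv g t) (at t)" for t
    using DERIV_mult[of f "deriv f t" t UNIV g "deriv g t"] Suc.prems by (simp add: mult.commute)
  show ?case
    by (rule smooth_upto_SucI[OF d])
       (use Suc smooth_upto_Suc_imp in \<open>auto intro!: smooth_upto_add\<close>)
qed simp

lemma smooth_upto_affine: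
  "smooth_upto k f \<Longrightarrow> smooth_upto k (\<lambda>t. f (a + c * t))"
proof (induction k arbitrary: f)
  case (Suc k)
  have d: "((\<lambda>t. f (a + c * t)) has_real_derivative deriv f (a + c * t) * c) (at t)" for t
    by (rule DERIV_chain2[of f]) (use Suc.prems in \<open>auto intro!: derivative_eq_intros\<close>)
  show ?case
    by (rule smooth_upto_SucI[OF d]) (use Suc in \<open>auto intro!: smooth_upto_mult smooth_upto_const\<close>)
qed simp

text \<open>The polynomial parameter closes the family under differentiation, so that smoothness
  follows by induction over all polynomials at once.\<close>

definition exp_step :: "real poly \<Rightarrow> real \<Rightarrow> real" where
  "exp_step P t = (if t \<le> 0 then 0 else poly P (1 / t) * exp (- 1 / t))"

lemma power_mult_poly_div_exp_tendsto_0: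
  "((\<lambda>u::real. u ^ k * poly P u / exp u) \<longlongrightarrow> 0) at_top"
proof (induction P arbitrary: k)
  case (pCons a P)
  have "((\<lambda>u::real. a * (u ^ k / exp u) + u ^ Suc k * poly P u / exp u) \<longlongrightarrow> a * 0 + 0) at_top"
    by (intro tendsto_intros tendsto_power_div_exp_0 pCons)
  then show ?case by (simp add: field_simps)
qed simp

lemma exp_step_deriv:
  "(exp_step P has_real_derivative exp_step ([:0, 0, 1:] * (P - pderiv P)) t) (at t)"
proof -
  let ?Q = "[:0, 0, 1:] * (P - pderiv P)"
  consider "t < 0" | "t = 0" | "0 < t" by linarith
  then show ?thesis
  proof cases
    case 1
    have "((\<lambda>_. 0) has_real_derivative 0) (at t)" by simp
    then have "(exp_step P has_real_derivative 0) (at t)"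
      by (rule has_field_derivative_transform_within_open[where S = "{..<0}"])
         (use 1 in \<open>auto simp: exp_step_def\<close>)
    then show ?thesis using 1 by (simp add: exp_step_def)
  next
    \<comment> \<open>With u = 1 / h the difference quotient at 0 from the right is u P(u) exp(-u),
      and the exponential sends it to 0.\<close>
    case 2
    have "((\<lambda>u. u ^ 1 * poly P u / exp u) \<longlongrightarrow> 0) at_top"
      by (rule power_mult_poly_div_exp_tendsto_0)
    then have "((\<lambda>u. exp_step P (inverse u) / inverse u) \<longlongrightarrow> 0) at_top"
    proof (rule Lim_transform_eventually)
      show "\<forall>\<^sub>F u in at_top. u ^ 1 * poly P u / exp u = exp_step P (inverse u) / inverse u"
        using eventually_gt_at_top[of 0]
        by eventually_elim (simp add: exp_step_def exp_minus divide_inverse)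
    qed
    then have r: "((\<lambda>h. exp_step P h / h) \<longlongrightarrow> 0) (at_right 0)"
      by (simp add: filterlim_at_right_to_top)
    have "eventually (\<lambda>h. exp_step P h / h = 0) (at_left 0)"
      by (auto simp: exp_step_def eventually_at_filter)
    then have "((\<lambda>h. exp_step P h / h) \<longlongrightarrow> 0) (at_left 0)"
      by (simp add: tendsto_eventually)
    then have "((\<lambda>h. exp_step P h / h) \<longlongrightarrow> 0) (at 0)" using r by (simp add: filterlim_at_split)
    then show ?thesis using 2 by (simp add: has_field_derivative_iff exp_step_def)
  next
    case 3
    define u where "u = 1 / t"
    have d1: "((\<lambda>t. 1 / t) has_real_derivative - (u * u)) (at t)"
      by (auto intro!: derivative_eq_intros simp: u_def) (use 3 in simp)
    have d2: "((\<lambda>t. - 1 / t) has_real_derivative u * u) (at t)"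
      using DERIV_minus[OF d1] by simp
    have "((\<lambda>t. poly P (1 / t) * exp (- 1 / t)) has_real_derivative
        (poly (pderiv P) u * - (u * u)) * exp (- 1 / t) + (exp (- 1 / t) * (u * u)) * poly P (1 / t)) (at t)"
      using DERIV_chain2[OF poly_DERIV d1] DERIV_chain2[OF DERIV_exp d2]
      unfolding u_def by (rule DERIV_mult)
    also have "(poly (pderiv P) u * - (u * u)) * exp (- 1 / t) + (exp (- 1 / t) * (u * u)) * poly P (1 / t)
        = exp_step ?Q t"
      using 3 by (simp add: exp_step_def u_def[symmetric] algebra_simps)
    finally have "((\<lambda>t. poly P (1 / t) * exp (- 1 / t)) has_real_derivative exp_step ?Q t) (at t)" .
    then show ?thesis
      by (rule has_field_derivative_transform_within_open[where S = "{0<..}"])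
         (use 3 in \<open>auto simp: exp_step_def\<close>)
  qed
qed

lemma exp_step_smooth: "smooth_upto k (exp_step P)"
proof (induction k arbitrary: P)
  case (Suc k)
  show ?case by (rule smooth_upto_SucI[OF exp_step_deriv Suc])
qed simp

definition bump :: "real \<Rightarrow> real" where
  "bump t = exp_step 1 t * exp_step 1 (1 - t)"

lemma bump_smooth: "smooth_upto k (\<lambda>t. bump (a + c * t))"
proof -
  have "smooth_upto k (\<lambda>t. exp_step 1 (1 + (-1) * t))"
    by (rule smooth_upto_affine[OF exp_step_smooth])
  then have "smooth_upto k bump"
    unfolding bump_def[abs_def] by (intro smooth_upto_mult exp_step_smooth) simp
  then show ?thesis by (rule smooth_upto_affine)
qed

lemma bump_nonneg: "0 \<le> bump t" and bump_pos: "0 < t \<Longrightarrow> t < 1 \<Longrightarrow> 0 < bump t"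
  and bump_outside: "t \<notin> {0<..<1} \<Longrightarrow> bump t = 0"
  by (auto simp: bump_def exp_step_def)

section \<open>Tensor products of functions of one real variable\<close>

definition tensor :: "('a::euclidean_space \<Rightarrow> real \<Rightarrow> real) \<Rightarrow> 'a \<Rightarrow> real" where
  "tensor h y = (\<Prod>b\<in>Basis. h b (y \<bullet> b))"

lemma tensor_has_derivative:
  assumes "\<And>b. b \<in> Basis \<Longrightarrow> smooth_upto 1 (h b)"
  shows "(tensor h has_derivative (\<lambda>v. \<Sum>b\<in>Basis. (v \<bullet> b) * tensor (h(b := deriv (h b))) y)) (at y)"
proof -
  have "((\<lambda>y. h b (y \<bullet> b)) has_derivative (\<lambda>v. deriv (h b) (y \<bullet> b) * (v \<bullet> b))) (at y)"
    if "b \<in> Basis" for b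
  proof -
    have "(h b has_derivative (*) (deriv (h b) (y \<bullet> b))) (at (y \<bullet> b))"
      using assms[OF that] by (simp add: has_field_derivative_def)
    then show ?thesis
      by (intro has_derivative_compose[where f = "\<lambda>y. y \<bullet> b" and g = "h b"
            and f' = "\<lambda>v. v \<bullet> b" and g' = "(*) (deriv (h b) (y \<bullet> b))"])
         (auto intro!: derivative_eq_intros)
  qed
  then have "(tensor h has_derivative (\<lambda>v. \<Sum>b\<in>Basis. (deriv (h b) (y \<bullet> b) * (v \<bullet> b))
      * (\<Prod>j\<in>Basis - {b}. h j (y \<bullet> j)))) (at y)"
    unfolding tensor_def[abs_def] by (rule has_derivative_prod)
  moreover have "(deriv (h b) (y \<bullet> b) * (v \<bullet> b)) * (\<Prod>j\<in>Basis - {b}. h j (y \<bullet> j))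
      = (v \<bullet> b) * tensor (h(b := deriv (h b))) y" if "b \<in> Basis" for b v
    using that by (simp add: tensor_def prod.remove[of Basis b] mult_ac)
  ultimately show ?thesis by (simp cong: sum.cong)
qed

lemma sum_inner_Basis_mult:
  fixes g :: "'a::euclidean_space \<Rightarrow> real"
  assumes "b \<in> Basis"
  shows "(\<Sum>i\<in>Basis. (b \<bullet> i) * g i) = g b"
proof -
  have "(\<Sum>i\<in>Basis. (b \<bullet> i) * g i) = (\<Sum>i\<in>Basis. if i = b then g i else 0)"
    by (rule sum.cong) (use assms in \<open>auto simp: inner_Basis\<close>)
  then show ?thesis using assms by simp
qed

lemma tensor_frechet:
  assumes "\<And>b. b \<in> Basis \<Longrightarrow> smooth_upto 1 (h b)" and b: "b \<in> Basis"
  shows "frechet_derivative (\<lambda>y. c * tensor h y) (at y) b = c * tensor (h(b := deriv (h b))) y"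
proof -
  have "frechet_derivative (\<lambda>y. c * tensor h y) (at y)
      = (\<lambda>v. c * (\<Sum>b\<in>Basis. (v \<bullet> b) * tensor (h(b := deriv (h b))) y))"
    by (intro frechet_derivative_at[symmetric] has_derivative_mult_right tensor_has_derivative assms(1))
  then show ?thesis by (simp only: sum_inner_Basis_mult[OF b])
qed

lemma tensor_continuous:
  assumes "\<And>b. b \<in> Basis \<Longrightarrow> smooth_upto 1 (h b)"
  shows "continuous_on A (tensor h)"
  by (intro continuous_at_imp_continuous_on ballI has_derivative_continuous[OF tensor_has_derivative] assms)

text \<open>A partial derivative of a tensor product is again a tensor product, with one factor
  differentiated. The induction therefore runs over all families \<open>h\<close>.\<close>

lemma tensor_Ck:
  assumes "\<And>b k. b \<in> Basis \<Longrightarrow> smooth_upto k (h b)"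
  shows "Ck k (\<lambda>y. c * tensor h y)"
  using assms
proof (induction k arbitrary: h c)
  case 0
  then show ?case by (auto intro!: continuous_intros tensor_continuous)
next
  case (Suc k)
  have h1: "\<And>b. b \<in> Basis \<Longrightarrow> smooth_upto 1 (h b)" using Suc.prems by blast
  have "((\<lambda>y. c * tensor h y) has_derivative (\<lambda>v. c * (\<Sum>b\<in>Basis. (v \<bullet> b) * tensor (h(b := deriv (h b))) y))) (at y)" for y
    by (intro has_derivative_mult_right tensor_has_derivative h1)
  then have "(\<lambda>y. c * tensor h y) differentiable_on UNIV"
    unfolding differentiable_on_def differentiable_def by blast
  moreover have "Ck k (\<lambda>y. frechet_derivative (\<lambda>y. c * tensor h y) (at y) b)" if b: "b \<in> Basis" for b
  proof -
    have "smooth_upto k' (deriv (h b))" for k' using Suc.prems[OF b, of "Suc k'"] by simp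
    then have "Ck k (\<lambda>y. c * tensor (h(b := deriv (h b))) y)"
      by (intro Suc.IH) (use Suc.prems in auto)
    moreover have "frechet_derivative (\<lambda>y. c * tensor h y) (at y) b = c * tensor (h(b := deriv (h b))) y" for y
      by (rule tensor_frechet) (use h1 b in auto)
    ultimately show ?thesis by simp
  qed
  ultimately show ?case by simp
qed

subsection \<open>Mollification\<close>

lemma conv_integrable:
  fixes u :: "'a::euclidean_space \<Rightarrow> 'b::euclidean_space" and \<phi> :: "'a \<Rightarrow> real"
  assumes u: "integrable lborel u" and [measurable]: "\<phi> \<in> borel_measurable borel"
    and b: "\<And>y. \<bar>\<phi> y\<bar> \<le> C"
  shows "integrable lborel (\<lambda>y. \<phi> (y - x) *\<^sub>R u y)"
proof (rule Bochner_Integration.integrable_bound)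
  show "integrable lborel (\<lambda>y. C *\<^sub>R u y)" using u by simp
  have [measurable]: "u \<in> borel_measurable borel" using u by auto
  show "(\<lambda>y. \<phi> (y - x) *\<^sub>R u y) \<in> borel_measurable lborel" by measurable
  have "0 \<le> C" using b[of 0] by linarith
  then show "AE y in lborel. norm (\<phi> (y - x) *\<^sub>R u y) \<le> norm (C *\<^sub>R u y)"
    using b by (auto intro!: mult_right_mono)
qed

lemma conv_continuous:
  fixes u :: "'a::euclidean_space \<Rightarrow> 'b::euclidean_space" and \<phi> :: "'a \<Rightarrow> real"
  assumes u: "integrable lborel u" and c: "continuous_on UNIV \<phi>" and b: "\<And>y. \<bar>\<phi> y\<bar> \<le> C"
  shows "continuous_on UNIV (\<lambda>x. \<integral>y. \<phi> (y - x) *\<^sub>R u y \<partial>lborel)"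
proof (rule continuous_at_imp_continuous_on, rule ballI)
  have [measurable]: "\<phi> \<in> borel_measurable borel" using c by (rule borel_measurable_continuous_onI)
  have [measurable]: "u \<in> borel_measurable borel" using u by auto
  have C: "0 \<le> C" using b[of 0] by linarith
  fix x
  show "isCont (\<lambda>x. \<integral>y. \<phi> (y - x) *\<^sub>R u y \<partial>lborel) x"
    unfolding continuous_at_sequentially comp_def
  proof (intro allI impI)
    fix X assume X: "X \<longlonglongrightarrow> x"
    show "(\<lambda>n. \<integral>y. \<phi> (y - X n) *\<^sub>R u y \<partial>lborel) \<longlonglongrightarrow> (\<integral>y. \<phi> (y - x) *\<^sub>R u y \<partial>lborel)"
    proof (rule integral_dominated_convergence[where w = "\<lambda>y. C * norm (u y)"])
      show "integrable lborel (\<lambda>y. C * norm (u y))" using u by simp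
      show "AE y in lborel. (\<lambda>n. \<phi> (y - X n) *\<^sub>R u y) \<longlonglongrightarrow> \<phi> (y - x) *\<^sub>R u y"
      proof (intro AE_I2 tendsto_scaleR tendsto_const)
        fix y
        have "isCont \<phi> (y - x)" using c by (simp add: continuous_on_eq_continuous_at)
        moreover have "(\<lambda>n. y - X n) \<longlonglongrightarrow> y - x" by (intro tendsto_intros X)
        ultimately show "(\<lambda>n. \<phi> (y - X n)) \<longlonglongrightarrow> \<phi> (y - x)" by (rule isCont_tendsto_compose)
      qed
      show "AE y in lborel. norm (\<phi> (y - X n) *\<^sub>R u y) \<le> C * norm (u y)" for n
        using b by (auto intro!: mult_right_mono)
    qed measurable
  qed
qed

text \<open>The mean value inequality dominates the difference quotients by C |v| |u|, so dominated
  convergence allows differentiation under the integral. The minus sign appears because x enters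
  through y - x.\<close>

lemma conv_has_derivative:
  fixes u :: "'a::euclidean_space \<Rightarrow> real" and \<phi> :: "'a \<Rightarrow> real" and D\<phi> :: "'a \<Rightarrow> 'a"
  assumes u: "integrable lborel u" and d: "\<And>y. (\<phi> has_derivative (\<lambda>v. D\<phi> y \<bullet> v)) (at y)"
    and b: "\<And>y. \<bar>\<phi> y\<bar> \<le> C" and Db: "\<And>y. norm (D\<phi> y) \<le> C" and [measurable]: "D\<phi> \<in> borel_measurable borel"
  shows "((\<lambda>t. \<integral>y. \<phi> (y - (x + t *\<^sub>R v)) *\<^sub>R u y \<partial>lborel) has_real_derivative
     - (\<integral>y. (D\<phi> (y - x) \<bullet> v) * u y \<partial>lborel)) (at 0)"
proof -
  have c: "continuous_on UNIV \<phi>"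
    by (intro continuous_at_imp_continuous_on ballI has_derivative_continuous[OF d])
  then have [measurable]: "\<phi> \<in> borel_measurable borel" by (rule borel_measurable_continuous_onI)
  have [measurable]: "u \<in> borel_measurable borel" using u by auto
  define k where "k y t = \<phi> (y - (x + t *\<^sub>R v))" for y t
  have kd: "(k y has_real_derivative - (D\<phi> (y - (x + t *\<^sub>R v)) \<bullet> v)) (at t)" for y t
  proof -
    have "((\<lambda>t. \<phi> (y - (x + t *\<^sub>R v))) has_derivative (\<lambda>s. D\<phi> (y - (x + t *\<^sub>R v)) \<bullet> (- (s *\<^sub>R v)))) (at t)"
      by (rule has_derivative_compose[where g = \<phi>, OF _ d]) (auto intro!: derivative_eq_intros)
    moreover have "(\<lambda>s. D\<phi> (y - (x + t *\<^sub>R v)) \<bullet> (- (s *\<^sub>R v))) = (*) (- (D\<phi> (y - (x + t *\<^sub>R v)) \<bullet> v))"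
      by (auto simp: fun_eq_iff)
    ultimately show ?thesis
      unfolding has_field_derivative_def k_def by simp
  qed
  have int: "integrable lborel (\<lambda>y. k y t * u y)" for t
    using conv_integrable[where \<phi> = \<phi>, OF u _ b, where x = "x + t *\<^sub>R v"] by (simp add: k_def)
  have "((\<lambda>t. (\<integral>y. k y t * u y \<partial>lborel)) has_real_derivative (\<integral>y. - (D\<phi> (y - x) \<bullet> v) * u y \<partial>lborel)) (at 0)"
    unfolding has_field_derivative_iff tendsto_at_iff_sequentially comp_def
  proof (intro allI impI)
    fix X :: "nat \<Rightarrow> real" assume X: "\<forall>i. X i \<in> UNIV - {0}" "X \<longlonglongrightarrow> 0"
    have X0: "X i \<noteq> 0" for i using X by auto
    have lim: "(\<lambda>i. \<integral>y. (k y (X i) - k y 0) / X i * u y \<partial>lborel) \<longlonglongrightarrow> (\<integral>y. - (D\<phi> (y - x) \<bullet> v) * u y \<partial>lborel)"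
    proof (rule integral_dominated_convergence[where w = "\<lambda>y. (C * norm v) * \<bar>u y\<bar>"])
      show "integrable lborel (\<lambda>y. (C * norm v) * \<bar>u y\<bar>)" using u by simp
      show "AE y in lborel. (\<lambda>i. (k y (X i) - k y 0) / X i * u y) \<longlonglongrightarrow> - (D\<phi> (y - x) \<bullet> v) * u y"
      proof (intro AE_I2 tendsto_mult tendsto_const)
        fix y
        have "((\<lambda>h. (k y (0 + h) - k y 0) / h) \<longlongrightarrow> - (D\<phi> (y - x) \<bullet> v)) (at 0)"
          using kd[of y 0] by (simp add: DERIV_def)
        then show "(\<lambda>i. (k y (X i) - k y 0) / X i) \<longlonglongrightarrow> - (D\<phi> (y - x) \<bullet> v)"
          using X unfolding tendsto_at_iff_sequentially comp_def by simp
      qed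
      show "AE y in lborel. norm ((k y (X i) - k y 0) / X i * u y) \<le> (C * norm v) * \<bar>u y\<bar>" for i
      proof (intro AE_I2)
        fix y
        have "norm (k y (X i) - k y 0) \<le> (C * norm v) * norm (X i - 0)"
        proof (rule field_differentiable_bound[OF convex_UNIV])
          show "(k y has_field_derivative - (D\<phi> (y - (x + t *\<^sub>R v)) \<bullet> v)) (at t within UNIV)" for t
            using kd by simp
          show "norm (- (D\<phi> (y - (x + t *\<^sub>R v)) \<bullet> v)) \<le> C * norm v" for t
            using Cauchy_Schwarz_ineq2[of "D\<phi> (y - (x + t *\<^sub>R v))" v] Db[of "y - (x + t *\<^sub>R v)"]
            by (smt (verit) mult_right_mono norm_ge_zero norm_minus_cancel real_norm_def)
        qed auto
        then have "\<bar>(k y (X i) - k y 0) / X i\<bar> \<le> C * norm v"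
          using X0[of i] by (simp add: field_simps)
        then show "norm ((k y (X i) - k y 0) / X i * u y) \<le> (C * norm v) * \<bar>u y\<bar>"
          unfolding real_norm_def abs_mult by (rule mult_right_mono) simp
      qed
    qed (unfold k_def, measurable)
    have eq: "(\<integral>y. (k y (X i) - k y 0) / X i * u y \<partial>lborel)
        = ((\<integral>y. k y (X i) * u y \<partial>lborel) - (\<integral>y. k y 0 * u y \<partial>lborel)) / X i" for i
    proof -
      have "((\<integral>y. k y (X i) * u y \<partial>lborel) - (\<integral>y. k y 0 * u y \<partial>lborel)) / X i
          = (\<integral>y. (k y (X i) * u y - k y 0 * u y) / X i \<partial>lborel)"
        using int by simp
      then show ?thesis by (simp add: left_diff_distrib diff_divide_distrib)
    qed
    show "(\<lambda>i. ((\<integral>y. k y (X i) * u y \<partial>lborel) - (\<integral>y. k y 0 * u y \<partial>lborel)) / (X i - 0))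
       \<longlonglongrightarrow> (\<integral>y. - (D\<phi> (y - x) \<bullet> v) * u y \<partial>lborel)"
      using lim by (simp only: eq diff_zero)
  qed
  then show ?thesis by (simp add: k_def)
qed

text \<open>The support lies in a cube with a corner at the origin instead of a centred ball: the
  kernel at x then lives in a cube with corner x, the shape used for Lebesgue differentiation.
  Smoothness is asked of all scaled translates because these serve as test functions.\<close>

locale mollifier =
  fixes \<rho> :: "'a::euclidean_space \<Rightarrow> real" and D\<rho> :: "'a \<Rightarrow> 'a" and M :: real
  assumes smooth: "\<And>c \<epsilon> x k. 0 < \<epsilon> \<Longrightarrow> Ck k (\<lambda>y. c * \<rho> ((y - x) /\<^sub>R \<epsilon>))"
    and deriv: "\<And>u. (\<rho> has_derivative (\<lambda>v. D\<rho> u \<bullet> v)) (at u)"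
    and Dcont: "continuous_on UNIV D\<rho>"
    and rho_nonneg: "\<And>u. 0 \<le> \<rho> u"
    and rho_le: "\<And>u. \<rho> u \<le> M"
    and D_le: "\<And>u. norm (D\<rho> u) \<le> M"
    and supp: "\<And>u. \<rho> u \<noteq> 0 \<Longrightarrow> u \<in> cbox 0 One"
    and mass: "(\<integral>\<^sup>+u. ennreal (\<rho> u) \<partial>lborel) = 1"
begin

definition K :: "real \<Rightarrow> 'a \<Rightarrow> real" where
  "K \<epsilon> u = \<rho> (u /\<^sub>R \<epsilon>) / \<epsilon> ^ DIM('a)"

definition DK :: "real \<Rightarrow> 'a \<Rightarrow> 'a" where
  "DK \<epsilon> u = D\<rho> (u /\<^sub>R \<epsilon>) /\<^sub>R (\<epsilon> ^ DIM('a) * \<epsilon>)"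

lemma rho_cont: "continuous_on UNIV \<rho>"
  by (intro continuous_at_imp_continuous_on ballI has_derivative_continuous[OF deriv])

lemma measurable_rho [measurable]: "\<rho> \<in> borel_measurable borel"
  using rho_cont by (rule borel_measurable_continuous_onI)

context
  fixes \<epsilon> :: real assumes \<epsilon>: "0 < \<epsilon>"
begin

lemma K_nonneg: "0 \<le> K \<epsilon> u"
  using rho_nonneg \<epsilon> by (simp add: K_def)

lemma K_le: "K \<epsilon> u \<le> M / \<epsilon> ^ DIM('a)"
  using rho_le \<epsilon> by (simp add: K_def divide_right_mono)

lemma K_abs_le: "\<bar>K \<epsilon> u\<bar> \<le> M / \<epsilon> ^ DIM('a)"
  using K_le K_nonneg by simp

lemma K_deriv: "(K \<epsilon> has_derivative (\<lambda>v. DK \<epsilon> u \<bullet> v)) (at u)"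
proof -
  have "((\<lambda>u. \<rho> (u /\<^sub>R \<epsilon>)) has_derivative (\<lambda>v. D\<rho> (u /\<^sub>R \<epsilon>) \<bullet> (v /\<^sub>R \<epsilon>))) (at u)"
    by (rule has_derivative_compose[where g = \<rho>, OF _ deriv]) (auto intro!: derivative_eq_intros)
  then have "((\<lambda>u. \<rho> (u /\<^sub>R \<epsilon>) * (1 / \<epsilon> ^ DIM('a))) has_derivative (\<lambda>v. D\<rho> (u /\<^sub>R \<epsilon>) \<bullet> (v /\<^sub>R \<epsilon>) * (1 / \<epsilon> ^ DIM('a)))) (at u)"
    by (rule has_derivative_mult_left)
  then show ?thesis
    using \<epsilon> by (simp add: K_def[abs_def] DK_def divide_inverse mult_ac)
qed

lemma K_cont: "continuous_on UNIV (K \<epsilon>)"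
  by (intro continuous_at_imp_continuous_on ballI has_derivative_continuous[OF K_deriv])

lemma measurable_K: "K \<epsilon> \<in> borel_measurable borel"
  using K_cont by (rule borel_measurable_continuous_onI)

lemma measurable_DK: "DK \<epsilon> \<in> borel_measurable borel"
proof (rule borel_measurable_continuous_onI)
  show "continuous_on UNIV (DK \<epsilon>)"
    unfolding DK_def[abs_def] using \<epsilon>
    by (intro continuous_intros continuous_on_compose2[OF Dcont]) auto
qed

lemma DK_le: "norm (DK \<epsilon> u) \<le> M / (\<epsilon> ^ DIM('a) * \<epsilon>)"
  using D_le[of "u /\<^sub>R \<epsilon>"] \<epsilon> by (simp add: DK_def field_simps)

lemma K_supp: "K \<epsilon> (y - x) \<noteq> 0 \<Longrightarrow> y \<in> cbox x (x + \<epsilon> *\<^sub>R One)"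
  using supp[of "(y - x) /\<^sub>R \<epsilon>"] \<epsilon>
  by (auto simp: K_def mem_box inner_simps field_simps)

lemma K_mass: "(\<integral>\<^sup>+y. ennreal (K \<epsilon> (y - x)) \<partial>lborel) = 1"
proof -
  have "(\<integral>\<^sup>+y. ennreal (K \<epsilon> (y - x)) \<partial>lborel)
     = (\<integral>\<^sup>+y. ennreal (K \<epsilon> (y - x)) \<partial>density (distr lborel borel (\<lambda>u. x + \<epsilon> *\<^sub>R u)) (\<lambda>_. ennreal (\<bar>\<epsilon>\<bar> ^ DIM('a))))"
    using lborel_affine[of \<epsilon> x] \<epsilon> by simp
  also have "\<dots> = (\<integral>\<^sup>+u. ennreal (\<epsilon> ^ DIM('a)) * ennreal (K \<epsilon> (\<epsilon> *\<^sub>R u)) \<partial>lborel)"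
    using measurable_K \<epsilon> by (simp add: nn_integral_density nn_integral_distr)
  also have "\<dots> = (\<integral>\<^sup>+u. ennreal (\<rho> u) \<partial>lborel)"
    using \<epsilon> rho_nonneg by (intro nn_integral_cong) (simp add: K_def flip: ennreal_mult)
  finally show ?thesis by (simp add: mass)
qed

lemma K_mass': "(\<integral>\<^sup>+x. ennreal (K \<epsilon> (y - x)) \<partial>lborel) = 1"
proof -
  have "(\<integral>\<^sup>+x. ennreal (K \<epsilon> (y - x)) \<partial>lborel)
     = (\<integral>\<^sup>+x. ennreal (K \<epsilon> (y - x)) \<partial>density (distr lborel borel (\<lambda>u. y + (-1) *\<^sub>R u)) (\<lambda>_. ennreal (\<bar>-1\<bar> ^ DIM('a))))"
    using lborel_affine[of "-1" y] by simp
  also have "\<dots> = (\<integral>\<^sup>+u. ennreal (K \<epsilon> (u - 0)) \<partial>lborel)"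
    using measurable_K by (simp add: nn_integral_density nn_integral_distr)
  finally show ?thesis using K_mass[of 0] by simp
qed

lemma test_function_K:
  assumes "cbox x (x + \<epsilon> *\<^sub>R One) \<subseteq> U"
  shows "test_function U (\<lambda>y. K \<epsilon> (y - x))"
proof -
  have "{y. K \<epsilon> (y - x) \<noteq> 0} \<subseteq> cbox x (x + \<epsilon> *\<^sub>R One)" using K_supp by blast
  then have cl: "closure {y. K \<epsilon> (y - x) \<noteq> 0} \<subseteq> cbox x (x + \<epsilon> *\<^sub>R One)"
    by (rule closure_minimal) (rule closed_cbox)
  then have "compact (closure {y. K \<epsilon> (y - x) \<noteq> 0})"
    by (metis bounded_cbox bounded_subset closed_closure compact_eq_bounded_closed)
  moreover have "Ck k (\<lambda>y. K \<epsilon> (y - x))" for k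
    using smooth[OF \<epsilon>, of k "1 / \<epsilon> ^ DIM('a)" x] by (simp add: K_def)
  ultimately show ?thesis using cl assms by (auto simp: test_function_def)
qed

lemma frechet_K: "frechet_derivative (\<lambda>y. K \<epsilon> (y - x)) (at y) b = DK \<epsilon> (y - x) \<bullet> b"
proof -
  have "((\<lambda>y. K \<epsilon> (y - x)) has_derivative (\<lambda>v. DK \<epsilon> (y - x) \<bullet> v)) (at y)"
    by (rule has_derivative_compose[where g = "K \<epsilon>", OF _ K_deriv]) (auto intro!: derivative_eq_intros)
  then show ?thesis by (simp flip: frechet_derivative_at)
qed

definition mol :: "('a \<Rightarrow> 'b::euclidean_space) \<Rightarrow> 'a \<Rightarrow> 'b" where
  "mol u x = (\<integral>y. K \<epsilon> (y - x) *\<^sub>R u y \<partial>lborel)"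

lemma mol_integrable:
  "integrable lborel (u :: 'a \<Rightarrow> 'b::euclidean_space) \<Longrightarrow> integrable lborel (\<lambda>y. K \<epsilon> (y - x) *\<^sub>R u y)"
  by (rule conv_integrable[OF _ measurable_K K_abs_le])

lemma mol_cont: "integrable lborel u \<Longrightarrow> continuous_on UNIV (mol u)"
  unfolding mol_def[abs_def] by (rule conv_continuous[OF _ K_cont K_abs_le])

text \<open>Differentiation falls on the kernel, and the weak formulation, tested with the kernel at
  x, moves it to \<open>G\<close>. The set \<open>S\<close> is meant to consist of points whose
  kernels fit into the domain.\<close>

lemma mol_gateaux:
  fixes u :: "'a \<Rightarrow> real" and G :: "'a \<Rightarrow> 'a"
  assumes u: "integrable lborel u" and G: "integrable lborel G"
    and weak: "\<And>x b. x \<in> S \<Longrightarrow> b \<in> Basis \<Longrightarrow>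
      (\<integral>y. u y * frechet_derivative (\<lambda>y. K \<epsilon> (y - x)) (at y) b \<partial>lborel) = - (\<integral>y. (G y \<bullet> b) * K \<epsilon> (y - x) \<partial>lborel)"
  shows "gateaux_on S (mol u) (mol G)"
  unfolding gateaux_on_def
proof (intro ballI allI)
  fix x v assume x: "x \<in> S"
  have M: "0 \<le> M" using rho_nonneg[of 0] rho_le[of 0] by linarith
  define C where "C = M / \<epsilon> ^ DIM('a) + M / (\<epsilon> ^ DIM('a) * \<epsilon>)"
  have b: "\<bar>K \<epsilon> y\<bar> \<le> C" "norm (DK \<epsilon> y) \<le> C" for y
    using K_abs_le[of y] DK_le[of y] M \<epsilon> by (auto simp: C_def intro: add_increasing add_increasing2)
  note [measurable] = measurable_DK measurable_K
  have [measurable]: "u \<in> borel_measurable borel" "G \<in> borel_measurable borel" using u G by auto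
  have iG: "integrable lborel (\<lambda>y. (G y \<bullet> b) * K \<epsilon> (y - x))" for b
    using integrable_inner_left[of b, OF mol_integrable[OF G, of x]] by (simp add: mult.commute)
  have iD: "integrable lborel (\<lambda>y. (DK \<epsilon> (y - x) \<bullet> b) * u y)" for b
  proof -
    have "\<bar>DK \<epsilon> y \<bullet> b\<bar> \<le> C * norm b" for y
      using Cauchy_Schwarz_ineq2[of "DK \<epsilon> y" b] mult_right_mono[OF b(2)[of y] norm_ge_zero[of b]] by linarith
    from conv_integrable[where \<phi> = "\<lambda>y. DK \<epsilon> y \<bullet> b" and x = x, OF u _ this] show ?thesis by simp
  qed
  \<comment> \<open>The weak formulation knows only coordinate directions, so \<open>v\<close> is
    expanded in the basis here and reassembled after integration by parts.\<close>
  have "- (\<integral>y. (DK \<epsilon> (y - x) \<bullet> v) * u y \<partial>lborel)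
      = - (\<integral>y. (\<Sum>b\<in>Basis. (v \<bullet> b) * ((DK \<epsilon> (y - x) \<bullet> b) * u y)) \<partial>lborel)"
    by (subst euclidean_inner) (simp add: sum_distrib_right sum_distrib_left mult_ac)
  also have "\<dots> = (\<Sum>b\<in>Basis. (v \<bullet> b) * - (\<integral>y. (DK \<epsilon> (y - x) \<bullet> b) * u y \<partial>lborel))"
    using iD by (simp add: sum_negf)
  also have "\<dots> = (\<Sum>b\<in>Basis. (v \<bullet> b) * (\<integral>y. (G y \<bullet> b) * K \<epsilon> (y - x) \<partial>lborel))"
    using weak[OF x] by (intro sum.cong refl) (simp add: frechet_K mult.commute)
  also have "\<dots> = (\<integral>y. (\<Sum>b\<in>Basis. (v \<bullet> b) * ((G y \<bullet> b) * K \<epsilon> (y - x))) \<partial>lborel)"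
    using iG by simp
  also have "\<dots> = (\<integral>y. (K \<epsilon> (y - x) *\<^sub>R G y) \<bullet> v \<partial>lborel)"
    by (subst (3) euclidean_inner) (simp add: sum_distrib_left mult_ac)
  also have "\<dots> = mol G x \<bullet> v"
    unfolding mol_def using mol_integrable[OF G] by (simp del: inner_scaleR_left)
  finally have eq: "- (\<integral>y. (DK \<epsilon> (y - x) \<bullet> v) * u y \<partial>lborel) = mol G x \<bullet> v" .
  show "((\<lambda>t. mol u (x + t *\<^sub>R v)) has_real_derivative mol G x \<bullet> v) (at 0)"
    unfolding eq[symmetric] unfolding mol_def by (rule conv_has_derivative[OF u K_deriv b measurable_DK])
qed

end

end

lemma bounded_of_cont_zero_outside:
  fixes g :: "'a::euclidean_space \<Rightarrow> 'b::euclidean_space"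
  assumes "continuous_on UNIV g" "\<And>u. u \<notin> cbox 0 One \<Longrightarrow> g u = 0"
  shows "\<exists>B. \<forall>u. norm (g u) \<le> B"
proof -
  have "compact (g ` cbox 0 One)"
    by (rule compact_continuous_image[OF continuous_on_subset[OF assms(1)]]) auto
  then have "bounded (g ` cbox 0 One)" by (rule compact_imp_bounded)
  then obtain B where B: "\<And>u. u \<in> cbox 0 One \<Longrightarrow> norm (g u) \<le> B" by (auto simp: bounded_iff)
  have "norm (g u) \<le> max B 0" for u
    using B[of u] assms(2)[of u] by (cases "u \<in> cbox 0 One") auto
  then show ?thesis by blast
qed

text \<open>A tensor product of bumps is divided by its integral, which is finite because the
  function is bounded with bounded support, and nonzero because it is positive on the open
  cube.\<close>

lemma mollifier_exists: "\<exists>(\<rho> :: 'a::euclidean_space \<Rightarrow> real) D\<rho> M. mollifier \<rho> D\<rho> M"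
proof -
  define T :: "'a \<Rightarrow> real" where "T = tensor (\<lambda>_. bump)"
  define T' :: "'a \<Rightarrow> 'a \<Rightarrow> real" where "T' b = tensor ((\<lambda>_. bump)(b := deriv bump))" for b
  define I where "I = enn2real (\<integral>\<^sup>+u. ennreal (T u) \<partial>lborel)"
  define D where "D u = (\<Sum>b\<in>Basis. T' b u *\<^sub>R b) /\<^sub>R I" for u
  have sb: "smooth_upto k bump" for k using bump_smooth[of k 0 1] by simp
  have sd: "smooth_upto k (deriv bump)" for k using sb[of "Suc k"] by simp
  have d0: "deriv bump t = 0" if "t \<notin> {0..1}" for t
  proof (rule DERIV_imp_deriv, rule has_field_derivative_transform_within_open[where S = "- {0..1}" and f = "\<lambda>_. 0"])
    show "open (- {0..1::real})" by (simp add: open_Compl)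
  qed (use that bump_outside in auto)
  have out: "T u = 0" "T' b u = 0" if u: "u \<notin> cbox 0 One" and b: "b \<in> Basis" for u b
  proof -
    obtain j where j: "j \<in> Basis" "u \<bullet> j \<notin> {0..1}" using u by (auto simp: mem_box)
    have "bump (u \<bullet> j) = 0" using j by (intro bump_outside) auto
    then show "T u = 0" "T' b u = 0" using j d0
      by (auto simp: T_def T'_def tensor_def intro!: prod_zero bexI[of _ j])
  qed
  have T0: "0 \<le> T u" for u by (auto simp: T_def tensor_def intro!: prod_nonneg bump_nonneg)
  have Tc: "continuous_on UNIV T" unfolding T_def by (rule tensor_continuous) (use sb in blast)
  have T'c: "continuous_on UNIV (T' b)" for b
    unfolding T'_def by (rule tensor_continuous) (use sb sd in \<open>auto simp del: smooth_upto.simps\<close>)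
  have Td: "(T has_derivative (\<lambda>v. \<Sum>b\<in>Basis. (v \<bullet> b) * T' b u)) (at u)" for u
    unfolding T_def T'_def by (rule tensor_has_derivative) (use sb in blast)
  obtain b :: 'a where b: "b \<in> Basis" using nonempty_Basis by blast
  obtain B where B: "\<And>u. norm (T u) \<le> B"
    using bounded_of_cont_zero_outside[OF Tc] out(1)[OF _ b] by blast
  have [measurable]: "T \<in> borel_measurable borel" using Tc by (rule borel_measurable_continuous_onI)
  have Ifin: "(\<integral>\<^sup>+u. ennreal (T u) \<partial>lborel) < \<infinity>"
  proof -
    have "ennreal (T u) \<le> ennreal B * indicator (cbox 0 One) u" for u
      using B[of u] out(1)[OF _ b, of u] by (cases "u \<in> cbox 0 One") (auto intro: ennreal_leI)
    then have "(\<integral>\<^sup>+u. ennreal (T u) \<partial>lborel) \<le> (\<integral>\<^sup>+u. ennreal B * indicator (cbox (0::'a) One) u \<partial>lborel)"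
      by (intro nn_integral_mono)
    also have "\<dots> = ennreal B * emeasure lborel (cbox (0::'a) One)"
      by (rule nn_integral_cmult_indicator) simp
    also have "\<dots> < \<infinity>" by (simp add: ennreal_mult_less_top emeasure_lborel_cbox_eq)
    finally show ?thesis .
  qed
  have "(\<integral>\<^sup>+u. ennreal (T u) \<partial>lborel) \<noteq> 0"
  proof
    assume "(\<integral>\<^sup>+u. ennreal (T u) \<partial>lborel) = 0"
    then have "AE u in lborel. ennreal (T u) = 0" by (simp add: nn_integral_0_iff_AE)
    then have "AE u in lborel. u \<notin> box (0::'a) One"
    proof eventually_elim
      case (elim u)
      have "0 < T u" if "u \<in> box 0 One"
        unfolding T_def tensor_def using that by (intro prod_pos bump_pos) (auto simp: mem_box)
      then show ?case using elim by (auto simp: ennreal_eq_0_iff)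
    qed
    then have "box (0::'a) One \<in> null_sets lborel" by (simp add: AE_iff_null_sets)
    then have "emeasure lborel (box (0::'a) One) = 0" by auto
    then show False by (simp add: emeasure_lborel_box_eq)
  qed
  then have I: "0 < I" and II: "(\<integral>\<^sup>+u. ennreal (T u) \<partial>lborel) = ennreal I"
    using Ifin by (auto simp: I_def enn2real_positive_iff less_top zero_less_iff_neq_zero)
  have Dc: "continuous_on UNIV D" unfolding D_def[abs_def] by (intro continuous_intros T'c)
  have "D u = 0" if "u \<notin> cbox 0 One" for u using out(2)[OF that] by (simp add: D_def)
  then obtain B' where B': "\<And>u. norm (D u) \<le> B'"
    using bounded_of_cont_zero_outside[OF Dc] by blast
  have "mollifier (\<lambda>u. T u / I) D (max (B / I) B')"
  proof
    show "Ck k (\<lambda>y. c * (T ((y - x) /\<^sub>R \<epsilon>) / I))" if "0 < \<epsilon>" for c \<epsilon> :: real and x k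
    proof -
      have "Ck k (\<lambda>y. (c / I) * tensor (\<lambda>b t. bump (- (x \<bullet> b) / \<epsilon> + 1 / \<epsilon> * t)) y)"
        by (rule tensor_Ck) (rule bump_smooth)
      moreover have "tensor (\<lambda>b t. bump (- (x \<bullet> b) / \<epsilon> + 1 / \<epsilon> * t)) y = T ((y - x) /\<^sub>R \<epsilon>)" for y
        using that by (simp add: tensor_def T_def inner_simps divide_inverse algebra_simps)
      ultimately show ?thesis by simp
    qed
    show "((\<lambda>u. T u / I) has_derivative (\<bullet>) (D u)) (at u)" for u
    proof -
      have "((\<lambda>u. T u / I) has_derivative (\<lambda>v. (\<Sum>b\<in>Basis. (v \<bullet> b) * T' b u) / I)) (at u)"
        by (rule has_derivative_divide'[OF Td has_derivative_const, THEN has_derivative_eq_rhs]) (use I in \<open>auto simp: divide_inverse\<close>)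
      moreover have "(\<Sum>b\<in>Basis. (v \<bullet> b) * T' b u) / I = D u \<bullet> v" for v
        by (simp add: D_def inner_sum_left divide_inverse mult.commute inner_commute[of v])
      ultimately show ?thesis by simp
    qed
    show "0 \<le> T u / I" for u using T0 I by simp
    show "T u / I \<le> max (B / I) B'" for u using B[of u] T0[of u] I by (auto simp: divide_right_mono le_max_iff_disj)
    show "norm (D u) \<le> max (B / I) B'" for u using B'[of u] by simp
    show "u \<in> cbox 0 One" if "T u / I \<noteq> 0" for u using that out(1)[OF _ b, of u] by auto
    have "(\<integral>\<^sup>+u. ennreal (T u / I) \<partial>lborel) = (\<integral>\<^sup>+u. ennreal (T u) / ennreal I \<partial>lborel)"
      using T0 I by (intro nn_integral_cong) (simp add: divide_ennreal)
    also have "\<dots> = ennreal I / ennreal I" by (simp add: nn_integral_divide II)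
    finally show "(\<integral>\<^sup>+u. ennreal (T u / I) \<partial>lborel) = 1" using I by (simp add: divide_ennreal)
  qed (rule Dc)
  then show ?thesis by blast
qed

section \<open>Jensen's inequality for norms of vector-valued integrals\<close>

lemma mat_norm_nonneg: "0 \<le> mat_norm N A"
  by (simp add: mat_norm_def L2_set_nonneg)

lemma sum_inner_le_mat_norm:
  "(\<Sum>i<N. A i \<bullet> B i) \<le> mat_norm N A * mat_norm N B"
proof -
  have "(\<Sum>i<N. A i \<bullet> B i) \<le> (\<Sum>i<N. \<bar>norm (A i)\<bar> * \<bar>norm (B i)\<bar>)"
    by (intro sum_mono) (simp add: norm_cauchy_schwarz)
  also have "\<dots> \<le> mat_norm N A * mat_norm N B"
    unfolding mat_norm_def by (rule L2_set_mult_ineq)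
  finally show ?thesis .
qed

lemma mat_norm_le_sum: "mat_norm N A \<le> (\<Sum>i<N. norm (A i))"
  unfolding mat_norm_def by (rule L2_set_le_sum) auto

lemma mat_norm_square: "(mat_norm N A)\<^sup>2 = (\<Sum>i<N. A i \<bullet> A i)"
  by (simp add: mat_norm_def L2_set_def sum_nonneg power2_norm_eq_inner)

text \<open>Pair the family of integrals with itself: its squared norm m^2 is an integral of inner
  products, which Cauchy-Schwarz bounds by m times the integral of the norms. One factor m
  cancels.\<close>

lemma mat_norm_integral_le:
  fixes u :: "'a \<Rightarrow> nat \<Rightarrow> 'b::euclidean_space" and k :: "'a \<Rightarrow> real"
  assumes k: "\<And>y. 0 \<le> k y" "k \<in> borel_measurable M" and u: "\<And>i. i < N \<Longrightarrow> integrable M (\<lambda>y. k y *\<^sub>R u y i)"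
    and um: "\<And>i. i < N \<Longrightarrow> (\<lambda>y. u y i) \<in> borel_measurable M"
  shows "ennreal (mat_norm N (\<lambda>i. \<integral>y. k y *\<^sub>R u y i \<partial>M)) \<le> (\<integral>\<^sup>+y. ennreal (k y * mat_norm N (u y)) \<partial>M)"
proof -
  let ?m = "\<lambda>i. \<integral>y. k y *\<^sub>R u y i \<partial>M"
  define m where "m = mat_norm N ?m"
  have [measurable]: "(\<lambda>y. mat_norm N (u y)) \<in> borel_measurable M" by (rule measurable_mat_norm[OF um])
  note [measurable] = k(2)
  have int: "integrable M (\<lambda>y. k y * mat_norm N (u y))"
  proof (rule Bochner_Integration.integrable_bound)
    show "integrable M (\<lambda>y. \<Sum>i<N. norm (k y *\<^sub>R u y i))"
      by (intro Bochner_Integration.integrable_sum integrable_norm u) auto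
    have "k y * mat_norm N (u y) \<le> (\<Sum>i<N. norm (k y *\<^sub>R u y i))" for y
      using mult_left_mono[OF mat_norm_le_sum[of N "u y"] k(1)[of y]] k(1)[of y] by (simp add: sum_distrib_left)
    then show "AE y in M. norm (k y * mat_norm N (u y)) \<le> norm (\<Sum>i<N. norm (k y *\<^sub>R u y i))"
      using k(1) by (intro AE_I2) (simp add: mat_norm_nonneg sum_nonneg)
  qed measurable
  have "m * m = (\<Sum>i<N. ?m i \<bullet> ?m i)"
    unfolding m_def mat_norm_square[symmetric] by (simp add: power2_eq_square)
  also have "\<dots> = (\<integral>y. (\<Sum>i<N. ?m i \<bullet> (k y *\<^sub>R u y i)) \<partial>M)"
    using u by (subst Bochner_Integration.integral_sum) (auto simp del: inner_scaleR_right)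
  also have "\<dots> \<le> (\<integral>y. m * (k y * mat_norm N (u y)) \<partial>M)"
  proof (rule integral_mono)
    show "integrable M (\<lambda>y. \<Sum>i<N. ?m i \<bullet> (k y *\<^sub>R u y i))"
      using u by (intro Bochner_Integration.integrable_sum integrable_inner_right) auto
    show "integrable M (\<lambda>y. m * (k y * mat_norm N (u y)))" using int by simp
    fix y
    have "(\<Sum>i<N. ?m i \<bullet> (k y *\<^sub>R u y i)) = k y * (\<Sum>i<N. ?m i \<bullet> u y i)" by (simp add: sum_distrib_left)
    also have "\<dots> \<le> k y * (m * mat_norm N (u y))"
      unfolding m_def by (intro mult_left_mono sum_inner_le_mat_norm k(1))
    finally show "(\<Sum>i<N. ?m i \<bullet> (k y *\<^sub>R u y i)) \<le> m * (k y * mat_norm N (u y))" by (simp add: mult_ac)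
  qed
  also have "\<dots> = m * (\<integral>y. k y * mat_norm N (u y) \<partial>M)" by simp
  finally have 1: "m * m \<le> m * (\<integral>y. k y * mat_norm N (u y) \<partial>M)" .
  have i0: "0 \<le> (\<integral>y. k y * mat_norm N (u y) \<partial>M)"
    by (rule integral_nonneg_AE) (simp add: k(1) mat_norm_nonneg)
  have "m \<le> (\<integral>y. k y * mat_norm N (u y) \<partial>M)"
    using 1 i0 mat_norm_nonneg[of N ?m] by (cases "m = 0") (auto simp: m_def less_le)
  then have "ennreal m \<le> ennreal (\<integral>y. k y * mat_norm N (u y) \<partial>M)" by (rule ennreal_leI)
  also have "\<dots> = (\<integral>\<^sup>+y. ennreal (k y * mat_norm N (u y)) \<partial>M)"
    by (rule nn_integral_eq_integral[symmetric, OF int]) (simp add: k(1) mat_norm_nonneg)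
  finally show ?thesis by (simp add: m_def)
qed

text \<open>A supporting line of \<open>H\<close> at m, the norm of the averaged family, is
  integrated against the weight of mass 1. Its slope is nonnegative by monotonicity, so
  \<open>mat_norm_integral_le\<close> may be inserted.\<close>

lemma jensen_mat_norm:
  fixes u :: "'a \<Rightarrow> nat \<Rightarrow> 'b::euclidean_space" and k :: "'a \<Rightarrow> real" and H :: "real \<Rightarrow> real"
  assumes H: "convex_on UNIV H" "\<And>s t. s \<le> t \<Longrightarrow> H s \<le> H t" "\<And>t. 0 \<le> H t" "H \<in> borel_measurable borel"
    and k: "\<And>y. 0 \<le> k y" "k \<in> borel_measurable M" "(\<integral>\<^sup>+y. ennreal (k y) \<partial>M) = 1"
    and u: "\<And>i. i < N \<Longrightarrow> integrable M (\<lambda>y. k y *\<^sub>R u y i)"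
    and um: "\<And>i. i < N \<Longrightarrow> (\<lambda>y. u y i) \<in> borel_measurable M"
  shows "ennreal (H (mat_norm N (\<lambda>i. \<integral>y. k y *\<^sub>R u y i \<partial>M))) \<le> (\<integral>\<^sup>+y. ennreal (k y) * ennreal (H (mat_norm N (u y))) \<partial>M)"
proof -
  define m where "m = mat_norm N (\<lambda>i. \<integral>y. k y *\<^sub>R u y i \<partial>M)"
  \<comment> \<open>The infimum of the slopes to the right of m is the right derivative of
    \<open>H\<close> at m.\<close>
  define c where "c = Inf ((\<lambda>t. (H m - H t) / (m - t)) ` ({m<..} \<inter> UNIV))"
  have sup: "H m + c * (t - m) \<le> H t" for t
    unfolding c_def by (rule convex_le_Inf_differential[OF H(1)]) auto
  have c0: "0 \<le> c" using sup[of "m - 1"] H(2)[of "m - 1" m] by simp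
  have m0: "0 \<le> m" by (simp add: m_def mat_norm_nonneg)
  note [measurable] = H(4) k(2)
  have [measurable]: "(\<lambda>y. mat_norm N (u y)) \<in> borel_measurable M" by (rule measurable_mat_norm[OF um])
  let ?A = "\<integral>\<^sup>+y. ennreal (k y) * ennreal (H (mat_norm N (u y))) \<partial>M"
  \<comment> \<open>The term \<open>c * m\<close> is carried on both sides and cancelled at the end,
    which avoids subtraction in \<open>ennreal\<close>.\<close>
  have "ennreal (H m) + ennreal (c * m) \<le> ennreal (H m) * 1 + ennreal c * (\<integral>\<^sup>+y. ennreal (k y * mat_norm N (u y)) \<partial>M)"
    using mat_norm_integral_le[OF k(1,2) u um] c0 m0
    by (auto simp: ennreal_mult m_def intro!: add_left_mono mult_left_mono)
  also have "\<dots> = (\<integral>\<^sup>+y. ennreal (H m) * ennreal (k y) + ennreal c * ennreal (k y * mat_norm N (u y)) \<partial>M)"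
    unfolding k(3)[symmetric] by (subst nn_integral_add) (auto simp: nn_integral_cmult)
  also have "\<dots> \<le> (\<integral>\<^sup>+y. ennreal (k y) * ennreal (H (mat_norm N (u y))) + ennreal (c * m) * ennreal (k y) \<partial>M)"
  proof (rule nn_integral_mono)
    fix y
    have "H m * k y + c * (k y * mat_norm N (u y)) \<le> k y * H (mat_norm N (u y)) + c * m * k y"
      using mult_left_mono[OF sup[of "mat_norm N (u y)"] k(1)[of y]] by (simp add: algebra_simps)
    moreover have "0 \<le> k y * mat_norm N (u y)" "0 \<le> k y * H (mat_norm N (u y))" "0 \<le> c * m * k y"
      using H(3) k(1) c0 m0 mat_norm_nonneg by (auto intro!: mult_nonneg_nonneg)
    ultimately show "ennreal (H m) * ennreal (k y) + ennreal c * ennreal (k y * mat_norm N (u y))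
       \<le> ennreal (k y) * ennreal (H (mat_norm N (u y))) + ennreal (c * m) * ennreal (k y)"
      using H(3) k(1)[of y] c0 m0 mat_norm_nonneg
      by (simp add: ennreal_leI flip: ennreal_mult ennreal_plus)
  qed
  also have "\<dots> = ?A + ennreal (c * m)"
    by (subst nn_integral_add) (auto simp: nn_integral_cmult k(3))
  finally have "ennreal (c * m) + ennreal (H m) \<le> ennreal (c * m) + ?A" by (simp add: add.commute)
  then show ?thesis by (simp add: m_def[symmetric] ennreal_add_left_cancel_le)
qed

section \<open>Integral bounds and almost everywhere convergence of mollifications\<close>

context mollifier
begin

text \<open>For x in \<open>S\<close> the kernel sees only \<open>U\<close>; after exchanging the
  integrals its mass in the variable x is 1.\<close>

lemma mol_tonelli_le:
  assumes \<epsilon>: "0 < \<epsilon>" and [measurable]: "h \<in> borel_measurable borel" "S \<in> sets borel" "U \<in> sets borel"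
    and SU: "\<And>x. x \<in> S \<Longrightarrow> cbox x (x + \<epsilon> *\<^sub>R One) \<subseteq> U"
  shows "(\<integral>\<^sup>+x\<in>S. (\<integral>\<^sup>+y. ennreal (K \<epsilon> (y - x)) * h y \<partial>lborel) \<partial>lborel) \<le> (\<integral>\<^sup>+y\<in>U. h y \<partial>lborel)"
proof -
  note [measurable] = measurable_K[OF \<epsilon>]
  have "(\<integral>\<^sup>+x\<in>S. (\<integral>\<^sup>+y. ennreal (K \<epsilon> (y - x)) * h y \<partial>lborel) \<partial>lborel)
      = (\<integral>\<^sup>+x. \<integral>\<^sup>+y. ennreal (K \<epsilon> (y - x)) * h y * indicator S x \<partial>lborel \<partial>lborel)"
    by (intro nn_integral_cong nn_integral_multc[symmetric]) measurable
  also have "\<dots> \<le> (\<integral>\<^sup>+x. \<integral>\<^sup>+y. ennreal (K \<epsilon> (y - x)) * (h y * indicator U y) \<partial>lborel \<partial>lborel)"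
  proof (intro nn_integral_mono)
    fix x y
    show "ennreal (K \<epsilon> (y - x)) * h y * indicator S x \<le> ennreal (K \<epsilon> (y - x)) * (h y * indicator U y)"
      using K_supp[OF \<epsilon>, of y x] SU[of x] by (cases "K \<epsilon> (y - x) = 0"; cases "x \<in> S") (auto simp: indicator_def)
  qed
  also have "\<dots> = (\<integral>\<^sup>+y. \<integral>\<^sup>+x. ennreal (K \<epsilon> (y - x)) * (h y * indicator U y) \<partial>lborel \<partial>lborel)"
    by (rule lborel_pair.Fubini') measurable
  also have "\<dots> = (\<integral>\<^sup>+y. (\<integral>\<^sup>+x. ennreal (K \<epsilon> (y - x)) \<partial>lborel) * (h y * indicator U y) \<partial>lborel)"
    by (intro nn_integral_cong nn_integral_multc) measurable
  finally show ?thesis by (simp add: K_mass'[OF \<epsilon>])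
qed

text \<open>The kernel has mass 1, so the deviation from q is an average of u - q; bounding the
  kernel by its maximum leaves M times a mean over the cube. The constant q is free, to be chosen
  rational later.\<close>

lemma mol_minus_le:
  fixes u :: "'a \<Rightarrow> real"
  assumes u: "integrable lborel u" and \<epsilon>: "0 < \<epsilon>"
  shows "\<bar>mol \<epsilon> u x - q\<bar> \<le> M * (integral (cbox x (x + \<epsilon> *\<^sub>R One)) (\<lambda>y. \<bar>u y - q\<bar>) / \<epsilon> ^ DIM('a))"
    and "(\<lambda>y. \<bar>u y - q\<bar>) integrable_on cbox a b"
proof -
  note [measurable] = measurable_K[OF \<epsilon>]
  have um [measurable]: "u \<in> borel_measurable borel" using u by auto
  have si: "set_integrable lborel (cbox a b) (\<lambda>y. \<bar>u y - q\<bar>)" for a b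
    unfolding set_integrable_def
  proof (rule Bochner_Integration.integrable_bound)
    have "emeasure lborel (cbox a b) < \<infinity>" by (rule emeasure_lborel_cbox_finite)
    then show "integrable lborel (\<lambda>y. \<bar>u y\<bar> + \<bar>q\<bar> * indicator (cbox a b) y)"
      using u by (auto intro!: Bochner_Integration.integrable_add integrable_mult_right integrable_real_indicator)
    show "AE y in lborel. norm (indicator (cbox a b) y *\<^sub>R \<bar>u y - q\<bar>) \<le> norm (\<bar>u y\<bar> + \<bar>q\<bar> * indicator (cbox a b) y)"
      by (auto simp: indicator_def)
  qed measurable
  then show "(\<lambda>y. \<bar>u y - q\<bar>) integrable_on cbox a b" by (rule set_borel_integral_eq_integral)
  let ?B = "cbox x (x + \<epsilon> *\<^sub>R One)"
  have K1: "integrable lborel (\<lambda>y. K \<epsilon> (y - x))" "(\<integral>y. K \<epsilon> (y - x) \<partial>lborel) = 1"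
    using integrableI_nn_integral_finite[of "\<lambda>y. K \<epsilon> (y - x)" lborel 1]
      integral_eq_nn_integral[of "\<lambda>y. K \<epsilon> (y - x)" lborel] K_mass[OF \<epsilon>, of x] K_nonneg[OF \<epsilon>] by auto
  have iu: "integrable lborel (\<lambda>y. K \<epsilon> (y - x) * u y)"
    using mol_integrable[OF \<epsilon> u, of x] by simp
  have "mol \<epsilon> u x - q = (\<integral>y. K \<epsilon> (y - x) * u y \<partial>lborel) - (\<integral>y. K \<epsilon> (y - x) * q \<partial>lborel)"
    using K1 by (simp add: mol_def[OF \<epsilon>])
  also have "\<dots> = (\<integral>y. K \<epsilon> (y - x) * (u y - q) \<partial>lborel)"
    using iu K1 by (simp add: right_diff_distrib)
  finally have "\<bar>mol \<epsilon> u x - q\<bar> \<le> (\<integral>y. \<bar>K \<epsilon> (y - x) * (u y - q)\<bar> \<partial>lborel)"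
    using integral_abs_bound[of lborel] by simp
  also have "\<dots> \<le> (\<integral>y. M / \<epsilon> ^ DIM('a) * (indicator ?B y *\<^sub>R \<bar>u y - q\<bar>) \<partial>lborel)"
  proof (rule integral_mono)
    show "integrable lborel (\<lambda>y. M / \<epsilon> ^ DIM('a) * (indicator ?B y *\<^sub>R \<bar>u y - q\<bar>))"
      using si[of x "x + \<epsilon> *\<^sub>R One"] unfolding set_integrable_def by (intro integrable_mult_right)
    have "integrable lborel (\<lambda>y. K \<epsilon> (y - x) * u y - K \<epsilon> (y - x) * q)" using iu K1 by simp
    then show "integrable lborel (\<lambda>y. \<bar>K \<epsilon> (y - x) * (u y - q)\<bar>)"
      by (simp add: right_diff_distrib)
    fix y
    show "\<bar>K \<epsilon> (y - x) * (u y - q)\<bar> \<le> M / \<epsilon> ^ DIM('a) * (indicator ?B y *\<^sub>R \<bar>u y - q\<bar>)"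
    proof (cases "K \<epsilon> (y - x) = 0")
      case True
      have "0 \<le> M" using rho_nonneg[of 0] rho_le[of 0] by linarith
      then show ?thesis using True \<epsilon> by simp
    next
      case False
      then have "y \<in> ?B" by (rule K_supp[OF \<epsilon>])
      then show ?thesis using mult_right_mono[OF K_abs_le[OF \<epsilon>], of "\<bar>u y - q\<bar>" "y - x"] by (simp add: abs_mult)
    qed
  qed
  also have "\<dots> = M / \<epsilon> ^ DIM('a) * integral ?B (\<lambda>y. \<bar>u y - q\<bar>)"
    using set_borel_integral_eq_integral(2)[OF si, of x "x + \<epsilon> *\<^sub>R One"] by (simp add: set_lebesgue_integral_def)
  finally show "\<bar>mol \<epsilon> u x - q\<bar> \<le> M * (integral ?B (\<lambda>y. \<bar>u y - q\<bar>) / \<epsilon> ^ DIM('a))" by simp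
qed

text \<open>Lebesgue differentiation concerns one fixed function and one null set. It is applied to
  |u - q| for all rational q, which costs countably many null sets; afterwards q is chosen close to
  u x.\<close>

lemma mol_tendsto_AE:
  fixes u :: "'a \<Rightarrow> real"
  assumes u: "integrable lborel u" and \<epsilon>: "\<And>k. 0 < \<epsilon> k" "\<epsilon> \<longlonglongrightarrow> 0"
  shows "AE x in lborel. (\<lambda>k. mol (\<epsilon> k) u x) \<longlonglongrightarrow> u x"
proof -
  define P where "P q x \<longleftrightarrow> (\<forall>e>0. \<exists>d>0. \<forall>h. 0 < h \<and> h < d \<longrightarrow>
      \<bar>integral (cbox x (x + h *\<^sub>R One)) (\<lambda>y. \<bar>u y - q\<bar>) / h ^ DIM('a) - \<bar>u x - q\<bar>\<bar> < e)" for q x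
  have "AE x in lborel. P q x" for q
  proof -
    obtain N where N: "negligible N" "\<And>x e. x \<notin> N \<Longrightarrow> 0 < e \<Longrightarrow>
        \<exists>d>0. \<forall>h. 0 < h \<and> h < d \<longrightarrow>
           norm (integral (cbox x (x + h *\<^sub>R One)) (\<lambda>y. \<bar>u y - q\<bar>) /\<^sub>R h ^ DIM('a) - \<bar>u x - q\<bar>) < e"
      by (rule integrable_ccontinuous_explicit[OF mol_minus_le(2)[OF u \<epsilon>(1)[of 0], of q]], rule that, assumption) blast
    have "N \<in> null_sets (completion lborel)" using N(1) by (simp add: negligible_iff_null_sets)
    then have "AE x in completion lborel. x \<notin> N" by (rule AE_not_in)
    then have "AE x in lborel. x \<notin> N" by (simp only: AE_completion_iff)
    then show ?thesis
      by eventually_elim (use N(2) in \<open>simp add: P_def divide_inverse mult.commute\<close>)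
  qed
  then have "AE x in lborel. \<forall>q\<in>\<rat>. P q x"
    by (intro AE_ball_countable[THEN iffD2] ballI countable_rat)
  then show ?thesis
  proof eventually_elim
    case (elim x)
    have M: "0 \<le> M" using rho_nonneg[of 0] rho_le[of 0] by linarith
    show ?case
    proof (rule LIMSEQ_I)
      fix r :: real assume r: "0 < r"
      \<comment> \<open>A cube mean below 2 \<delta> gives a total error below (2 M + 2) \<delta>,
        which this choice makes equal to r.\<close>
      define \<delta> where "\<delta> = r / (2 * M + 2)"
      have \<delta>: "0 < \<delta>" using r M by (simp add: \<delta>_def)
      obtain q where q: "q \<in> \<rat>" "u x < q" "q < u x + \<delta>"
        using Rats_dense_in_real[of "u x" "u x + \<delta>"] \<delta> by auto
      obtain d where d: "d > 0" "\<And>h. 0 < h \<Longrightarrow> h < d \<Longrightarrow>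
          \<bar>integral (cbox x (x + h *\<^sub>R One)) (\<lambda>y. \<bar>u y - q\<bar>) / h ^ DIM('a) - \<bar>u x - q\<bar>\<bar> < \<delta>"
        using elim q(1) \<delta> unfolding P_def by meson
      obtain k0 where "\<forall>k\<ge>k0. norm (\<epsilon> k - 0) < d" using LIMSEQ_D[OF \<epsilon>(2) d(1)] by blast
      then have k0: "\<epsilon> k < d" if "k \<ge> k0" for k using that by (simp add: abs_less_iff)
      show "\<exists>no. \<forall>n\<ge>no. norm (mol (\<epsilon> n) u x - u x) < r"
      proof (intro exI allI impI)
        fix k assume "k \<ge> k0"
        let ?J = "integral (cbox x (x + \<epsilon> k *\<^sub>R One)) (\<lambda>y. \<bar>u y - q\<bar>) / \<epsilon> k ^ DIM('a)"
        have "?J < 2 * \<delta>" using d(2)[OF \<epsilon>(1) k0[OF \<open>k \<ge> k0\<close>]] q by linarith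
        then have "M * ?J \<le> M * (2 * \<delta>)" using M by (intro mult_left_mono) auto
        then have "\<bar>mol (\<epsilon> k) u x - q\<bar> \<le> M * (2 * \<delta>)"
          using mol_minus_le(1)[OF u \<epsilon>(1), of k x q] by linarith
        then have "\<bar>mol (\<epsilon> k) u x - u x\<bar> < M * (2 * \<delta>) + 2 * \<delta>" using q by linarith
        also have "\<dots> = (2 * M + 2) * \<delta>" by (simp add: algebra_simps)
        also have "\<dots> = r" using M by (simp add: \<delta>_def)
        finally show "norm (mol (\<epsilon> k) u x - u x) < r" by simp
      qed
    qed
  qed
qed

end

subsection \<open>The Sobolev inequality for weakly differentiable functions\<close>

lemma nn_integral_ball_rescale:
  fixes z :: "'a::euclidean_space"
  assumes [measurable]: "h \<in> borel_measurable borel" and \<rho>: "0 < \<rho>"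
  shows "(\<integral>\<^sup>+y\<in>ball 0 1. h (z + \<rho> *\<^sub>R y) \<partial>lborel) = ennreal (1 / \<rho> ^ DIM('a)) * (\<integral>\<^sup>+x\<in>ball z \<rho>. h x \<partial>lborel)"
proof -
  have ind: "indicator (ball z \<rho>) (z + \<rho> *\<^sub>R y) = (indicator (ball 0 1) y :: ennreal)" for y
    using \<rho> by (auto simp: indicator_def dist_norm)
  have [measurable]: "ball z \<rho> \<in> sets borel" "ball (0::'a) 1 \<in> sets borel" by simp_all
  have "(\<integral>\<^sup>+x\<in>ball z \<rho>. h x \<partial>lborel)
     = (\<integral>\<^sup>+x\<in>ball z \<rho>. h x \<partial>density (distr lborel borel (\<lambda>u. z + \<rho> *\<^sub>R u)) (\<lambda>_. ennreal (\<bar>\<rho>\<bar> ^ DIM('a))))"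
    using lborel_affine[of \<rho> z] \<rho> by simp
  also have "\<dots> = (\<integral>\<^sup>+u. ennreal (\<rho> ^ DIM('a)) * (h (z + \<rho> *\<^sub>R u) * indicator (ball z \<rho>) (z + \<rho> *\<^sub>R u)) \<partial>lborel)"
    using \<rho> by (simp add: nn_integral_density nn_integral_distr)
  also have "\<dots> = ennreal (\<rho> ^ DIM('a)) * (\<integral>\<^sup>+y\<in>ball 0 1. h (z + \<rho> *\<^sub>R y) \<partial>lborel)"
    unfolding ind by (rule nn_integral_cmult) measurable
  finally have "ennreal (1 / \<rho> ^ DIM('a)) * (\<integral>\<^sup>+x\<in>ball z \<rho>. h x \<partial>lborel)
     = (ennreal (1 / \<rho> ^ DIM('a)) * ennreal (\<rho> ^ DIM('a))) * (\<integral>\<^sup>+y\<in>ball 0 1. h (z + \<rho> *\<^sub>R y) \<partial>lborel)"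
    by (simp add: mult.assoc)
  also have "ennreal (1 / \<rho> ^ DIM('a)) * ennreal (\<rho> ^ DIM('a)) = 1"
    using \<rho> by (simp flip: ennreal_mult)
  finally show ?thesis by simp
qed

lemma cbox_corner_subset_cball:
  fixes x :: "'a::euclidean_space"
  assumes "0 \<le> \<epsilon>"
  shows "cbox x (x + \<epsilon> *\<^sub>R One) \<subseteq> cball x (\<epsilon> * DIM('a))"
proof
  fix y assume y: "y \<in> cbox x (x + \<epsilon> *\<^sub>R One)"
  have "norm (y - x) \<le> (\<Sum>b\<in>Basis. \<bar>(y - x) \<bullet> b\<bar>)" by (rule norm_le_l1)
  also have "\<dots> \<le> (\<Sum>b\<in>(Basis::'a set). \<epsilon>)"
    using y by (intro sum_mono) (auto simp: mem_box inner_simps)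
  finally show "y \<in> cball x (\<epsilon> * DIM('a))" by (simp add: dist_norm norm_minus_commute mult.commute)
qed

text \<open>Dividing the dilated function by \<rho> leaves the gradient unscaled, which explains why
  f enters the estimates as f / r and Df does not.\<close>

lemma gateaux_rescale:
  assumes "gateaux_on (ball z \<rho>) w Dw" "0 < \<rho>"
  shows "gateaux_on (ball 0 1) (\<lambda>y. w (z + \<rho> *\<^sub>R y) / \<rho>) (\<lambda>y. Dw (z + \<rho> *\<^sub>R y))"
  unfolding gateaux_on_def
proof (intro ballI allI)
  fix x v :: 'a assume x: "x \<in> ball 0 1"
  have "z + \<rho> *\<^sub>R x \<in> ball z \<rho>" using x assms(2) by (simp add: dist_norm)
  then have "((\<lambda>t. w ((z + \<rho> *\<^sub>R x) + t *\<^sub>R (\<rho> *\<^sub>R v))) has_real_derivative Dw (z + \<rho> *\<^sub>R x) \<bullet> (\<rho> *\<^sub>R v)) (at 0)"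
    using assms(1) unfolding gateaux_on_def by blast
  from DERIV_cdivide[OF this, of \<rho>]
  show "((\<lambda>t. w (z + \<rho> *\<^sub>R (x + t *\<^sub>R v)) / \<rho>) has_real_derivative Dw (z + \<rho> *\<^sub>R x) \<bullet> v) (at 0)"
    using assms(2) by (simp add: algebra_simps)
qed

lemma le_epow_inverse: "0 < a \<Longrightarrow> epow x a \<le> y \<Longrightarrow> x \<le> epow y (1 / a)"
  using epow_mono[of "epow x a" y "1 / a"] by (simp add: epow_epow)

lemma mat_norm_mono: "(\<And>i. i < N \<Longrightarrow> norm (A i) \<le> norm (B i)) \<Longrightarrow> mat_norm N A \<le> mat_norm N B"
  unfolding mat_norm_def by (rule L2_set_mono) auto

lemma vec_norm_divide: "0 < c \<Longrightarrow> vec_norm N (\<lambda>i. v i / c) = vec_norm N v / c"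
  using L2_set_right_distrib[of "1 / c" v "{..<N}"] by (simp add: vec_norm_def mult.commute)

text \<open>Borel functions rather than Lebesgue measurable ones: Tonelli's theorem is used for \<open>lborel\<close>.\<close>

definition weak_pair ::
  "nat \<Rightarrow> 'a::euclidean_space set \<Rightarrow> ('a \<Rightarrow> nat \<Rightarrow> real) \<Rightarrow> ('a \<Rightarrow> nat \<Rightarrow> 'a) \<Rightarrow> bool" where
  "weak_pair N U u G \<longleftrightarrow> (\<forall>i<N.
     integrable lborel (\<lambda>x. u x i) \<and> (\<lambda>x. G x i) \<in> borel_measurable borel \<and>
     (\<forall>S. compact S \<and> S \<subseteq> U \<longrightarrow> integrable lborel (\<lambda>x. indicator S x *\<^sub>R G x i)) \<and>
     (\<forall>\<phi> b. test_function U \<phi> \<and> b \<in> Basis \<longrightarrow>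
       (\<integral>x. u x i * frechet_derivative \<phi> (at x) b \<partial>lborel) = - (\<integral>x. (G x i \<bullet> b) * \<phi> x \<partial>lborel)))"

lemma weak_pairD:
  assumes "weak_pair N U u G" "i < N"
  shows "integrable lborel (\<lambda>x. u x i)" "(\<lambda>x. G x i) \<in> borel_measurable borel"
    "compact S \<Longrightarrow> S \<subseteq> U \<Longrightarrow> integrable lborel (\<lambda>x. indicator S x *\<^sub>R G x i)"
    "test_function U \<phi> \<Longrightarrow> b \<in> Basis \<Longrightarrow>
      (\<integral>x. u x i * frechet_derivative \<phi> (at x) b \<partial>lborel) = - (\<integral>x. (G x i \<bullet> b) * \<phi> x \<partial>lborel)"
  using assms unfolding weak_pair_def by blast+

context doubling_young
begin

text \<open>Jensen's inequality bounds the right-hand side, so the mollified gradients need not converge.\<close>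

lemma sobolev_young_mollified:
  fixes u :: "'a::euclidean_space \<Rightarrow> nat \<Rightarrow> real" and G :: "'a \<Rightarrow> nat \<Rightarrow> 'a"
    and p \<epsilon> \<rho> r :: real
  assumes n: "2 \<le> DIM('a)" and p: "1 \<le> p" "p < DIM('a)"
    and mo: "mollifier \<sigma> D\<sigma> M" and \<epsilon>: "0 < \<epsilon>" and \<rho>: "0 < \<rho>" "\<rho> \<le> r" "r \<le> 2 * \<rho>" "\<rho> + \<epsilon> * DIM('a) < r"
    and uG: "weak_pair N (ball z r) u G"
  shows "epow (ennreal (1 / r ^ DIM('a)) * (\<integral>\<^sup>+x\<in>ball z \<rho>. ennreal (\<Phi> (vec_norm N (\<lambda>i. mollifier.mol \<sigma> \<epsilon> (\<lambda>y. u y i) x / r)) powr sobolev_exp DIM('a) p) \<partial>lborel)) (p / sobolev_exp DIM('a) p)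
   \<le> sobolev_const DIM('a) p D * (ennreal ((2 / r) ^ DIM('a) * D powr p)
      * (\<integral>\<^sup>+x\<in>ball z r. ennreal (\<Phi> (mat_norm N (G x)) powr p + \<Phi> (vec_norm N (\<lambda>i. u x i / r)) powr p) \<partial>lborel))"
proof -
  let ?R = "\<lambda>x. \<Phi> (mat_norm N (G x)) powr p + \<Phi> (vec_norm N (\<lambda>i. u x i / r)) powr p"
  let ?J = "\<integral>\<^sup>+x\<in>ball z r. ennreal (?R x) \<partial>lborel"
  interpret mollifier \<sigma> D\<sigma> M by (rule mo)
  note u = weak_pairD(1)[OF uG] and Gm = weak_pairD(2)[OF uG] and G = weak_pairD(3)[OF uG] and weak = weak_pairD(4)[OF uG]
  let ?ps = "sobolev_exp DIM('a) p" and ?d = "DIM('a)"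
  \<comment> \<open>All kernels at points of the smaller ball live in this compact set. Cutting
    \<open>G\<close> off to it makes it integrable on the whole space, and the mollified gradients
    on the smaller ball do not notice.\<close>
  define S where "S = cball z (\<rho> + \<epsilon> * ?d)"
  define GS where "GS x i = indicator S x *\<^sub>R G x i" for x i
  define f where "f x i = mol \<epsilon> (\<lambda>y. u y i) x" for x i
  define g where "g x i = mol \<epsilon> (\<lambda>y. GS y i) x" for x i
  have r: "0 < r" using \<rho> by linarith
  have ps: "0 < ?ps" using p by (simp add: sobolev_exp_def)
  have S: "compact S" "S \<subseteq> ball z r" using \<rho>(4) by (auto simp: S_def)
  have GSi: "integrable lborel (\<lambda>x. GS x i)" if "i < N" for i
    unfolding GS_def by (rule G[OF that S])
  have box: "cbox x (x + \<epsilon> *\<^sub>R One) \<subseteq> S" if "x \<in> ball z \<rho>" for x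
  proof
    fix y assume "y \<in> cbox x (x + \<epsilon> *\<^sub>R One)"
    then have "dist x y \<le> \<epsilon> * ?d" using cbox_corner_subset_cball[of \<epsilon> x] \<epsilon> by auto
    then show "y \<in> S" using that dist_triangle[of z y x] by (auto simp: S_def)
  qed
  have um: "(\<lambda>x. u x i) \<in> borel_measurable lborel" if "i < N" for i using u[OF that] by auto
  have GSm: "(\<lambda>x. GS x i) \<in> borel_measurable lborel" if "i < N" for i using GSi[OF that] by auto
  have gat: "gateaux_on (ball z \<rho>) (\<lambda>x. f x i) (\<lambda>x. g x i)" if i: "i < N" for i
    unfolding f_def g_def
  proof (rule mol_gateaux[OF \<epsilon> u[OF i] GSi[OF i]])
    fix x b assume x: "x \<in> ball z \<rho>" and b: "b \<in> (Basis :: 'a set)"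
    have "(\<integral>y. u y i * frechet_derivative (\<lambda>y. K \<epsilon> (y - x)) (at y) b \<partial>lborel) = - (\<integral>y. (G y i \<bullet> b) * K \<epsilon> (y - x) \<partial>lborel)"
      by (rule weak[OF i test_function_K[OF \<epsilon>] b]) (use box[OF x] S in blast)
    also have "(\<integral>y. (G y i \<bullet> b) * K \<epsilon> (y - x) \<partial>lborel) = (\<integral>y. (GS y i \<bullet> b) * K \<epsilon> (y - x) \<partial>lborel)"
    proof (rule Bochner_Integration.integral_cong[OF refl])
      fix y
      show "(G y i \<bullet> b) * K \<epsilon> (y - x) = (GS y i \<bullet> b) * K \<epsilon> (y - x)"
        using K_supp[OF \<epsilon>, of y x] box[OF x] by (cases "K \<epsilon> (y - x) = 0") (auto simp: GS_def indicator_def)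
    qed
    finally show "(\<integral>y. u y i * frechet_derivative (\<lambda>y. K \<epsilon> (y - x)) (at y) b \<partial>lborel) = - (\<integral>y. (GS y i \<bullet> b) * K \<epsilon> (y - x) \<partial>lborel)" .
  qed
  have cf: "continuous_on UNIV (\<lambda>x. f x i)" "continuous_on UNIV (\<lambda>x. g x i)" if "i < N" for i
    using mol_cont[OF \<epsilon> u[OF that]] mol_cont[OF \<epsilon> GSi[OF that]] by (auto simp: f_def g_def)
  have fm: "(\<lambda>x. vec_norm N (\<lambda>i. f x i / c)) \<in> borel_measurable borel"
     "(\<lambda>x. mat_norm N (g x)) \<in> borel_measurable borel" for c
    using borel_measurable_continuous_onI[OF cf(1)] borel_measurable_continuous_onI[OF cf(2)]
    by (auto intro!: measurable_vec_norm measurable_mat_norm borel_measurable_divide)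
  note [measurable] = fm
  have unm [measurable]: "(\<lambda>x. vec_norm N (\<lambda>i. u x i / c)) \<in> borel_measurable borel"
     "(\<lambda>x. mat_norm N (G x)) \<in> borel_measurable borel" "(\<lambda>x. mat_norm N (GS x)) \<in> borel_measurable borel" for c
    using um Gm GSm by (auto intro!: measurable_vec_norm measurable_mat_norm borel_measurable_divide)
  have [measurable]: "ball z \<rho> \<in> sets borel" "ball z r \<in> sets borel" "ball (0::'a) 1 \<in> sets borel" by auto
  let ?I = "\<lambda>h. \<integral>\<^sup>+x\<in>ball z \<rho>. ennreal (h x) \<partial>lborel"
  let ?E = "\<lambda>x. \<Phi> (mat_norm N (g x)) powr p + \<Phi> (vec_norm N (\<lambda>i. f x i / \<rho>)) powr p"
  \<comment> \<open>The smooth estimate on the unit ball is applied to the dilated functions; the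
    powers of \<rho> come from the change of variables.\<close>
  have main: "epow (ennreal (1 / \<rho> ^ ?d) * ?I (\<lambda>x. \<Phi> (vec_norm N (\<lambda>i. f x i / \<rho>)) powr ?ps)) (p / ?ps)
     \<le> sobolev_const ?d p D * (ennreal (1 / \<rho> ^ ?d) * ?I ?E)"
  proof -
    have "epow (\<integral>\<^sup>+y\<in>ball 0 1. ennreal (\<Phi> (vec_norm N ((\<lambda>y i. f (z + \<rho> *\<^sub>R y) i / \<rho>) y)) powr ?ps) \<partial>lborel) (p / ?ps)
       \<le> sobolev_const ?d p D * (\<integral>\<^sup>+y\<in>ball 0 1. ennreal (\<Phi> (mat_norm N ((\<lambda>y i. g (z + \<rho> *\<^sub>R y) i) y)) powr p
            + \<Phi> (vec_norm N ((\<lambda>y i. f (z + \<rho> *\<^sub>R y) i / \<rho>) y)) powr p) \<partial>lborel)"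
    proof (rule sobolev_young_C1[OF n p])
      fix i assume i: "i < N"
      show "continuous_on UNIV (\<lambda>x. f (z + \<rho> *\<^sub>R x) i / \<rho>)" "continuous_on UNIV (\<lambda>x. g (z + \<rho> *\<^sub>R x) i)"
        using \<rho>(1) by (auto intro!: continuous_intros continuous_on_compose2[OF cf(1)[OF i]] continuous_on_compose2[OF cf(2)[OF i]])
      show "gateaux_on (ball 0 1) (\<lambda>x. f (z + \<rho> *\<^sub>R x) i / \<rho>) (\<lambda>x. g (z + \<rho> *\<^sub>R x) i)"
        by (rule gateaux_rescale[OF gat[OF i] \<rho>(1)])
    qed
    moreover have "(\<integral>\<^sup>+y\<in>ball 0 1. ennreal (\<Phi> (vec_norm N ((\<lambda>y i. f (z + \<rho> *\<^sub>R y) i / \<rho>) y)) powr ?ps) \<partial>lborel)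
        = ennreal (1 / \<rho> ^ ?d) * ?I (\<lambda>x. \<Phi> (vec_norm N (\<lambda>i. f x i / \<rho>)) powr ?ps)"
      using nn_integral_ball_rescale[of "\<lambda>x. ennreal (\<Phi> (vec_norm N (\<lambda>i. f x i / \<rho>)) powr ?ps)" \<rho> z] \<rho>(1) by simp
    moreover have "(\<integral>\<^sup>+y\<in>ball 0 1. ennreal (\<Phi> (mat_norm N ((\<lambda>y i. g (z + \<rho> *\<^sub>R y) i) y)) powr p
            + \<Phi> (vec_norm N ((\<lambda>y i. f (z + \<rho> *\<^sub>R y) i / \<rho>) y)) powr p) \<partial>lborel) = ennreal (1 / \<rho> ^ ?d) * ?I ?E"
      using nn_integral_ball_rescale[of "\<lambda>x. ennreal (?E x)" \<rho> z] \<rho>(1) by simp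
    ultimately show ?thesis by simp
  qed
  have H: "convex_on UNIV (\<lambda>t. \<Phi> t powr p)" "\<And>s t. s \<le> t \<Longrightarrow> \<Phi> s powr p \<le> \<Phi> t powr p" "\<And>t. 0 \<le> \<Phi> t powr p"
      "(\<lambda>t. \<Phi> t powr p) \<in> borel_measurable borel"
    using powr_convex_on[OF p(1)] p mono nonneg by (auto intro: powr_mono2)
  have Kx: "(\<lambda>y. K \<epsilon> (y - x)) \<in> borel_measurable lborel" for x using measurable_K[OF \<epsilon>] by measurable
  have Jg: "ennreal (\<Phi> (mat_norm N (g x)) powr p) \<le> (\<integral>\<^sup>+y. ennreal (K \<epsilon> (y - x)) * ennreal (\<Phi> (mat_norm N (GS y)) powr p) \<partial>lborel)" for x
    unfolding g_def mol_def[OF \<epsilon>]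
    by (rule jensen_mat_norm[OF H K_nonneg[OF \<epsilon>] Kx K_mass[OF \<epsilon>] mol_integrable[OF \<epsilon> GSi] GSm])
  have Jf: "ennreal (\<Phi> (vec_norm N (\<lambda>i. f x i / \<rho>)) powr p)
     \<le> (\<integral>\<^sup>+y. ennreal (K \<epsilon> (y - x)) * ennreal (\<Phi> (vec_norm N (\<lambda>i. u y i / \<rho>)) powr p) \<partial>lborel)" for x
  proof -
    have "ennreal (\<Phi> (mat_norm N (\<lambda>i. \<integral>y. K \<epsilon> (y - x) *\<^sub>R (u y i / \<rho>) \<partial>lborel)) powr p)
      \<le> (\<integral>\<^sup>+y. ennreal (K \<epsilon> (y - x)) * ennreal (\<Phi> (mat_norm N (\<lambda>i. u y i / \<rho>)) powr p) \<partial>lborel)"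
    proof (rule jensen_mat_norm[OF H K_nonneg[OF \<epsilon>] Kx K_mass[OF \<epsilon>]])
      fix i assume "i < N"
      then have i: "integrable lborel (\<lambda>y. u y i / \<rho>)" using u by simp
      show "integrable lborel (\<lambda>y. K \<epsilon> (y - x) *\<^sub>R (u y i / \<rho>))" by (rule mol_integrable[OF \<epsilon> i])
      show "(\<lambda>y. u y i / \<rho>) \<in> borel_measurable lborel" using i by auto
    qed
    then show ?thesis by (simp add: mat_norm_real f_def mol_def[OF \<epsilon>])
  qed
  have E: "?I ?E \<le> ennreal (D powr p) * ?J"
  proof -
    define h where "h y = ennreal (\<Phi> (mat_norm N (GS y)) powr p) + ennreal (\<Phi> (vec_norm N (\<lambda>i. u y i / \<rho>)) powr p)" for y
    have [measurable]: "h \<in> borel_measurable borel" unfolding h_def by measurable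
    have "?I ?E \<le> (\<integral>\<^sup>+x\<in>ball z \<rho>. (\<integral>\<^sup>+y. ennreal (K \<epsilon> (y - x)) * h y \<partial>lborel) \<partial>lborel)"
    proof (intro nn_integral_mono mult_right_mono)
      fix x
      note [measurable] = measurable_K[OF \<epsilon>]
      have "ennreal (?E x) = ennreal (\<Phi> (mat_norm N (g x)) powr p) + ennreal (\<Phi> (vec_norm N (\<lambda>i. f x i / \<rho>)) powr p)"
        by simp
      also have "\<dots> \<le> (\<integral>\<^sup>+y. ennreal (K \<epsilon> (y - x)) * ennreal (\<Phi> (mat_norm N (GS y)) powr p) \<partial>lborel)
          + (\<integral>\<^sup>+y. ennreal (K \<epsilon> (y - x)) * ennreal (\<Phi> (vec_norm N (\<lambda>i. u y i / \<rho>)) powr p) \<partial>lborel)"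
        by (intro add_mono Jg Jf)
      also have "\<dots> = (\<integral>\<^sup>+y. ennreal (K \<epsilon> (y - x)) * h y \<partial>lborel)"
        unfolding h_def distrib_left by (rule nn_integral_add[symmetric]) measurable
      finally show "ennreal (?E x) \<le> (\<integral>\<^sup>+y. ennreal (K \<epsilon> (y - x)) * h y \<partial>lborel)" .
    qed simp
    also have "\<dots> \<le> (\<integral>\<^sup>+y\<in>ball z r. h y \<partial>lborel)"
      by (rule mol_tonelli_le[OF \<epsilon>]) (use box S in auto)
    also have "\<dots> \<le> (\<integral>\<^sup>+y. ennreal (D powr p) * (ennreal (?R y) * indicator (ball z r) y) \<partial>lborel)"
    proof (rule nn_integral_mono)
      fix y
      have D: "1 \<le> D powr p" using D_ge_1 p by (simp add: ge_one_powr_ge_zero)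
      have "\<Phi> (mat_norm N (GS y)) powr p \<le> \<Phi> (mat_norm N (G y)) powr p"
        by (intro H(2) mat_norm_mono) (auto simp: GS_def indicator_def)
      also have "\<dots> \<le> D powr p * \<Phi> (mat_norm N (G y)) powr p"
        using mult_right_mono[OF D, of "\<Phi> (mat_norm N (G y)) powr p"] by simp
      finally have 1: "\<Phi> (mat_norm N (GS y)) powr p \<le> D powr p * \<Phi> (mat_norm N (G y)) powr p" .
      \<comment> \<open>Replacing \<rho> by r costs one doubling, because r \<le> 2 \<rho>.\<close>
      have "\<Phi> (vec_norm N (\<lambda>i. u y i / \<rho>)) \<le> \<Phi> (2 * vec_norm N (\<lambda>i. u y i / r))"
      proof (rule mono)
        have v: "0 \<le> vec_norm N (u y)" by (simp add: vec_norm_def L2_set_nonneg)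
        have "vec_norm N (u y) * r \<le> vec_norm N (u y) * (2 * \<rho>)" by (rule mult_left_mono[OF \<rho>(3) v])
        then show "vec_norm N (\<lambda>i. u y i / \<rho>) \<le> 2 * vec_norm N (\<lambda>i. u y i / r)"
          using \<rho>(1) r by (simp add: vec_norm_divide field_simps)
      qed
      also have "\<dots> \<le> D * \<Phi> (vec_norm N (\<lambda>i. u y i / r))"
        by (rule doubling) (simp add: vec_norm_def L2_set_nonneg)
      finally have "\<Phi> (vec_norm N (\<lambda>i. u y i / \<rho>)) powr p \<le> (D * \<Phi> (vec_norm N (\<lambda>i. u y i / r))) powr p"
        using p nonneg by (intro powr_mono2) auto
      then have 2: "\<Phi> (vec_norm N (\<lambda>i. u y i / \<rho>)) powr p \<le> D powr p * \<Phi> (vec_norm N (\<lambda>i. u y i / r)) powr p"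
        by (simp add: powr_mult)
      have "h y = ennreal (\<Phi> (mat_norm N (GS y)) powr p + \<Phi> (vec_norm N (\<lambda>i. u y i / \<rho>)) powr p)"
        by (simp add: h_def)
      also have "\<dots> \<le> ennreal (D powr p * (?R y))"
        using 1 2 by (intro ennreal_leI) (simp add: distrib_left)
      also have "\<dots> = ennreal (D powr p) * ennreal (?R y)"
        by (rule ennreal_mult) auto
      finally show "h y * indicator (ball z r) y \<le> ennreal (D powr p) * (ennreal (?R y) * indicator (ball z r) y)"
        unfolding mult.assoc[symmetric] by (rule mult_right_mono) simp
    qed
    also have "\<dots> = ennreal (D powr p) * ?J"
      by (rule nn_integral_cmult) measurable
    finally show ?thesis .
  qed
  have rr: "1 / \<rho> ^ ?d \<le> (2 / r) ^ ?d"
  proof -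
    have "1 / \<rho> \<le> 2 / r" using \<rho> r by (simp add: field_simps)
    then have "(1 / \<rho>) ^ ?d \<le> (2 / r) ^ ?d" using \<rho>(1) by (intro power_mono) auto
    then show ?thesis by (simp add: power_divide)
  qed
  have "epow (ennreal (1 / r ^ ?d) * ?I (\<lambda>x. \<Phi> (vec_norm N (\<lambda>i. f x i / r)) powr ?ps)) (p / ?ps)
     \<le> epow (ennreal (1 / \<rho> ^ ?d) * ?I (\<lambda>x. \<Phi> (vec_norm N (\<lambda>i. f x i / \<rho>)) powr ?ps)) (p / ?ps)"
  proof (intro epow_mono mult_mono nn_integral_mono mult_right_mono ennreal_leI powr_mono2 mono)
    show "1 / r ^ ?d \<le> 1 / \<rho> ^ ?d" using \<rho> r by (intro divide_left_mono power_mono mult_pos_pos zero_less_power) auto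
    show "vec_norm N (\<lambda>i. f x i / r) \<le> vec_norm N (\<lambda>i. f x i / \<rho>)" for x
    proof -
      have "0 \<le> vec_norm N (f x)" by (simp add: vec_norm_def L2_set_nonneg)
      then show ?thesis using \<rho>(1,2) r by (simp add: vec_norm_divide divide_left_mono)
    qed
  qed (use ps p nonneg in auto)
  also note main
  also have "sobolev_const ?d p D * (ennreal (1 / \<rho> ^ ?d) * ?I ?E)
    \<le> sobolev_const ?d p D * (ennreal ((2 / r) ^ ?d) * (ennreal (D powr p) * ?J))"
    by (intro mult_left_mono mult_mono ennreal_leI rr E) auto
  finally show ?thesis
    using r by (simp add: f_def ennreal_mult mult.assoc)
qed

text \<open>The mollified estimate has a right-hand side independent of the mollification. Growing
  balls and shrinking kernels therefore allow Fatou's lemma on the left without any finiteness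
  assumption.\<close>

lemma sobolev_young_ball:
  fixes u :: "'a::euclidean_space \<Rightarrow> nat \<Rightarrow> real" and G :: "'a \<Rightarrow> nat \<Rightarrow> 'a"
    and p r :: real
  assumes n: "2 \<le> DIM('a)" and p: "1 \<le> p" "p < DIM('a)" and r: "0 < r"
    and uG: "weak_pair N (ball z r) u G"
  shows "epow (ennreal (1 / r ^ DIM('a)) * (\<integral>\<^sup>+x\<in>ball z r. ennreal (\<Phi> (vec_norm N (\<lambda>i. u x i / r)) powr sobolev_exp DIM('a) p) \<partial>lborel)) (p / sobolev_exp DIM('a) p)
   \<le> sobolev_const DIM('a) p D * (ennreal ((2 / r) ^ DIM('a) * D powr p)
      * (\<integral>\<^sup>+x\<in>ball z r. ennreal (\<Phi> (mat_norm N (G x)) powr p + \<Phi> (vec_norm N (\<lambda>i. u x i / r)) powr p) \<partial>lborel))"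
proof -
  let ?v = "\<lambda>x. vec_norm N (\<lambda>i. u x i / r)"
  let ?A = "\<integral>\<^sup>+x\<in>ball z r. ennreal (\<Phi> (?v x) powr sobolev_exp DIM('a) p) \<partial>lborel"
  let ?ps = "sobolev_exp DIM('a) p" and ?d = "DIM('a)"
  let ?a = "p / ?ps"
  obtain \<sigma> :: "'a \<Rightarrow> real" and D\<sigma> M where mo: "mollifier \<sigma> D\<sigma> M" using mollifier_exists by blast
  interpret mollifier \<sigma> D\<sigma> M by (rule mo)
  note u = weak_pairD(1)[OF uG]
  have ps: "0 < ?ps" using p by (simp add: sobolev_exp_def)
  have a: "0 < ?a" using ps p by simp
  \<comment> \<open>Starting the denominators at 2 secures r \<le> 2 \<rho>, and each kernel uses
    only half of the remaining gap to the boundary.\<close>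
  define \<rho> where "\<rho> k = r - r / real (Suc (Suc k))" for k
  define \<epsilon> where "\<epsilon> k = r / real (Suc (Suc k)) / (2 * real ?d)" for k
  define Y where "Y = sobolev_const ?d p D * (ennreal ((2 / r) ^ ?d * D powr p)
      * (\<integral>\<^sup>+x\<in>ball z r. ennreal (\<Phi> (mat_norm N (G x)) powr p + \<Phi> (?v x) powr p) \<partial>lborel))"
  define f where "f k x = vec_norm N (\<lambda>i. mol (\<epsilon> k) (\<lambda>y. u y i) x / r)" for k x
  define A where "A k = (\<integral>\<^sup>+x\<in>ball z (\<rho> k). ennreal (\<Phi> (f k x) powr ?ps) \<partial>lborel)" for k
  have \<epsilon>0: "0 < \<epsilon> k" for k using r by (simp add: \<epsilon>_def)
  have \<rho>: "0 < \<rho> k" "\<rho> k \<le> r" "r \<le> 2 * \<rho> k" "\<rho> k + \<epsilon> k * ?d < r" for k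
  proof -
    define t where "t = r / real (Suc (Suc k))"
    have "t \<le> r / 2" unfolding t_def using r by (intro divide_left_mono) auto
    moreover have "0 < t" using r by (simp add: t_def)
    moreover have "\<epsilon> k * ?d = t / 2" by (simp add: \<epsilon>_def t_def)
    moreover have "\<rho> k = r - t" by (simp add: \<rho>_def t_def)
    ultimately show "0 < \<rho> k" "\<rho> k \<le> r" "r \<le> 2 * \<rho> k" "\<rho> k + \<epsilon> k * ?d < r"
      using r by linarith+
  qed
  have lim0: "(\<lambda>k. r / real (Suc (Suc k))) \<longlonglongrightarrow> 0"
    by (intro LIMSEQ_Suc lim_const_over_n)
  have \<rho>lim: "\<rho> \<longlonglongrightarrow> r"
    using tendsto_diff[OF tendsto_const[of r] lim0] by (simp add: \<rho>_def[abs_def])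
  have \<epsilon>lim: "\<epsilon> \<longlonglongrightarrow> 0"
    using tendsto_divide[OF lim0 tendsto_const[of "2 * real ?d"]] by (simp add: \<epsilon>_def[abs_def])
  \<comment> \<open>The estimate is solved for the integral itself, since Fatou's lemma acts on
    integrals and not on their powers.\<close>
  have Ak: "A k \<le> ennreal (r ^ ?d) * epow Y (1 / ?a)" for k
  proof -
    have "epow (ennreal (1 / r ^ ?d) * A k) ?a \<le> Y"
      unfolding A_def f_def Y_def by (rule sobolev_young_mollified[OF n p mo \<epsilon>0 \<rho> uG])
    then have "ennreal (1 / r ^ ?d) * A k \<le> epow Y (1 / ?a)" by (rule le_epow_inverse[OF a])
    then have "ennreal (r ^ ?d) * (ennreal (1 / r ^ ?d) * A k) \<le> ennreal (r ^ ?d) * epow Y (1 / ?a)"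
      by (rule mult_left_mono) simp
    moreover have "ennreal (r ^ ?d) * ennreal (1 / r ^ ?d) = 1" using r by (simp flip: ennreal_mult)
    ultimately show ?thesis by (simp add: mult.assoc[symmetric])
  qed
  have fm: "f k \<in> borel_measurable borel" for k
    unfolding f_def[abs_def]
    by (intro measurable_vec_norm borel_measurable_divide borel_measurable_const
        borel_measurable_continuous_onI[OF mol_cont[OF \<epsilon>0 u]])
  note [measurable] = fm
  have [measurable]: "ball z s \<in> sets borel" for s by simp
  have "AE x in lborel. \<forall>i\<in>{..<N}. (\<lambda>k. mol (\<epsilon> k) (\<lambda>y. u y i) x) \<longlonglongrightarrow> u x i"
    by (intro AE_ball_countable[THEN iffD2] ballI mol_tendsto_AE u \<epsilon>0 \<epsilon>lim countable_finite) auto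
  then have "AE x in lborel. ennreal (\<Phi> (?v x) powr ?ps) * indicator (ball z r) x
     \<le> liminf (\<lambda>k. ennreal (\<Phi> (f k x) powr ?ps) * indicator (ball z (\<rho> k)) x)"
  proof eventually_elim
    case (elim x)
    show ?case
    proof (cases "x \<in> ball z r")
      case True
      have "(\<lambda>k. f k x) \<longlonglongrightarrow> ?v x"
        unfolding f_def vec_norm_def L2_set_def
        by (intro tendsto_intros) (use elim r in auto)
      then have "(\<lambda>k. \<Phi> (f k x)) \<longlonglongrightarrow> \<Phi> (?v x)"
        by (rule isCont_tendsto_compose[OF isCont])
      then have "(\<lambda>k. \<Phi> (f k x) powr ?ps) \<longlonglongrightarrow> \<Phi> (?v x) powr ?ps"
        by (intro tendsto_powr2 tendsto_const) (use ps nonneg in auto)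
      then have "(\<lambda>k. ennreal (\<Phi> (f k x) powr ?ps)) \<longlonglongrightarrow> ennreal (\<Phi> (?v x) powr ?ps)"
        by (rule tendsto_ennrealI)
      moreover have "eventually (\<lambda>k. ennreal (\<Phi> (f k x) powr ?ps)
          = ennreal (\<Phi> (f k x) powr ?ps) * indicator (ball z (\<rho> k)) x) sequentially"
        using order_tendstoD(1)[OF \<rho>lim, of "dist z x"] True
        by (auto elim!: eventually_mono)
      ultimately have "(\<lambda>k. ennreal (\<Phi> (f k x) powr ?ps) * indicator (ball z (\<rho> k)) x)
          \<longlonglongrightarrow> ennreal (\<Phi> (?v x) powr ?ps)"
        by (rule Lim_transform_eventually)
      from lim_imp_Liminf[OF sequentially_bot this] show ?thesis using True by simp
    qed simp
  qed
  then have "?A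
     \<le> (\<integral>\<^sup>+x. liminf (\<lambda>k. ennreal (\<Phi> (f k x) powr ?ps) * indicator (ball z (\<rho> k)) x) \<partial>lborel)"
    by (rule nn_integral_mono_AE)
  also have "\<dots> \<le> liminf A"
    unfolding A_def[abs_def] by (rule nn_integral_liminf) measurable
  also have "\<dots> \<le> ennreal (r ^ ?d) * epow Y (1 / ?a)"
    by (rule Liminf_le) (use Ak in auto)
  finally have "ennreal (1 / r ^ ?d) * ?A
     \<le> ennreal (1 / r ^ ?d) * (ennreal (r ^ ?d) * epow Y (1 / ?a))"
    by (rule mult_left_mono) simp
  also have "\<dots> = epow Y (1 / ?a)"
    using r by (simp add: mult.assoc[symmetric] flip: ennreal_mult)
  finally have "epow (ennreal (1 / r ^ ?d) * ?A) ?a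
     \<le> epow (epow Y (1 / ?a)) ?a"
    using a by (intro epow_mono) auto
  also have "\<dots> = Y" using a p ps by (simp add: epow_epow)
  finally show ?thesis by (simp add: Y_def)
qed

end

subsection \<open>Interpolation\<close>

lemma ex_borel_version:
  fixes f :: "'a::euclidean_space \<Rightarrow> 'b::euclidean_space"
  assumes f: "f \<in> borel_measurable lebesgue"
  shows "\<exists>g\<in>borel_measurable borel. AE x in lborel. f x = g x"
proof -
  have "\<exists>g\<in>borel_measurable lborel. AE x in lborel. f x \<bullet> b = g x" for b
    using f by (intro completion_ex_borel_measurable_real) simp
  then obtain g where g: "\<And>b. g b \<in> borel_measurable lborel" "\<And>b. AE x in lborel. f x \<bullet> b = g b x" by metis
  have "AE x in lborel. \<forall>b\<in>Basis. f x \<bullet> b = g b x"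
    using g(2) by (intro AE_ball_countable[THEN iffD2]) (auto intro: countable_finite)
  then have "AE x in lborel. f x = (\<Sum>b\<in>Basis. g b x *\<^sub>R b)"
  proof eventually_elim
    case (elim x)
    have "f x = (\<Sum>b\<in>Basis. (f x \<bullet> b) *\<^sub>R b)" by (rule euclidean_representation[symmetric])
    also have "\<dots> = (\<Sum>b\<in>Basis. g b x *\<^sub>R b)" 
      by (intro sum.cong refl arg_cong2[where f = scaleR] bspec[OF elim])
    finally show ?case .
  qed
  moreover have "(\<lambda>x. \<Sum>b\<in>Basis. g b x *\<^sub>R b) \<in> borel_measurable borel"
  proof -
    have [measurable]: "g b \<in> borel_measurable borel" for b using g(1)[of b] by simp
    show ?thesis by measurable
  qed
  ultimately show ?thesis by (rule bexI)
qed

lemma integral_borel_version: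
  fixes h g :: "'a::euclidean_space \<Rightarrow> 'b::euclidean_space"
  assumes h: "h \<in> borel_measurable lebesgue" and g: "g \<in> borel_measurable borel"
    and eq: "AE x in lborel. h x = g x"
  shows "integrable lebesgue h \<longleftrightarrow> integrable lborel g" "integral\<^sup>L lebesgue h = integral\<^sup>L lborel g"
proof -
  have eq': "AE x in lebesgue. h x = g x" using eq by (rule AE_completion)
  have g': "g \<in> borel_measurable lebesgue" using g by (simp add: measurable_completion)
  show "integrable lebesgue h \<longleftrightarrow> integrable lborel g"
    using integrable_cong_AE[OF h g' eq'] integrable_completion[of g lborel] g by simp
  show "integral\<^sup>L lebesgue h = integral\<^sup>L lborel g"
    using integral_cong_AE[OF h g' eq'] integral_completion[of g lborel] g by simp
qed

text \<open>Local integrability speaks of compact sets only; the open ball is exhausted by closed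
  balls and the cut-off functions converge pointwise.\<close>

lemma locally_integrable_measurable:
  fixes u :: "'a::euclidean_space \<Rightarrow> 'b::euclidean_space"
  assumes "locally_integrable_on u (ball z r)" and r: "0 < r"
  shows "(\<lambda>x. indicator (ball z r) x *\<^sub>R u x) \<in> borel_measurable lebesgue"
proof (rule borel_measurable_LIMSEQ_metric)
  let ?s = "\<lambda>k. r - r / real (Suc k)"
  show "(\<lambda>x. indicator (cball z (?s k)) x *\<^sub>R u x) \<in> borel_measurable lebesgue" for k
  proof -
    have "0 < r / real (Suc k)" using r by simp
    then have "cball z (?s k) \<subseteq> ball z r" by (auto simp del: of_nat_Suc)
    then have "u absolutely_integrable_on cball z (?s k)"
      using assms(1) by (auto simp: locally_integrable_on_def)
    then show ?thesis unfolding set_integrable_def by auto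
  qed
  show "(\<lambda>k. indicator (cball z (?s k)) x *\<^sub>R u x) \<longlonglongrightarrow> indicator (ball z r) x *\<^sub>R u x" for x
  proof (cases "x \<in> ball z r")
    case True
    have "?s \<longlonglongrightarrow> r - 0" by (intro tendsto_diff tendsto_const LIMSEQ_Suc lim_const_over_n)
    then have "eventually (\<lambda>k. dist z x < ?s k) sequentially" using True by (intro order_tendstoD(1)) auto
    then have "eventually (\<lambda>k. indicator (cball z (?s k)) x *\<^sub>R u x = indicator (ball z r) x *\<^sub>R u x) sequentially"
      by eventually_elim (use True in simp)
    then show ?thesis by (rule tendsto_eventually)
  next
    case False
    have "x \<notin> cball z (?s k)" for k
    proof -
      have "0 < r / real (Suc k)" using r by simp
      then show ?thesis using False by (simp del: of_nat_Suc)
    qed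
    then show ?thesis using False by simp
  qed
qed

text \<open>Averages become integrals against a probability measure, for which the constant function
  1 is a free factor in Hoelder's inequality.\<close>

lemma average_uniform_measure:
  fixes U :: "'a::euclidean_space set"
  assumes "h' \<in> borel_measurable borel" "U \<in> sets borel" "AE x in lborel. x \<in> U \<longrightarrow> h x = h' x"
  shows "average U h = (\<integral>\<^sup>+x. h' x \<partial>uniform_measure lborel U)"
proof -
  have "(\<integral>\<^sup>+x\<in>U. h x \<partial>lebesgue) = (\<integral>\<^sup>+x\<in>U. h x \<partial>lborel)" by (rule nn_integral_completion)
  also have "\<dots> = (\<integral>\<^sup>+x\<in>U. h' x \<partial>lborel)"
    by (rule nn_integral_cong_AE) (use assms(3) in \<open>eventually_elim, auto simp: indicator_def\<close>)
  finally show ?thesis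
    using assms(1,2) by (simp add: average_def nn_integral_uniform_measure)
qed

text \<open>Hoelder's inequality with three functions: X^a with weight \<gamma> \<theta> / a, X^s
  with weight \<gamma> (1 - \<theta>) / s, and the constant 1, which takes up the slack in the
  condition on \<gamma>. The first two exponents combine to \<gamma>, and the third integral is
  1.\<close>

lemma lyapunov_interpolation:
  assumes P: "emeasure P (space P) = 1" and X: "X \<in> borel_measurable P" "\<And>x. 0 \<le> X x"
    and \<gamma>: "0 < \<gamma>" and \<theta>: "0 \<le> \<theta>" "\<theta> \<le> 1" and a: "0 < a" "0 < s"
    and le: "\<theta> / a + (1 - \<theta>) / s \<le> 1 / \<gamma>"
  shows "epow (\<integral>\<^sup>+x. ennreal (X x powr \<gamma>) \<partial>P) (1 / \<gamma>)
    \<le> epow (\<integral>\<^sup>+x. ennreal (X x powr a) \<partial>P) (\<theta> / a) * epow (\<integral>\<^sup>+x. ennreal (X x powr s) \<partial>P) ((1 - \<theta>) / s)"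
proof -
  let ?I = "\<lambda>c. \<integral>\<^sup>+x. ennreal (X x powr c) \<partial>P"
  define \<alpha> \<beta> where "\<alpha> = \<gamma> * \<theta> / a" and "\<beta> = \<gamma> * (1 - \<theta>) / s"
  have ab: "0 \<le> \<alpha>" "0 \<le> \<beta>" "\<alpha> + \<beta> \<le> 1"
  proof -
    have "\<gamma> * (\<theta> / a + (1 - \<theta>) / s) \<le> \<gamma> * (1 / \<gamma>)" using le \<gamma> by (intro mult_left_mono) auto
    then show "\<alpha> + \<beta> \<le> 1" using \<gamma> by (simp add: \<alpha>_def \<beta>_def distrib_left)
  qed (use \<gamma> \<theta> a in \<open>auto simp: \<alpha>_def \<beta>_def\<close>)
  define h where "h i x = (if i = 0 then ennreal (X x powr a) else if i = 1 then ennreal (X x powr s) else 1)" for i :: nat and x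
  define w where "w i = (if i = 0 then \<alpha> else if i = 1 then \<beta> else 1 - \<alpha> - \<beta>)" for i :: nat
  have "ennreal (X x powr \<gamma>) = (\<Prod>i\<in>{0,1,2}. epow (h i x) (w i))" for x
  proof -
    have e: "ennreal (X x powr c) = epow (ennreal (X x)) c" if "0 < c" for c
      using that X(2) by (simp add: epow_ennreal)
    have "a * \<alpha> = \<gamma> * \<theta>" "s * \<beta> = \<gamma> * (1 - \<theta>)" using a by (simp_all add: \<alpha>_def \<beta>_def)
    then have "a * \<alpha> + s * \<beta> = \<gamma>" by (simp add: algebra_simps)
    then show ?thesis
      using epow_add[of "a * \<alpha>" "s * \<beta>" "ennreal (X x)"] ab a
      by (simp add: h_def w_def e \<gamma> epow_epow)
  qed
  then have "(?I \<gamma>) = (\<integral>\<^sup>+x. (\<Prod>i\<in>{0,1,2}. epow (h i x) (w i)) \<partial>P)" by simp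
  also have "\<dots> \<le> (\<Prod>i\<in>{0,1,2}. epow (\<integral>\<^sup>+x. h i x \<partial>P) (w i))"
  proof (rule Holder_epow)
    show "h i \<in> borel_measurable P" for i
      using X(1) by (cases "i = 0"; cases "i = 1"; simp add: h_def[abs_def])
  qed (use ab in \<open>auto simp: w_def\<close>)
  also have "\<dots> = epow (?I a) \<alpha> * epow (?I s) \<beta>"
    by (simp add: h_def w_def P)
  finally have "epow (?I \<gamma>) (1 / \<gamma>)
     \<le> epow (epow (?I a) \<alpha> * epow (?I s) \<beta>) (1 / \<gamma>)"
    using \<gamma> by (intro epow_mono) auto
  also have "\<dots> = epow (?I a) (\<theta> / a) * epow (?I s) ((1 - \<theta>) / s)"
    using \<gamma> ab by (simp add: epow_mult epow_epow) (simp add: \<alpha>_def \<beta>_def)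
  finally show ?thesis .
qed

lemma measurable_psi:
  assumes "weak_Phi \<psi>" and [measurable]: "F \<in> borel_measurable M" and "\<And>x. 0 \<le> F x"
  shows "(\<lambda>x. \<psi> (F x)) \<in> borel_measurable M"
proof -
  have "mono (\<lambda>t. \<psi> (max 0 t))"
    using assms(1) by (auto simp: weak_Phi_def mono_on_def mono_def)
  then have [measurable]: "(\<lambda>t. \<psi> (max 0 t)) \<in> borel_measurable borel" by (rule borel_measurable_mono)
  have "(\<lambda>x. (\<lambda>t. \<psi> (max 0 t)) (F x)) \<in> borel_measurable M" by measurable
  then show ?thesis using assms(3) by (simp add: max_def)
qed

text \<open>The power q2 / q turns the growth (F / m)^q into F^q2 / m^q2, whose mean is 1 if m is
  the mean of order q2. The factor 2 comes from the pointwise sum, \<open>2 powr (q / q2)\<close>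
  from the integrated one.\<close>

lemma psi_Lq_le:
  assumes \<psi>: "weak_Phi \<psi>" "aInc 1 L \<psi>" "aDec q L \<psi>" and q: "1 \<le> q" and q2: "0 < q2"
    and P: "emeasure P (space P) = 1" and F [measurable]: "F \<in> borel_measurable P" and F0: "\<And>x. 0 \<le> F x"
  shows "epow (\<integral>\<^sup>+x. ennreal (\<psi> (F x) powr (q2 / q)) \<partial>P) (q / q2)
    \<le> ennreal (2 * L * 2 powr (q / q2)) * ext_infty \<psi> (epow (\<integral>\<^sup>+x. ennreal (F x powr q2) \<partial>P) (1 / q2))"
proof -
  have q0: "0 \<le> q" using q by simp
  note facts = \<psi> q0
  define J where "J = (\<integral>\<^sup>+x. ennreal (F x powr q2) \<partial>P)"
  define s where "s = q2 / q"
  have s: "0 < s" "q / q2 = 1 / s" using q q2 by (auto simp: s_def)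
  have L: "1 \<le> L" by (rule aInc_const_ge_1[OF facts])
  have [measurable]: "(\<lambda>x. \<psi> (F x)) \<in> borel_measurable P" by (rule measurable_psi[OF \<psi>(1) F F0])
  \<comment> \<open>A scale \<open>m\<close> must be positive and finite. If \<open>J = 0\<close>
    then F, and with it \<psi> (F), vanishes almost everywhere; if \<open>J = \<infinity>\<close>
    the bound is infinite.\<close>
  consider "J = 0" | "J = \<infinity>" | j where "0 < j" "J = ennreal j"
    by (cases J) (auto, metis ennreal_0 ennreal_less_zero_iff less_eq_real_def)
  then show ?thesis
  proof cases
    case 1
    then have "AE x in P. ennreal (F x powr q2) = 0" by (simp add: J_def nn_integral_0_iff_AE)
    then have "AE x in P. ennreal (\<psi> (F x) powr s) = 0"
      by eventually_elim (simp add: psi_zero[OF facts] ennreal_eq_0_iff)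
    then have "(\<integral>\<^sup>+x. ennreal (\<psi> (F x) powr s) \<partial>P) = 0" by (simp add: nn_integral_0_iff_AE)
    then show ?thesis using s by (simp add: s_def[symmetric])
  next
    case 2
    then show ?thesis using q2 L by (simp add: J_def[symmetric] ext_infty_def ennreal_mult_top)
  next
    case 3
    define m where "m = j powr (1 / q2)"
    have m: "0 < m" "m powr q2 = j" using 3 q2 by (auto simp: m_def powr_powr)
    have em: "epow J (1 / q2) = ennreal m" using 3 q2 by (simp add: epow_ennreal m_def)
    define B where "B = L * \<psi> m"
    have B: "0 \<le> B" using L psi_nonneg[OF facts, of m] m by (simp add: B_def)
    have pt: "\<psi> (F x) powr s \<le> (2 * B) powr s * (1 + F x powr q2 / j)" for x
    proof -
      let ?w = "(F x / m) powr q"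
      have "\<psi> (F x) \<le> B * (1 + ?w)"
        using psi_le_sum[OF facts m(1) F0] by (simp add: B_def)
      also have "\<dots> \<le> B * (2 * max 1 ?w)" using B by (intro mult_left_mono) auto
      finally have "\<psi> (F x) powr s \<le> (2 * B * max 1 ?w) powr s"
        using s psi_nonneg[OF facts F0] by (intro powr_mono2) (auto simp: mult_ac)
      also have "\<dots> = (2 * B) powr s * (max 1 ?w) powr s" by (simp add: powr_mult)
      also have "(max 1 ?w) powr s \<le> 1 + ?w powr s" by (auto simp: max_def)
      also have "?w powr s = F x powr q2 / j"
        using m q F0[of x] by (simp add: powr_powr s_def powr_divide)
      finally show ?thesis by (simp add: mult_left_mono)
    qed
    have "(\<integral>\<^sup>+x. ennreal (\<psi> (F x) powr s) \<partial>P)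
       \<le> (\<integral>\<^sup>+x. ennreal ((2 * B) powr s) * (1 + ennreal (F x powr q2) * ennreal (1 / j)) \<partial>P)"
    proof (rule nn_integral_mono)
      fix x
      have "ennreal (\<psi> (F x) powr s) \<le> ennreal ((2 * B) powr s * (1 + F x powr q2 * (1 / j)))"
        using pt[of x] by (intro ennreal_leI) simp
      also have "\<dots> = ennreal ((2 * B) powr s) * (1 + ennreal (F x powr q2) * ennreal (1 / j))"
        using 3 by (simp add: ennreal_mult[symmetric] flip: ennreal_plus ennreal_1)
      finally show "ennreal (\<psi> (F x) powr s) \<le> ennreal ((2 * B) powr s) * (1 + ennreal (F x powr q2) * ennreal (1 / j))" .
    qed
    also have "\<dots> = ennreal ((2 * B) powr s) * (1 + J * ennreal (1 / j))"
      by (simp add: nn_integral_cmult nn_integral_add nn_integral_multc P J_def)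
    also have "J * ennreal (1 / j) = 1" using 3 by (simp flip: ennreal_mult)
    finally have "epow (\<integral>\<^sup>+x. ennreal (\<psi> (F x) powr s) \<partial>P) (1 / s) \<le> epow (ennreal ((2 * B) powr s * 2)) (1 / s)"
      using s by (intro epow_mono) (auto simp: ennreal_mult)
    also have "\<dots> = ennreal (2 * B * 2 powr (1 / s))"
      using s B by (simp add: epow_ennreal powr_mult powr_powr)
    also have "2 * B * 2 powr (1 / s) = (2 * L * 2 powr (1 / s)) * \<psi> m" by (simp add: B_def mult_ac)
    also have "ennreal \<dots> = ennreal (2 * L * 2 powr (1 / s)) * ext_infty \<psi> (ennreal m)"
      using L m psi_nonneg[OF facts, of m] by (simp add: ext_infty_def ennreal_mult)
    finally show ?thesis by (simp add: em s(2) J_def[symmetric] s_def[symmetric])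
  qed
qed

text \<open>The type enters only through its dimension and the volume of its unit ball, which
  converts integrals into averages. The factor \<open>L * 2 powr q\<close> passes from \<psi> to
  \<open>young_of\<close>, the factor \<open>L powr p\<close> back.\<close>

definition psi_sobolev_const :: "'a::euclidean_space itself \<Rightarrow> real \<Rightarrow> real \<Rightarrow> real \<Rightarrow> ennreal" where
  "psi_sobolev_const _ p L q =
     ennreal (L * 2 powr q)
     * epow (epow (ennreal (1 / measure lborel (ball (0::'a) 1))) (p / sobolev_exp DIM('a) p)
         * sobolev_const DIM('a) p (L ^ 3 * 4 powr q)
         * ennreal (2 ^ DIM('a) * (L ^ 3 * 4 powr q) powr p * measure lborel (ball (0::'a) 1) * L powr p)) (1 / p)"

lemma epow_finite: "x < \<infinity> \<Longrightarrow> epow x a < \<infinity>"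
  by (auto simp: epow_def)

lemma psi_sobolev_const_finite:
  assumes "2 \<le> DIM('a::euclidean_space)" "0 < p"
  shows "psi_sobolev_const TYPE('a) p L q < \<infinity>"
  unfolding psi_sobolev_const_def infinity_ennreal_def
  by (intro ennreal_mult_less_top[THEN iffD2] disjI2 conjI epow_finite[unfolded infinity_ennreal_def]
      sobolev_const_finite[unfolded infinity_ennreal_def] assms)
     simp_all

lemma emeasure_ball_scale:
  assumes "0 < r"
  shows "emeasure lborel (ball (z::'a::euclidean_space) r) = ennreal (r ^ DIM('a) * measure lborel (ball (0::'a) 1))"
proof -
  have w: "emeasure lborel (ball (0::'a) 1) = ennreal (measure lborel (ball (0::'a) 1))"
    using emeasure_lborel_ball_finite[of "0::'a" 1] by (intro emeasure_eq_ennreal_measure) auto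
  have "emeasure lborel (ball (0::'a) 1) = ennreal (1 / r ^ DIM('a)) * emeasure lborel (ball z r)"
    using nn_integral_ball_rescale[of "\<lambda>_. 1" r z] assms by simp
  then have "ennreal (r ^ DIM('a)) * emeasure lborel (ball (0::'a) 1)
      = (ennreal (r ^ DIM('a)) * ennreal (1 / r ^ DIM('a))) * emeasure lborel (ball z r)"
    by (simp add: mult.assoc)
  also have "ennreal (r ^ DIM('a)) * ennreal (1 / r ^ DIM('a)) = 1"
    using assms by (simp flip: ennreal_mult)
  finally show ?thesis using assms by (simp add: w ennreal_mult)
qed

lemma measure_unit_ball_pos: "0 < measure lborel (ball (0::'a::euclidean_space) 1)"
  using content_ball_pos[of 1 "0::'a"] by simp

text \<open>\<open>sobolev_young_ball\<close> is transferred by \<open>psi_le_young\<close> on the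
  left and \<open>young_le\<close> on the right. The factor (2 / r)^n meets the volume of the ball,
  so r cancels from the constant.\<close>

lemma psi_sobolev:
  fixes u :: "'a::euclidean_space \<Rightarrow> nat \<Rightarrow> real" and G :: "'a \<Rightarrow> nat \<Rightarrow> 'a"
    and p r :: real
  assumes \<psi>: "weak_Phi \<psi>" "aInc 1 L \<psi>" "aDec q L \<psi>" and q: "0 \<le> q"
    and n: "2 \<le> DIM('a)" and p: "1 \<le> p" "p < DIM('a)" and r: "0 < r"
    and uG: "weak_pair N (ball z r) u G"
  defines "P \<equiv> uniform_measure lborel (ball z r)"
    and "F \<equiv> \<lambda>x. vec_norm N (\<lambda>i. u x i / r)" and "T \<equiv> \<lambda>x. mat_norm N (G x)"
  shows "epow (\<integral>\<^sup>+x. ennreal (\<psi> (F x) powr sobolev_exp DIM('a) p) \<partial>P) (1 / sobolev_exp DIM('a) p)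
   \<le> psi_sobolev_const TYPE('a) p L q * epow (\<integral>\<^sup>+x. ennreal (\<psi> (T x) powr p + \<psi> (F x) powr p) \<partial>P) (1 / p)"
proof -
  let ?h = "\<lambda>x. \<psi> (T x) powr p + \<psi> (F x) powr p"
  note facts = \<psi> q and u = weak_pairD(1)[OF uG] and Gm = weak_pairD(2)[OF uG]
  define \<Phi> where "\<Phi> = young_of \<psi>"
  define D where "D = L ^ 3 * 4 powr q"
  let ?k = "\<lambda>x. \<Phi> (T x) powr p + \<Phi> (F x) powr p"
  interpret doubling_young \<Phi> D
    unfolding \<Phi>_def D_def by (rule young_of_doubling[OF facts])
  let ?ps = "sobolev_exp DIM('a) p" and ?d = "DIM('a)"
  let ?S = "\<integral>\<^sup>+x. ennreal (\<psi> (F x) powr ?ps) \<partial>P"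
  let ?B = "\<integral>\<^sup>+x. ennreal (\<Phi> (F x) powr ?ps) \<partial>P"
  define \<omega> where "\<omega> = measure lborel (ball (0::'a) 1)"
  define C where "C = sobolev_const ?d p D"
  have \<omega>: "0 < \<omega>" unfolding \<omega>_def by (rule measure_unit_ball_pos)
  have V: "emeasure lborel (ball z r) = ennreal (r ^ ?d * \<omega>)"
    unfolding \<omega>_def by (rule emeasure_ball_scale[OF r])
  have ps: "0 < ?ps" using p by (simp add: sobolev_exp_def)
  have L: "1 \<le> L" by (rule aInc_const_ge_1[OF facts])
  have Fm [measurable]: "F \<in> borel_measurable borel"
    unfolding F_def using u by (intro measurable_vec_norm borel_measurable_divide) auto
  have Tm [measurable]: "T \<in> borel_measurable borel"
    unfolding T_def by (intro measurable_mat_norm Gm)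
  have F0: "0 \<le> F x" and T0: "0 \<le> T x" for x
    by (simp_all add: F_def T_def vec_norm_def L2_set_nonneg mat_norm_nonneg)
  have [measurable]: "(\<lambda>x. \<psi> (F x)) \<in> borel_measurable borel" "(\<lambda>x. \<psi> (T x)) \<in> borel_measurable borel"
    by (rule measurable_psi[OF \<psi>(1)]; simp add: F0 T0)+
  have U [measurable]: "ball z r \<in> sets borel" by simp
  have nP: "(\<integral>\<^sup>+x. h x \<partial>P) = ennreal (1 / (r ^ ?d * \<omega>)) * (\<integral>\<^sup>+x\<in>ball z r. h x \<partial>lborel)"
    if "h \<in> borel_measurable borel" for h
    using that U r \<omega> by (simp add: P_def nn_integral_uniform_measure V divide_ennreal_def inverse_ennreal mult.commute divide_inverse)
  let ?A = "\<integral>\<^sup>+x\<in>ball z r. ennreal (\<Phi> (F x) powr ?ps) \<partial>lborel"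
  let ?J = "\<integral>\<^sup>+x\<in>ball z r. ennreal (?k x) \<partial>lborel"
  let ?Q = "\<integral>\<^sup>+x. ennreal (?h x) \<partial>P"
  have main: "epow (ennreal (1 / r ^ ?d) * ?A) (p / ?ps) \<le> C * (ennreal ((2 / r) ^ ?d * D powr p) * ?J)"
    unfolding F_def T_def C_def by (rule sobolev_young_ball[OF n p r uG])
  have J: "?J \<le> ennreal (r ^ ?d * \<omega> * L powr p) * ?Q"
  proof -
    have "?J \<le> (\<integral>\<^sup>+x. ennreal (L powr p) * (ennreal (?h x) * indicator (ball z r) x) \<partial>lborel)"
    proof (rule nn_integral_mono)
      fix x
      have *: "\<Phi> t powr p \<le> L powr p * \<psi> t powr p" if "0 \<le> t" for t
      proof -
        have "\<Phi> t powr p \<le> (L * \<psi> t) powr p"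
          unfolding \<Phi>_def using young_le[OF facts that] p nonneg[of t]
          by (intro powr_mono2) (auto simp: \<Phi>_def)
        then show ?thesis by (simp add: powr_mult)
      qed
      have "ennreal (?k x) \<le> ennreal (L powr p * (?h x))"
        using *[OF T0, of x] *[OF F0, of x] by (intro ennreal_leI) (simp add: distrib_left)
      also have "\<dots> = ennreal (L powr p) * ennreal (?h x)"
        by (rule ennreal_mult) auto
      finally show "ennreal (?k x) * indicator (ball z r) x
         \<le> ennreal (L powr p) * (ennreal (?h x) * indicator (ball z r) x)"
        unfolding mult.assoc[symmetric] by (rule mult_right_mono) simp
    qed
    also have "\<dots> = ennreal (L powr p) * (\<integral>\<^sup>+x\<in>ball z r. ennreal (?h x) \<partial>lborel)"
      by (rule nn_integral_cmult) measurable
    also have "(\<integral>\<^sup>+x\<in>ball z r. ennreal (?h x) \<partial>lborel) = ennreal (r ^ ?d * \<omega>) * ?Q"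
    proof -
      have "ennreal (r ^ ?d * \<omega>) * ennreal (1 / (r ^ ?d * \<omega>)) = 1"
        using r \<omega> by (simp flip: ennreal_mult)
      then show ?thesis by (subst nP) (auto simp: mult.assoc[symmetric])
    qed
    finally show ?thesis using r \<omega> by (simp add: ennreal_mult mult_ac)
  qed
  have "epow ?B (p / ?ps)
     = epow (ennreal (1 / \<omega>) * (ennreal (1 / r ^ ?d) * ?A)) (p / ?ps)"
    using r \<omega> by (subst nP) (auto simp: mult.assoc[symmetric] mult.commute simp flip: ennreal_mult)
  also have "\<dots> = epow (ennreal (1 / \<omega>)) (p / ?ps) * epow (ennreal (1 / r ^ ?d) * ?A) (p / ?ps)"
    using p ps by (intro epow_mult) auto
  also have "\<dots> \<le> epow (ennreal (1 / \<omega>)) (p / ?ps) * (C * (ennreal ((2 / r) ^ ?d * D powr p) * (ennreal (r ^ ?d * \<omega> * L powr p) * ?Q)))"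
    by (intro mult_left_mono order_trans[OF main] J) auto
  also have "\<dots> = epow (ennreal (1 / \<omega>)) (p / ?ps) * C * ennreal (2 ^ ?d * D powr p * \<omega> * L powr p) * ?Q"
  proof -
    have "ennreal ((2 / r) ^ ?d * D powr p) * ennreal (r ^ ?d * \<omega> * L powr p) = ennreal (2 ^ ?d * D powr p * \<omega> * L powr p)"
      using r \<omega> by (simp add: power_divide flip: ennreal_mult)
    then show ?thesis by (simp add: mult.assoc[symmetric])
  qed
  finally have \<Phi>b: "epow ?B (p / ?ps)
     \<le> epow (ennreal (1 / \<omega>)) (p / ?ps) * C * ennreal (2 ^ ?d * D powr p * \<omega> * L powr p) * ?Q" (is "_ \<le> ?C1 * _") .
  have \<psi>b: "?S \<le> ennreal ((L * 2 powr q) powr ?ps) * ?B"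
  proof -
    have "\<psi> (F x) powr ?ps \<le> (L * 2 powr q) powr ?ps * \<Phi> (F x) powr ?ps" for x
    proof -
      have "\<psi> (F x) powr ?ps \<le> (L * 2 powr q * \<Phi> (F x)) powr ?ps"
        unfolding \<Phi>_def using psi_le_young[OF facts F0] psi_nonneg[OF facts F0] ps by (intro powr_mono2) auto
      then show ?thesis by (simp add: powr_mult)
    qed
    then have "?S \<le> (\<integral>\<^sup>+x. ennreal ((L * 2 powr q) powr ?ps) * ennreal (\<Phi> (F x) powr ?ps) \<partial>P)"
      by (intro nn_integral_mono) (simp add: ennreal_leI flip: ennreal_mult)
    also have "\<dots> = ennreal ((L * 2 powr q) powr ?ps) * ?B"
      by (rule nn_integral_cmult) (simp add: P_def)
    finally show ?thesis .
  qed
  have "epow ?S (1 / ?ps)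
     \<le> epow (ennreal ((L * 2 powr q) powr ?ps) * ?B) (1 / ?ps)"
    using ps by (intro epow_mono \<psi>b) auto
  also have "\<dots> = ennreal (L * 2 powr q) * epow ?B (1 / ?ps)"
    using ps L by (simp add: epow_mult epow_ennreal powr_powr)
  also have "epow ?B (1 / ?ps)
     = epow (epow ?B (p / ?ps)) (1 / p)"
    using ps p by (simp add: epow_epow)
  also have "\<dots> \<le> epow (?C1 * ?Q) (1 / p)" using p by (intro epow_mono \<Phi>b) auto
  also have "\<dots> = epow ?C1 (1 / p) * epow ?Q (1 / p)" using p by (intro epow_mult) auto
  finally show ?thesis
    by (simp add: psi_sobolev_const_def \<omega>_def[symmetric] C_def D_def mult.assoc mult_left_mono)
qed

text \<open>Used to bound the powers \<theta> and 1 - \<theta> of the two constants uniformly in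
  \<theta>.\<close>

lemma epow_le_max_1: "0 \<le> \<theta> \<Longrightarrow> \<theta> \<le> 1 \<Longrightarrow> epow x \<theta> \<le> max 1 x"
proof (cases "x \<le> 1")
  case True
  assume "0 \<le> \<theta>"
  from epow_mono[OF True this] show ?thesis by (simp add: le_max_iff_disj)
next
  case False
  assume \<theta>: "0 \<le> \<theta>" "\<theta> \<le> 1"
  have "1 * epow x \<theta> \<le> epow x (1 - \<theta>) * epow x \<theta>"
    using epow_mono[of 1 x "1 - \<theta>"] False \<theta> by (intro mult_right_mono) auto
  also have "\<dots> = x" using epow_add[of "1 - \<theta>" \<theta> x] \<theta> by simp
  finally show ?thesis by (simp add: le_max_iff_disj)
qed

text \<open>Both functions are extended by 0 outside the ball and changed on a null set. Integrals
  do not see the change, so the weak formulation carries over from \<open>lebesgue\<close> to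
  \<open>lborel\<close>.\<close>

lemma borel_version_of_weak_derivative:
  fixes f :: "'a::euclidean_space \<Rightarrow> nat \<Rightarrow> real" and Df :: "'a \<Rightarrow> nat \<Rightarrow> 'a"
  assumes f: "f \<in> vec_W11 (ball z r) N" and Df: "weak_derivative (ball z r) N f Df" and r: "0 < r"
  obtains u G where "weak_pair N (ball z r) u G"
    "AE x in lborel. x \<in> ball z r \<longrightarrow> (\<forall>i<N. f x i = u x i \<and> Df x i = G x i)"
proof -
  let ?U = "ball z r"
  let ?f = "\<lambda>i x. indicator ?U x *\<^sub>R f x i" and ?D = "\<lambda>i x. indicator ?U x *\<^sub>R Df x i"
  have wg: "weak_gradient ?U (\<lambda>x. f x i) (\<lambda>x. Df x i)" if "i < N" for i
    using Df that by (auto simp: weak_derivative_def)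
  have fi: "integrable lebesgue (?f i)" if "i < N" for i
    using f that by (auto simp: vec_W11_def W11_def set_integrable_def)
  have Dm: "?D i \<in> borel_measurable lebesgue" if "i < N" for i
    using locally_integrable_measurable[OF _ r] wg[OF that] by (auto simp: weak_gradient_def)
  have "\<exists>g\<in>borel_measurable borel. AE x in lborel. ?f i x = g x" if "i < N" for i
    by (rule ex_borel_version) (use fi[OF that] in auto)
  then obtain u' where u': "\<And>i. i < N \<Longrightarrow> u' i \<in> borel_measurable borel"
    "\<And>i. i < N \<Longrightarrow> AE x in lborel. ?f i x = u' i x" by metis
  have "\<exists>g\<in>borel_measurable borel. AE x in lborel. ?D i x = g x" if "i < N" for i
    by (rule ex_borel_version[OF Dm[OF that]])
  then obtain G' where G': "\<And>i. i < N \<Longrightarrow> G' i \<in> borel_measurable borel"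
    "\<And>i. i < N \<Longrightarrow> AE x in lborel. ?D i x = G' i x" by metis
  show ?thesis
  proof (rule that[of "\<lambda>x i. u' i x" "\<lambda>x i. G' i x"])
    show "weak_pair N ?U (\<lambda>x i. u' i x) (\<lambda>x i. G' i x)"
      unfolding weak_pair_def
    proof (intro allI impI conjI; (elim conjE)?)
      fix i assume i: "i < N"
      note [measurable] = u'(1)[OF i] G'(1)[OF i] Dm[OF i]
      have fm [measurable]: "?f i \<in> borel_measurable lebesgue" using fi[OF i] by auto
      show "integrable lborel (\<lambda>x. u' i x)"
        using integral_borel_version(1)[OF fm u'(1)[OF i] u'(2)[OF i]] fi[OF i] by simp
      show "(\<lambda>x. G' i x) \<in> borel_measurable borel" by measurable
      show "integrable lborel (\<lambda>x. indicator S x *\<^sub>R G' i x)" if S: "compact S" "S \<subseteq> ?U" for S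
      proof -
        have int: "integrable lebesgue (\<lambda>x. indicator S x *\<^sub>R Df x i)"
          using wg[OF i] S by (auto simp: weak_gradient_def locally_integrable_on_def set_integrable_def)
        have "AE x in lborel. indicator S x *\<^sub>R Df x i = indicator S x *\<^sub>R G' i x"
          using G'(2)[OF i] by eventually_elim (use S in \<open>auto simp: indicator_def\<close>)
        moreover have "S \<in> sets borel" using S(1) by (simp add: borel_compact)
        ultimately show ?thesis
          using integral_borel_version(1)[of "\<lambda>x. indicator S x *\<^sub>R Df x i" "\<lambda>x. indicator S x *\<^sub>R G' i x"] int by auto
      qed
      fix \<phi> and b :: 'a assume \<phi>: "test_function ?U \<phi>" and b: "b \<in> Basis"
      have "Ck (Suc 0) \<phi>" "Ck 0 \<phi>" using \<phi> unfolding test_function_def by blast+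
      then have \<phi>m [measurable]: "\<phi> \<in> borel_measurable borel"
        and \<phi>m' [measurable]: "(\<lambda>x. frechet_derivative \<phi> (at x) b) \<in> borel_measurable borel"
        using b by (auto intro: borel_measurable_continuous_onI)
      have leb: "h \<in> borel_measurable lebesgue" if "h \<in> borel_measurable borel" for h :: "'a \<Rightarrow> real"
        using that by (simp add: measurable_completion)
      have "(\<integral>x. u' i x * frechet_derivative \<phi> (at x) b \<partial>lborel) = (\<integral>x. ?f i x * frechet_derivative \<phi> (at x) b \<partial>lebesgue)"
      proof (rule integral_borel_version(2)[symmetric])
        show "AE x in lborel. ?f i x * frechet_derivative \<phi> (at x) b = u' i x * frechet_derivative \<phi> (at x) b"
          using u'(2)[OF i] by eventually_elim simp
        show "(\<lambda>x. ?f i x * frechet_derivative \<phi> (at x) b) \<in> borel_measurable lebesgue"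
          by (intro borel_measurable_times fm leb \<phi>m')
      qed measurable
      also have "\<dots> = (LINT x:?U|lebesgue. f x i * frechet_derivative \<phi> (at x) b)"
        by (simp add: set_lebesgue_integral_def mult.assoc)
      also have "\<dots> = - (LINT x:?U|lebesgue. (Df x i \<bullet> b) * \<phi> x)"
        using wg[OF i] \<phi> b by (auto simp: weak_gradient_def)
      also have "(LINT x:?U|lebesgue. (Df x i \<bullet> b) * \<phi> x) = (\<integral>x. (?D i x \<bullet> b) * \<phi> x \<partial>lebesgue)"
        by (simp add: set_lebesgue_integral_def mult.assoc)
      also have "\<dots> = (\<integral>x. (G' i x \<bullet> b) * \<phi> x \<partial>lborel)"
      proof (rule integral_borel_version(2))
        show "AE x in lborel. (?D i x \<bullet> b) * \<phi> x = (G' i x \<bullet> b) * \<phi> x"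
          using G'(2)[OF i] by eventually_elim simp
        show "(\<lambda>x. (?D i x \<bullet> b) * \<phi> x) \<in> borel_measurable lebesgue"
          by (intro borel_measurable_times borel_measurable_inner borel_measurable_const Dm[OF i] leb \<phi>m)
      qed measurable
      finally show "(\<integral>x. u' i x * frechet_derivative \<phi> (at x) b \<partial>lborel) = - (\<integral>x. (G' i x \<bullet> b) * \<phi> x \<partial>lborel)" .
    qed
  next
    have "AE x in lborel. \<forall>i\<in>{..<N}. ?f i x = u' i x \<and> ?D i x = G' i x"
      by (intro AE_ball_countable[THEN iffD2] ballI countable_finite)
         (use u'(2) G'(2) in auto)
    then show "AE x in lborel. x \<in> ?U \<longrightarrow> (\<forall>i<N. f x i = u' i x \<and> Df x i = G' i x)"
      by eventually_elim auto
  qed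
qed

theorem lemma2p13:
  fixes p L q\<^sub>1 q\<^sub>2 :: real
  assumes "CARD('n::finite) \<ge> 2"
    and "1 \<le> p" and "p < real CARD('n)"
    and "L \<ge> 1" and "q\<^sub>1 \<ge> 1" and "q\<^sub>2 > 0"
  shows "\<exists>c>0. \<forall>(\<psi> :: real \<Rightarrow> real) (\<gamma> :: real) (\<theta> :: real).
    weak_Phi \<psi> \<and> aInc 1 L \<psi> \<and> aDec q\<^sub>1 L \<psi> \<and> \<gamma> > 0 \<and> 0 \<le> \<theta> \<and> \<theta> \<le> 1 \<and>
    1 / \<gamma> \<ge> \<theta> / (real CARD('n) * p / (real CARD('n) - p)) + (1 - \<theta>) * q\<^sub>1 / q\<^sub>2 \<longrightarrow>
    (\<forall>(z :: real ^ 'n) (r :: real) (N :: nat) (f :: real ^ 'n \<Rightarrow> nat \<Rightarrow> real)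
       (Df :: real ^ 'n \<Rightarrow> nat \<Rightarrow> real ^ 'n).
      r > 0 \<and> N \<ge> 1 \<and> f \<in> vec_W11 (ball z r) N \<and> weak_derivative (ball z r) N f Df \<longrightarrow>
      epow (average (ball z r) (\<lambda>x. ennreal (\<psi> (vec_norm N (\<lambda>i. f x i / r)) powr \<gamma>))) (1 / \<gamma>)
      \<le> ennreal c
        * epow (average (ball z r) (\<lambda>x. ennreal (\<psi> (mat_norm N (Df x)) powr p
                                         + \<psi> (vec_norm N (\<lambda>i. f x i / r)) powr p))) (\<theta> / p)
        * epow (ext_infty \<psi> (epow (average (ball z r)
              (\<lambda>x. ennreal (vec_norm N (\<lambda>i. f x i / r) powr q\<^sub>2))) (1 / q\<^sub>2))) (1 - \<theta>))"
proof -
  have n: "2 \<le> DIM(real ^ 'n)" and d: "DIM(real ^ 'n) = CARD('n)" using assms(1) by simp_all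
  have p: "1 \<le> p" "p < real DIM(real ^ 'n)" using assms by simp_all
  let ?ps = "sobolev_exp CARD('n) p"
  define C where "C = psi_sobolev_const TYPE(real ^ 'n) p L q\<^sub>1"
  define E where "E = 2 * L * 2 powr (q\<^sub>1 / q\<^sub>2)"
  have E0: "0 \<le> E" using assms by (simp add: E_def)
  \<comment> \<open>Both maxima with 1 absorb the interpolation exponents, so \<open>c\<close>
    involves neither \<theta> nor \<gamma>; \<open>N\<close> and \<psi> never entered the two
    constants.\<close>
  define c where "c = max 1 (enn2real C) * max 1 E"
  have C: "C < \<infinity>" unfolding C_def by (rule psi_sobolev_const_finite[OF n]) (use assms in simp)
  then have Cr: "max 1 C = ennreal (max 1 (enn2real C))"
    by (cases C) (auto simp: max_def ennreal_1[symmetric] simp del: ennreal_1)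
  have ps: "0 < ?ps" using assms by (simp add: sobolev_exp_def)
  have ps': "?ps = real CARD('n) * p / (real CARD('n) - p)" by (simp add: sobolev_exp_def)
  show ?thesis
  proof (intro exI[of _ c] conjI allI impI; (elim conjE)?)
    show "0 < c" by (simp add: c_def)
    fix \<psi> :: "real \<Rightarrow> real" and \<gamma> \<theta> :: real
    fix z :: "real ^ 'n" and r :: real and N :: nat and f :: "real ^ 'n \<Rightarrow> nat \<Rightarrow> real" and Df :: "real ^ 'n \<Rightarrow> nat \<Rightarrow> real ^ 'n"
    assume \<psi>: "weak_Phi \<psi>" "aInc 1 L \<psi>" "aDec q\<^sub>1 L \<psi>" and \<gamma>: "\<gamma> > 0" and \<theta>: "0 \<le> \<theta>" "\<theta> \<le> 1"
      and le: "1 / \<gamma> \<ge> \<theta> / (real CARD('n) * p / (real CARD('n) - p)) + (1 - \<theta>) * q\<^sub>1 / q\<^sub>2"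
      and r: "r > 0" and f: "f \<in> vec_W11 (ball z r) N" and Df: "weak_derivative (ball z r) N f Df"
    obtain u G where uG: "weak_pair N (ball z r) u G"
      and ae: "AE x in lborel. x \<in> ball z r \<longrightarrow> (\<forall>i<N. f x i = u x i \<and> Df x i = G x i)"
      by (rule borel_version_of_weak_derivative[OF f Df r])
    define P where "P = uniform_measure lborel (ball z r)"
    define F where "F x = vec_norm N (\<lambda>i. u x i / r)" for x
    define T where "T x = mat_norm N (G x)" for x
    let ?f = "\<lambda>x. vec_norm N (\<lambda>i. f x i / r)"
  let ?S' = "\<integral>\<^sup>+x. ennreal (\<psi> (F x) powr (q\<^sub>2 / q\<^sub>1)) \<partial>P"
  let ?S = "\<integral>\<^sup>+x. ennreal (\<psi> (F x) powr ?ps) \<partial>P"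
    have Fm [measurable]: "F \<in> borel_measurable borel"
      unfolding F_def using weak_pairD(1)[OF uG] by (intro measurable_vec_norm borel_measurable_divide) auto
    have Tm [measurable]: "T \<in> borel_measurable borel"
      unfolding T_def by (intro measurable_mat_norm weak_pairD(2)[OF uG])
    have F0: "0 \<le> F x" and T0: "0 \<le> T x" for x
      by (simp_all add: F_def T_def vec_norm_def L2_set_nonneg mat_norm_nonneg)
    have \<psi>F [measurable]: "(\<lambda>x. \<psi> (F x)) \<in> borel_measurable borel" and [measurable]: "(\<lambda>x. \<psi> (T x)) \<in> borel_measurable borel"
      by (rule measurable_psi[OF \<psi>(1)]; simp add: F0 T0)+
    have P1: "emeasure P (space P) = 1"
    proof -
      have "emeasure lborel (ball z r) \<noteq> 0" "emeasure lborel (ball z r) \<noteq> \<infinity>"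
        using emeasure_ball_scale[OF r, of z] r measure_unit_ball_pos[where 'a = "real ^ 'n"] by simp_all
      then show ?thesis by (simp add: P_def ennreal_divide_self less_top)
    qed
    \<comment> \<open>All averages see \<open>f\<close> and \<open>Df\<close> only through these two
      norms, so one replacement with an arbitrary \<open>h\<close> serves the three of them.\<close>
    have "AE x in lborel. x \<in> ball z r \<longrightarrow> ?f x = F x \<and> mat_norm N (Df x) = T x"
      using ae by eventually_elim (auto simp: F_def T_def vec_norm_def mat_norm_def intro!: L2_set_cong)
    then have ave: "average (ball z r) (\<lambda>x. h (?f x) (mat_norm N (Df x))) = (\<integral>\<^sup>+x. h (F x) (T x) \<partial>P)"
      if "(\<lambda>x. h (F x) (T x)) \<in> borel_measurable borel" for h
      unfolding P_def by (intro average_uniform_measure that) (auto elim: eventually_mono)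
    have a1: "average (ball z r) (\<lambda>x. ennreal (\<psi> (?f x) powr \<gamma>)) = (\<integral>\<^sup>+x. ennreal (\<psi> (F x) powr \<gamma>) \<partial>P)"
      by (rule ave[where h = "\<lambda>s t. ennreal (\<psi> s powr \<gamma>)"]) measurable
    have a2: "average (ball z r) (\<lambda>x. ennreal (\<psi> (mat_norm N (Df x)) powr p + \<psi> (?f x) powr p))
        = (\<integral>\<^sup>+x. ennreal (\<psi> (T x) powr p + \<psi> (F x) powr p) \<partial>P)"
      by (rule ave[where h = "\<lambda>s t. ennreal (\<psi> t powr p + \<psi> s powr p)"]) measurable
    have a3: "average (ball z r) (\<lambda>x. ennreal (?f x powr q\<^sub>2)) = (\<integral>\<^sup>+x. ennreal (F x powr q\<^sub>2) \<partial>P)"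
      by (rule ave[where h = "\<lambda>s t. ennreal (s powr q\<^sub>2)"]) measurable
    let ?X = "\<integral>\<^sup>+x. ennreal (\<psi> (T x) powr p + \<psi> (F x) powr p) \<partial>P"
    let ?Y = "ext_infty \<psi> (epow (\<integral>\<^sup>+x. ennreal (F x powr q\<^sub>2) \<partial>P) (1 / q\<^sub>2))"
    have q0: "0 \<le> q\<^sub>1" and s: "0 < q\<^sub>2 / q\<^sub>1" using assms by auto
    have FP: "F \<in> borel_measurable P" "(\<lambda>x. \<psi> (F x)) \<in> borel_measurable P"
      using Fm \<psi>F by (simp_all add: P_def)
    \<comment> \<open>Interpolation takes place between the Sobolev exponent and
      \<open>q\<^sub>2 / q\<^sub>1\<close>; the admissibility condition is then the hypothesis on
      \<gamma>.\<close>
    have "epow (\<integral>\<^sup>+x. ennreal (\<psi> (F x) powr \<gamma>) \<partial>P) (1 / \<gamma>)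
      \<le> epow ?S (\<theta> / ?ps)
        * epow ?S' ((1 - \<theta>) / (q\<^sub>2 / q\<^sub>1))"
      by (rule lyapunov_interpolation[OF P1 FP(2) _ \<gamma> \<theta> ps s])
         (use le psi_nonneg[OF \<psi> q0 F0] in \<open>simp_all add: ps'\<close>)
    also have "\<dots> \<le> (max 1 C * epow ?X (\<theta> / p)) * (ennreal (max 1 E) * epow ?Y (1 - \<theta>))"
    proof (rule mult_mono)
      have "epow ?S (\<theta> / ?ps)
          = epow (epow ?S (1 / ?ps)) \<theta>"
        using ps \<theta> by (simp add: epow_epow)
      also have "\<dots> \<le> epow (C * epow ?X (1 / p)) \<theta>"
        using psi_sobolev[OF \<psi> q0 n p r uG] \<theta> unfolding C_def P_def F_def T_def d
        by (intro epow_mono) auto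
      also have "\<dots> = epow C \<theta> * epow ?X (\<theta> / p)"
        using \<theta> p by (simp add: epow_mult epow_epow)
      also have "\<dots> \<le> max 1 C * epow ?X (\<theta> / p)"
        using \<theta> by (intro mult_right_mono epow_le_max_1) auto
      finally show "epow ?S (\<theta> / ?ps) \<le> max 1 C * epow ?X (\<theta> / p)" .
      have "epow ?S' ((1 - \<theta>) / (q\<^sub>2 / q\<^sub>1))
          = epow (epow ?S' (q\<^sub>1 / q\<^sub>2)) (1 - \<theta>)"
        using assms \<theta> by (simp add: epow_epow mult.commute)
      also have "\<dots> \<le> epow (ennreal E * ?Y) (1 - \<theta>)"
        unfolding E_def using \<theta> by (intro epow_mono psi_Lq_le \<psi> assms P1 FP(1) F0) auto
      also have "\<dots> = epow (ennreal E) (1 - \<theta>) * epow ?Y (1 - \<theta>)"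
        using \<theta> by (intro epow_mult) auto
      also have "\<dots> \<le> max 1 (ennreal E) * epow ?Y (1 - \<theta>)"
        using \<theta> by (intro mult_right_mono epow_le_max_1) auto
      also have "max 1 (ennreal E) = ennreal (max 1 E)"
        using E0 by (auto simp: max_def ennreal_1[symmetric] simp del: ennreal_1)
      finally show "epow ?S' ((1 - \<theta>) / (q\<^sub>2 / q\<^sub>1))
        \<le> ennreal (max 1 E) * epow ?Y (1 - \<theta>)" .
    qed auto
    also have "\<dots> = ennreal c * epow ?X (\<theta> / p) * epow ?Y (1 - \<theta>)"
      unfolding Cr c_def by (simp add: ennreal_mult mult_ac)
    finally show "epow (average (ball z r) (\<lambda>x. ennreal (\<psi> (vec_norm N (\<lambda>i. f x i / r)) powr \<gamma>))) (1 / \<gamma>)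
      \<le> ennreal c
        * epow (average (ball z r) (\<lambda>x. ennreal (\<psi> (mat_norm N (Df x)) powr p
                                         + \<psi> (vec_norm N (\<lambda>i. f x i / r)) powr p))) (\<theta> / p)
        * epow (ext_infty \<psi> (epow (average (ball z r)
              (\<lambda>x. ennreal (vec_norm N (\<lambda>i. f x i / r) powr q\<^sub>2))) (1 / q\<^sub>2))) (1 - \<theta>)"
      unfolding a1 a2 a3 .
  qed
qed

end
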